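(* (Provably in ZFC) The following are equivalent: (i) $\mathbf{Det}(\Sigma^1_1)$: every Gale–Stewart game $G(L)$ with $L\subseteq X^\omega$ an effective analytic ($\Sigma^1_1$) set, $X$ a finite alphabet, is determined; (ii) $\mathbf{Det}(\mathbf{RAT}_\omega)$: for all finite alphabets $\Sigma,\Gamma$ and every infinitary rational relation $R\subseteq \Sigma^\omega\times\Gamma^\omega$, viewed as a subset of $(\Sigma\times\Gamma)^\omega$, the Gale–Stewart game $G(R)$ is determined.
   Context: Gale–Stewart game $G(A)$ for $A\subseteq X^\omega$: Player 1 writes $a_1\in X$, Player 2 writes $b_1\in X$, Player 1 writes $a_2$, etc.; after $\omega$ steps Player 1 wins iff $a_1b_1a_2b_2\cdots\in A$. A strategy for Player 1 is a map $(X^2)^\star\to X$, for Player 2 a map $(X^2)^\star X\to X$; the game is determined if one player has a winning strategy. A 2-tape Büchi automaton is $(K,\Sigma,\Gamma,\Delta,q_0,F)$ with $K$ finite set of states, $\Delta\subseteq K\times\Sigma^\star\times\Gamma^\star\times K$ finite, $q_0$ initial, $F\subseteq K$ accepting; a computation is an infinite sequence of transitions $(q_0,u_1,v_1,q_1),(q_1,u_2,v_2,q_2),\dots$, successful if some state of $F$ occurs infinitely often; it accepts $(u,v)\in\Sigma^\omega\times\Gamma^\omega$ if $u=u_1u_2\cdots$ and $v=v_1v_2\cdots$ for some successful computation. An infinitary rational relation is a set $L(\mathcal A)\subseteq\Sigma^\omega\times\Gamma^\omega$ of pairs accepted by such an automaton; a pair $(u,v)$ is identified with the $\omega$-word over $\Sigma\times\Gamma$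 whose $i$-th letter is $(u(i),v(i))$. A set $L\subseteq X^\omega$ is $\Sigma^1_1$ if it is the projection of a $\Pi^0_2$ (arithmetical) subset of $(X\times\{0,1\})^\omega$. *)

theory Defs
  imports Main "HOL-Library.Omega_Words_Fun" "HOL-Library.Nat_Bijection" "HOL-Library.FuncSet"
begin

section \<open>Gale-Stewart games\<close>

definition omega_words :: "'a set \<Rightarrow> 'a word set" where
  "omega_words X = {x. range x \<subseteq> X}"

text \<open>
  A play is the \<open>\<omega>\<close>-word \<open>a\<^sub>1 b\<^sub>1 a\<^sub>2 b\<^sub>2 \<dots>\<close>: Player 1 writes the letters at the even positions
  (counting from 0), Player 2 those at the odd positions. The first \<open>n\<close> rounds form a word over
  \<open>X \<times> X\<close>, and an element of \<open>(X\<^sup>2)\<^sup>* X\<close> is presented as two successive arguments.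
\<close>

definition rounds :: "'a word \<Rightarrow> nat \<Rightarrow> ('a \<times> 'a) list" where
  "rounds x n = map (\<lambda>i. (x (2 * i), x (2 * i + 1))) [0..<n]"

definition strategy1 :: "'a set \<Rightarrow> (('a \<times> 'a) list \<Rightarrow> 'a) \<Rightarrow> bool" where
  "strategy1 X \<sigma> \<longleftrightarrow> \<sigma> \<in> lists (X \<times> X) \<rightarrow> X"

definition strategy2 :: "'a set \<Rightarrow> (('a \<times> 'a) list \<Rightarrow> 'a \<Rightarrow> 'a) \<Rightarrow> bool" where
  "strategy2 X \<tau> \<longleftrightarrow> \<tau> \<in> lists (X \<times> X) \<rightarrow> (X \<rightarrow> X)"

definition follows1 :: "(('a \<times> 'a) list \<Rightarrow> 'a) \<Rightarrow> 'a word \<Rightarrow> bool" where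
  "follows1 \<sigma> x \<longleftrightarrow> (\<forall>n. x (2 * n) = \<sigma> (rounds x n))"

definition follows2 :: "(('a \<times> 'a) list \<Rightarrow> 'a \<Rightarrow> 'a) \<Rightarrow> 'a word \<Rightarrow> bool" where
  "follows2 \<tau> x \<longleftrightarrow> (\<forall>n. x (2 * n + 1) = \<tau> (rounds x n) (x (2 * n)))"

definition winning1 :: "'a set \<Rightarrow> 'a word set \<Rightarrow> (('a \<times> 'a) list \<Rightarrow> 'a) \<Rightarrow> bool" where
  "winning1 X A \<sigma> \<longleftrightarrow> strategy1 X \<sigma> \<and> (\<forall>x \<in> omega_words X. follows1 \<sigma> x \<longrightarrow> x \<in> A)"

definition winning2 :: "'a set \<Rightarrow> 'a word set \<Rightarrow> (('a \<times> 'a) list \<Rightarrow> 'a \<Rightarrow> 'a) \<Rightarrow> bool" where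
  "winning2 X A \<tau> \<longleftrightarrow> strategy2 X \<tau> \<and> (\<forall>x \<in> omega_words X. follows2 \<tau> x \<longrightarrow> x \<notin> A)"

definition determined :: "'a set \<Rightarrow> 'a word set \<Rightarrow> bool" where
  "determined X A \<longleftrightarrow> (\<exists>\<sigma>. winning1 X A \<sigma>) \<or> (\<exists>\<tau>. winning2 X A \<tau>)"


section \<open>Recursive functions and relations\<close>

text \<open>
  \<open>recursive_fun n f\<close>: \<open>f\<close> restricted to argument lists of length \<open>n\<close> is a total \<open>\<mu>\<close>-recursive
  function of arity \<open>n\<close>; the values of \<open>f\<close> on other lists carry no information. Minimization is
  restricted to regular functions, so only total functions are generated (and all total recursive
  functions, by Kleene's normal form theorem).
\<close>

inductive recursive_fun :: "nat \<Rightarrow> (nat list \<Rightarrow> nat) \<Rightarrow> bool" where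
  zero: "recursive_fun n (\<lambda>_. 0)"
| succ: "recursive_fun 1 (\<lambda>xs. Suc (xs ! 0))"
| proj: "i < n \<Longrightarrow> recursive_fun n (\<lambda>xs. xs ! i)"
| comp: "\<lbrakk>recursive_fun (length gs) f; \<And>g. g \<in> set gs \<Longrightarrow> recursive_fun n g\<rbrakk>
    \<Longrightarrow> recursive_fun n (\<lambda>xs. f (map (\<lambda>g. g xs) gs))"
| prim_rec: "\<lbrakk>recursive_fun n f; recursive_fun (n + 2) g\<rbrakk>
    \<Longrightarrow> recursive_fun (n + 1) (\<lambda>xs. rec_nat (f (tl xs)) (\<lambda>k r. g (k # r # tl xs)) (hd xs))"
| minimization: "\<lbrakk>recursive_fun (n + 1) f; \<And>xs. length xs = n \<Longrightarrow> \<exists>k. f (k # xs) = 0\<rbrakk>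
    \<Longrightarrow> recursive_fun n (\<lambda>xs. LEAST k. f (k # xs) = 0)"

definition recursive_rel :: "(nat \<times> nat list) set \<Rightarrow> bool" where
  "recursive_rel R \<longleftrightarrow>
    (\<exists>f. recursive_fun 2 f \<and>
      (\<forall>a w. f [a, list_encode w] = (if (a, w) \<in> R then 1 else 0)))"


section \<open>Effective analytic sets\<close>

text \<open>
  Finite alphabets are finite sets of natural numbers. A set \<open>L \<subseteq> X\<^sup>\<omega>\<close> is \<open>\<Pi>\<^sup>0\<^sub>2\<close> if, for some recursive
  \<open>R \<subseteq> \<nat> \<times> X\<^sup>*\<close>, it is the set of all \<open>x \<in> X\<^sup>\<omega>\<close> such that for all \<open>a\<close> there is \<open>b\<close> with
  \<open>(a, x[b + 1]) \<in> R\<close>, where \<open>x[n]\<close> is the prefix of length \<open>n\<close>.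
\<close>

definition Pi02 :: "nat set \<Rightarrow> nat word set \<Rightarrow> bool" where
  "Pi02 X L \<longleftrightarrow>
    (\<exists>R. R \<subseteq> UNIV \<times> lists X \<and> recursive_rel R \<and>
      L = {x \<in> omega_words X. \<forall>a. \<exists>b. (a, prefix (Suc b) x) \<in> R})"

text \<open>
  The alphabet \<open>X \<times> {0,1}\<close> is coded as a set of natural numbers by the standard pairing function.
\<close>

definition Sigma11 :: "nat set \<Rightarrow> nat word set \<Rightarrow> bool" where
  "Sigma11 X L \<longleftrightarrow>
    (\<exists>P. Pi02 (prod_encode ` (X \<times> {0, 1})) P \<and>
      L = {x \<in> omega_words X. \<exists>y \<in> omega_words {0, 1}. (\<lambda>i. prod_encode (x i, y i)) \<in> P})"

definition Det_Sigma11 :: bool where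
  "Det_Sigma11 \<longleftrightarrow> (\<forall>X L. finite X \<and> Sigma11 X L \<longrightarrow> determined X L)"


section \<open>Infinitary rational relations\<close>

record ('q, 'a, 'b) buchi2 =
  states :: "'q set"
  trans :: "('q \<times> 'a list \<times> 'b list \<times> 'q) set"
  init :: 'q
  accepting :: "'q set"

definition buchi2_automaton :: "'a set \<Rightarrow> 'b set \<Rightarrow> ('q, 'a, 'b) buchi2 \<Rightarrow> bool" where
  "buchi2_automaton \<Sigma> \<Gamma> M \<longleftrightarrow>
    finite (states M) \<and>
    finite (trans M) \<and> trans M \<subseteq> states M \<times> lists \<Sigma> \<times> lists \<Gamma> \<times> states M \<and>
    init M \<in> states M \<and> accepting M \<subseteq> states M"

text \<open>
  \<open>u = us 0 \<cdot> us 1 \<cdot> us 2 \<dots>\<close>. The factors may be empty; the second conjunct says that the infinite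
  concatenation is an infinite word.
\<close>

definition is_omega_concat :: "'a word \<Rightarrow> (nat \<Rightarrow> 'a list) \<Rightarrow> bool" where
  "is_omega_concat u us \<longleftrightarrow>
    (\<forall>n. concat (prefix n us) = prefix (length (concat (prefix n us))) u) \<and>
    (\<forall>m. \<exists>n. m \<le> length (concat (prefix n us)))"

definition accepts :: "('q, 'a, 'b) buchi2 \<Rightarrow> 'a word \<Rightarrow> 'b word \<Rightarrow> bool" where
  "accepts M u v \<longleftrightarrow>
    (\<exists>q us vs. q 0 = init M \<and> (\<forall>n. (q n, us n, vs n, q (Suc n)) \<in> trans M) \<and>
      limit q \<inter> accepting M \<noteq> {} \<and> is_omega_concat u us \<and> is_omega_concat v vs)"

definition rel_lang :: "'a set \<Rightarrow> 'b set \<Rightarrow> ('q, 'a, 'b) buchi2 \<Rightarrow> ('a word \<times> 'b word) set" where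
  "rel_lang \<Sigma> \<Gamma> M = {(u, v) \<in> omega_words \<Sigma> \<times> omega_words \<Gamma>. accepts M u v}"

definition inf_rational :: "'a set \<Rightarrow> 'b set \<Rightarrow> ('a word \<times> 'b word) set \<Rightarrow> bool" where
  "inf_rational \<Sigma> \<Gamma> R \<longleftrightarrow>
    (\<exists>M :: (nat, 'a, 'b) buchi2. buchi2_automaton \<Sigma> \<Gamma> M \<and> R = rel_lang \<Sigma> \<Gamma> M)"

definition zip_words :: "('a word \<times> 'b word) set \<Rightarrow> ('a \<times> 'b) word set" where
  "zip_words R = (\<lambda>(u, v) i. (u i, v i)) ` R"

definition Det_RAT :: bool where
  "Det_RAT \<longleftrightarrow>
    (\<forall>(\<Sigma> :: nat set) (\<Gamma> :: nat set) R. finite \<Sigma> \<and> finite \<Gamma> \<and> inf_rational \<Sigma> \<Gamma> R \<longrightarrow>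
      determined (\<Sigma> \<times> \<Gamma>) (zip_words R))"

end

theory Submission
  imports Defs
begin

text \<open>
  From (i) to (ii): a run of a 2-tape automaton is coded by a 0-1 word, and being an accepting run
  is a \<open>\<Pi>\<^sup>0\<^sub>2\<close> condition on the pair of this code and the play.

  From (ii) to (i): a set \<open>L\<close> that is \<open>\<Sigma>\<^sup>1\<^sub>1\<close> has the form: \<open>x \<in> L\<close> iff for some \<open>y \<in> {0, 1}\<^sup>\<omega>\<close> there
  are infinitely many \<open>n\<close> such that \<open>G\<close> does not vanish at the first \<open>n + 1\<close> rounds of \<open>x\<close> and the first
  \<open>n\<close> letters of \<open>y\<close>, where \<open>G\<close> is computable. In the new game, Player 2 writes the run of a fixed program
  that reads the rounds of the original game and after round \<open>n\<close> lists the \<open>2 ^ n\<close> nodes of level \<open>n\<close> of the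
  binary tree, marking those where \<open>G\<close> does not vanish. A play is in the relation iff the written run
  contains an error or some branch has infinitely many marked nodes. Both are recognized by a
  nondeterministic automaton with two heads: an error shows in two consecutive configurations, one under
  each head, and a branch is followed by keeping the index \<open>k\<close> of the current node as a distance
  between the heads while passing to \<open>2 * k\<close> or \<open>2 * k + 1\<close>. Hence Player 2 has to be honest, and honest
  plays are in the relation iff the embedded play of the original game is in \<open>L\<close>.
\<close>

section \<open>Recursive functions of a list of arguments\<close>

text \<open>A nondeterministic acceptor can guess a place and verify that a run goes wrong from
  there, but it cannot verify that a run is right. Hence the incorrect plays are accepted, and the
  run is written by the player who loses on acceptance. The machine computes for an unbounded time
  between two rounds of the original game, while in the new game Player 1 writes a letter in every
  round. Such a letter counts as a move only if the run reads it in that round, and the answer of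
  Player 2 is part of the letter that reads it. Strategies may use only the finite past, so their
  transfer rests on causality: a letter of the embedded play is determined by the opponent's earlier
  moves. The index of a node is unbounded and fits into no finite state. As a number of nodes it can
  be doubled by letting one head pass two nodes for each node of the other, since level
  \<open>n + 1\<close> has exactly twice as many nodes as level \<open>n\<close>; this is why whole
  levels are listed, and in increasing order.\<close>

definition recfun :: "nat \<Rightarrow> (nat list \<Rightarrow> nat) \<Rightarrow> bool" where
  "recfun n h \<longleftrightarrow> (\<exists>f. recursive_fun n f \<and> (\<forall>xs. length xs = n \<longrightarrow> f xs = h xs))"

lemma recfunI: "recursive_fun n f \<Longrightarrow> (\<And>xs. length xs = n \<Longrightarrow> f xs = h xs) \<Longrightarrow> recfun n h"
  unfolding recfun_def by blast

text \<open>\<open>recursive_fun\<close> is a property of a function on lists of all lengths, while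
  only the values on lists of length \<open>n\<close> matter. Closing it under agreement there frees
  the later rules from the exact shape of \<open>comp\<close>, \<open>prim_rec\<close> and
  \<open>minimization\<close>.\<close>

lemma recfun_cong: "recfun n h \<Longrightarrow> (\<And>xs. length xs = n \<Longrightarrow> h xs = h' xs) \<Longrightarrow> recfun n h'"
  unfolding recfun_def by metis

lemma recfun_proj: "i < n \<Longrightarrow> recfun n (\<lambda>xs. xs ! i)"
  by (rule recfunI[OF recursive_fun.proj]) auto

lemma recfun_comp:
  assumes "recfun (length gs) h" and "\<And>g. g \<in> set gs \<Longrightarrow> recfun n g"
  shows "recfun n (\<lambda>xs. h (map (\<lambda>g. g xs) gs))"
proof -
  obtain f where f: "recursive_fun (length gs) f" "\<And>xs. length xs = length gs \<Longrightarrow> f xs = h xs"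
    using assms(1) unfolding recfun_def by blast
  obtain F where F: "\<And>g. g \<in> set gs \<Longrightarrow> recursive_fun n (F g) \<and> (\<forall>xs. length xs = n \<longrightarrow> F g xs = g xs)"
    using assms(2) unfolding recfun_def by metis
  have "recursive_fun n (\<lambda>xs. f (map (\<lambda>g. g xs) (map F gs)))"
    by (rule recursive_fun.comp) (use f F in auto)
  then show ?thesis
  proof (rule recfunI)
    fix xs :: "nat list"
    assume l: "length xs = n"
    have "map (\<lambda>g. g xs) (map F gs) = map (\<lambda>g. g xs) gs" using F l by simp
    then show "f (map (\<lambda>g. g xs) (map F gs)) = h (map (\<lambda>g. g xs) gs)"
      using f(2)[of "map (\<lambda>g. g xs) gs"] by (simp only: length_map)
  qed
qed

lemma recfun_comp1:
  assumes "recfun 1 (\<lambda>xs. f (xs ! 0))" "recfun n g"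
  shows "recfun n (\<lambda>xs. f (g xs))"
  using recfun_comp[of "[g]" "\<lambda>xs. f (xs ! 0)" n] assms by simp

lemma recfun_comp2:
  assumes "recfun 2 (\<lambda>xs. f (xs ! 0) (xs ! 1))" "recfun n g" "recfun n h"
  shows "recfun n (\<lambda>xs. f (g xs) (h xs))"
  using recfun_comp[of "[g, h]" "\<lambda>xs. f (xs ! 0) (xs ! 1)" n] assms by (auto simp: numeral_2_eq_2)

lemma recfun_Suc: "recfun n g \<Longrightarrow> recfun n (\<lambda>xs. Suc (g xs))"
  by (rule recfun_comp1[where f = Suc]) (rule recfunI[OF recursive_fun.succ], simp)

lemma recfun_const: "recfun n (\<lambda>_. c)"
proof (induction c)
  case 0
  show ?case by (rule recfunI[OF recursive_fun.zero]) auto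
next
  case (Suc c)
  then show ?case by (rule recfun_Suc)
qed

text \<open>\<open>prim_rec\<close> recurses on the head of the list with the tail as parameters.
  Composing it with \<open>m\<close> followed by all \<open>n\<close> projections gives recursion up
  to a computed bound with the whole list as parameter.\<close>

lemma recfun_rec:
  assumes b: "recfun n b" and g: "recfun (n + 2) (\<lambda>xs. g (xs ! 0) (xs ! 1) (drop 2 xs))" and m: "recfun n m"
  shows "recfun n (\<lambda>xs. rec_nat (b xs) (\<lambda>k r. g k r xs) (m xs))"
proof -
  obtain b' where b': "recursive_fun n b'" "\<And>xs. length xs = n \<Longrightarrow> b' xs = b xs"
    using b unfolding recfun_def by blast
  obtain g' where g': "recursive_fun (n + 2) g'"
    "\<And>xs. length xs = n + 2 \<Longrightarrow> g' xs = g (xs ! 0) (xs ! 1) (drop 2 xs)"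
    using g unfolding recfun_def by blast
  have 1: "recfun (n + 1) (\<lambda>xs. rec_nat (b' (tl xs)) (\<lambda>k r. g' (k # r # tl xs)) (hd xs))"
    by (rule recfunI[OF recursive_fun.prim_rec[OF b'(1) g'(1)]]) auto
  let ?ps = "map (\<lambda>i xs. xs ! i) [0..<n] :: (nat list \<Rightarrow> nat) list"
  have id: "map (\<lambda>g. g xs) ?ps = xs" if "length xs = n" for xs :: "nat list"
    using that by (auto intro: nth_equalityI)
  have "recfun n (\<lambda>xs. (\<lambda>xs. rec_nat (b' (tl xs)) (\<lambda>k r. g' (k # r # tl xs)) (hd xs)) (map (\<lambda>g. g xs) (m # ?ps)))"
    by (rule recfun_comp) (use 1 m in \<open>auto intro: recfun_proj\<close>)
  then show ?thesis
  proof (rule recfun_cong)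
    fix xs :: "nat list"
    assume l: "length xs = n"
    have "rec_nat (b' xs) (\<lambda>k r. g' (k # r # xs)) (m xs) = rec_nat (b xs) (\<lambda>k r. g k r xs) (m xs)"
      using l b' g' by simp
    then show "rec_nat (b' (tl (map (\<lambda>g. g xs) (m # ?ps)))) (\<lambda>k r. g' (k # r # tl (map (\<lambda>g. g xs) (m # ?ps))))
        (hd (map (\<lambda>g. g xs) (m # ?ps))) = rec_nat (b xs) (\<lambda>k r. g k r xs) (m xs)"
      using id[OF l] by simp
  qed
qed

lemma recfun_Least:
  assumes f: "recfun (n + 1) (\<lambda>xs. f (xs ! 0) (tl xs))" and ex: "\<And>xs. length xs = n \<Longrightarrow> \<exists>k. f k xs = 0"
  shows "recfun n (\<lambda>xs. LEAST k. f k xs = 0)"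
proof -
  obtain f' where f': "recursive_fun (n + 1) f'" "\<And>xs. length xs = n + 1 \<Longrightarrow> f' xs = f (xs ! 0) (tl xs)"
    using f unfolding recfun_def by blast
  show ?thesis
    by (rule recfunI[OF recursive_fun.minimization[OF f'(1)]]) (use f' ex in auto)
qed

lemma recfun_pred: "recfun n g \<Longrightarrow> recfun n (\<lambda>xs. g xs - 1)"
proof -
  assume g: "recfun n g"
  have "recfun n (\<lambda>xs. rec_nat 0 (\<lambda>k r. k) (g xs))"
    by (rule recfun_rec) (auto intro: recfun_const recfun_proj g)
  moreover have "rec_nat 0 (\<lambda>k r. k) m = m - 1" for m :: nat by (cases m) auto
  ultimately show ?thesis by simp
qed

lemma recfun_add: "recfun n g \<Longrightarrow> recfun n h \<Longrightarrow> recfun n (\<lambda>xs. g xs + h xs)"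
proof -
  assume g: "recfun n g" "recfun n h"
  have "recfun n (\<lambda>xs. rec_nat (g xs) (\<lambda>k r. Suc r) (h xs))"
    by (rule recfun_rec) (auto intro: recfun_Suc recfun_proj g)
  moreover have "rec_nat a (\<lambda>k r. Suc r) m = a + m" for a m :: nat by (induction m) auto
  ultimately show ?thesis by simp
qed

lemma recfun_diff: "recfun n g \<Longrightarrow> recfun n h \<Longrightarrow> recfun n (\<lambda>xs. g xs - h xs)"
proof -
  assume g: "recfun n g" "recfun n h"
  have "recfun n (\<lambda>xs. rec_nat (g xs) (\<lambda>k r. r - 1) (h xs))"
    by (rule recfun_rec[where g = "\<lambda>k r _. r - 1"]) (rule g recfun_pred recfun_proj | simp)+
  moreover have "rec_nat a (\<lambda>k r. r - 1) m = a - m" for a m :: nat by (induction m) auto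
  ultimately show ?thesis by simp
qed

lemma triangle_rec: "triangle m = rec_nat 0 (\<lambda>k r. r + Suc k) m"
  by (induction m) auto

lemma recfun_triangle: "recfun n g \<Longrightarrow> recfun n (\<lambda>xs. triangle (g xs))"
  unfolding triangle_rec
  by (rule recfun_rec[where g = "\<lambda>k r _. r + Suc k"]) (auto intro!: recfun_add recfun_Suc recfun_const recfun_proj)

lemma recfun_prod_encode: "recfun n g \<Longrightarrow> recfun n h \<Longrightarrow> recfun n (\<lambda>xs. prod_encode (g xs, h xs))"
  unfolding prod_encode_def by (auto intro!: recfun_add recfun_triangle)

lemma strict_mono_triangle: "strict_mono triangle"
  by (rule strict_mono_Suc_iff[THEN iffD2]) auto

text \<open>\<open>prod_encode (a, b) = triangle (a + b) + a\<close> enumerates the diagonals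
  \<open>a + b\<close>. A code lies on the last diagonal whose first code does not exceed it, so an
  unbounded search finds the diagonal, and both projections become recursive.\<close>

lemma triangle_root_prod_encode:
  "(LEAST k. Suc (prod_encode (a, b)) - triangle (Suc k) = 0) = a + b"
proof (rule Least_equality)
  show "Suc (prod_encode (a, b)) - triangle (Suc (a + b)) = 0" by (simp add: prod_encode_def)
next
  fix k assume "Suc (prod_encode (a, b)) - triangle (Suc k) = 0"
  then have "triangle (a + b) < triangle (Suc k)" by (simp add: prod_encode_def del: triangle_Suc)
  then have "a + b < Suc k" using strict_mono_less[OF strict_mono_triangle] by blast
  then show "a + b \<le> k" by simp
qed

lemma recfun_triangle_root:
  "recfun n g \<Longrightarrow> recfun n (\<lambda>xs. LEAST k. Suc (g xs) - triangle (Suc k) = 0)"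
proof (rule recfun_Least)
  fix xs :: "nat list"
  have "g xs < triangle (Suc (g xs))" using strict_mono_imp_increasing[OF strict_mono_triangle, of "Suc (g xs)"] by linarith
  then show "\<exists>k. Suc (g xs) - triangle (Suc k) = 0" by (intro exI[of _ "g xs"]) simp
next
  assume g: "recfun n g"
  have tl: "recfun (n + 1) (\<lambda>xs. g (tl xs))"
  proof -
    have "recfun (n + 1) (\<lambda>xs. g (map (\<lambda>g. g xs) (map (\<lambda>i xs. xs ! Suc i) [0..<n])))"
      by (rule recfun_comp) (auto intro: recfun_proj g)
    then show ?thesis
      by (rule recfun_cong) (auto intro!: arg_cong[of _ _ g] nth_equalityI simp: nth_tl)
  qed
  show "recfun (n + 1) (\<lambda>xs. Suc (g (tl xs)) - triangle (Suc (xs ! 0)))"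
    by (intro recfun_diff recfun_Suc recfun_triangle recfun_proj tl) auto
qed

abbreviation pfst :: "nat \<Rightarrow> nat" where "pfst z \<equiv> fst (prod_decode z)"
abbreviation psnd :: "nat \<Rightarrow> nat" where "psnd z \<equiv> snd (prod_decode z)"

lemma pfst_formula: "pfst z = z - triangle (LEAST k. Suc z - triangle (Suc k) = 0)"
proof -
  obtain a b where z: "z = prod_encode (a, b)" by (metis prod.exhaust prod_decode_inverse)
  have "prod_encode (a, b) - triangle (a + b) = a" by (simp add: prod_encode_def)
  then show ?thesis unfolding z triangle_root_prod_encode by simp
qed

lemma psnd_formula: "psnd z = (LEAST k. Suc z - triangle (Suc k) = 0) - pfst z"
proof -
  obtain a b where z: "z = prod_encode (a, b)" by (metis prod.exhaust prod_decode_inverse)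
  show ?thesis unfolding z triangle_root_prod_encode by simp
qed

lemma recfun_pfst: "recfun n g \<Longrightarrow> recfun n (\<lambda>xs. pfst (g xs))"
  unfolding pfst_formula by (intro recfun_diff recfun_triangle recfun_triangle_root)

lemma recfun_psnd: "recfun n g \<Longrightarrow> recfun n (\<lambda>xs. psnd (g xs))"
  unfolding psnd_formula by (intro recfun_diff recfun_pfst recfun_triangle_root)

section \<open>Computable functions of one argument\<close>

text \<open>Several arguments are packed into one by \<open>prod_encode\<close>, so that the closure
  rules below need no arities.\<close>

definition computable :: "(nat \<Rightarrow> nat) \<Rightarrow> bool" where
  "computable f \<longleftrightarrow> recfun 1 (\<lambda>xs. f (xs ! 0))"

lemma computable_id: "computable (\<lambda>x. x)"
  unfolding computable_def by (rule recfun_proj) simp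

lemma computable_const: "computable (\<lambda>x. c)"
  unfolding computable_def by (rule recfun_const)

lemma computable_comp: "computable f \<Longrightarrow> computable g \<Longrightarrow> computable (\<lambda>x. f (g x))"
  unfolding computable_def by (rule recfun_comp1)

lemma computable_Suc: "computable f \<Longrightarrow> computable (\<lambda>x. Suc (f x))"
  unfolding computable_def by (rule recfun_Suc)

lemma computable_add: "computable f \<Longrightarrow> computable g \<Longrightarrow> computable (\<lambda>x. f x + g x)"
  unfolding computable_def by (rule recfun_add)

lemma computable_diff: "computable f \<Longrightarrow> computable g \<Longrightarrow> computable (\<lambda>x. f x - g x)"
  unfolding computable_def by (rule recfun_diff)

lemma computable_prod_encode: "computable f \<Longrightarrow> computable g \<Longrightarrow> computable (\<lambda>x. prod_encode (f x, g x))"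
  unfolding computable_def by (rule recfun_prod_encode)

lemma computable_pfst: "computable f \<Longrightarrow> computable (\<lambda>x. pfst (f x))"
  unfolding computable_def by (rule recfun_pfst)

lemma computable_psnd: "computable f \<Longrightarrow> computable (\<lambda>x. psnd (f x))"
  unfolding computable_def by (rule recfun_psnd)

lemma recfun_computable: "computable f \<Longrightarrow> recfun n g \<Longrightarrow> recfun n (\<lambda>xs. f (g xs))"
  unfolding computable_def by (rule recfun_comp1)

text \<open>In the step function the code \<open>z\<close> stands for \<open>(k, (r, x))\<close>;
  the parameter \<open>x\<close> is carried through the recursion.\<close>

lemma computable_rec:
  assumes b: "computable b" and m: "computable m"
    and g: "computable (\<lambda>z. g (pfst z) (pfst (psnd z)) (psnd (psnd z)))"
  shows "computable (\<lambda>x. rec_nat (b x) (\<lambda>k r. g k r x) (m x))"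
  unfolding computable_def
proof (rule recfun_rec[where g = "\<lambda>k r xs. g k r (xs ! 0)"])
  have "recfun (1 + 2) (\<lambda>xs. (\<lambda>z. g (pfst z) (pfst (psnd z)) (psnd (psnd z)))
      (prod_encode (xs ! 0, prod_encode (xs ! 1, xs ! 2))))"
    by (rule recfun_computable[OF g]) (auto intro!: recfun_prod_encode recfun_proj)
  then show "recfun (1 + 2) (\<lambda>xs. g (xs ! 0) (xs ! 1) (drop 2 xs ! 0))"
    by (rule recfun_cong) auto
qed (use b m in \<open>auto simp: computable_def\<close>)

lemma computable_Least_zero:
  assumes f: "computable (\<lambda>z. f (pfst z) (psnd z))" and ex: "\<And>x. \<exists>k. f k x = 0"
  shows "computable (\<lambda>x. LEAST k. f k x = 0)"
  unfolding computable_def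
proof (rule recfun_Least[where f = "\<lambda>k xs. f k (xs ! 0)"])
  have "recfun (1 + 1) (\<lambda>xs. (\<lambda>z. f (pfst z) (psnd z)) (prod_encode (xs ! 0, xs ! 1)))"
    by (rule recfun_computable[OF f]) (auto intro!: recfun_prod_encode recfun_proj)
  then show "recfun (1 + 1) (\<lambda>xs. f (xs ! 0) (tl xs ! 0))"
    by (rule recfun_cong) (auto simp: nth_tl)
qed (rule ex)

section \<open>Decidable predicates, division and finite tables\<close>

definition decidable :: "(nat \<Rightarrow> bool) \<Rightarrow> bool" where
  "decidable P \<longleftrightarrow> computable (\<lambda>x. if P x then 1 else 0)"

lemma decidable_nonzero: "computable f \<Longrightarrow> decidable (\<lambda>x. f x \<noteq> 0)"
proof -
  assume "computable f"
  then have "computable (\<lambda>x. 1 - (1 - f x))" by (intro computable_diff computable_const)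
  moreover have "(\<lambda>x. 1 - (1 - f x)) = (\<lambda>x. if f x \<noteq> 0 then 1 else 0)" by auto
  ultimately show ?thesis unfolding decidable_def by simp
qed

lemma decidable_not: "decidable P \<Longrightarrow> decidable (\<lambda>x. \<not> P x)"
proof -
  assume "decidable P"
  then have "computable (\<lambda>x. 1 - (if P x then 1 else 0))" unfolding decidable_def
    by (intro computable_diff computable_const)
  then have "decidable (\<lambda>x. 1 - (if P x then 1 else 0) \<noteq> (0::nat))" by (rule decidable_nonzero)
  then show ?thesis by (simp split: if_splits)
qed

lemma decidable_disj: "decidable P \<Longrightarrow> decidable Q \<Longrightarrow> decidable (\<lambda>x. P x \<or> Q x)"
proof -
  assume "decidable P" "decidable Q"
  then have "computable (\<lambda>x. (if P x then 1 else 0) + (if Q x then 1 else 0))"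
    unfolding decidable_def by (rule computable_add)
  from decidable_nonzero[OF this] show ?thesis by (simp split: if_splits)
qed

lemma decidable_conj: "decidable P \<Longrightarrow> decidable Q \<Longrightarrow> decidable (\<lambda>x. P x \<and> Q x)"
  using decidable_not[OF decidable_disj[OF decidable_not decidable_not], of P Q] by simp

lemma decidable_less: "computable f \<Longrightarrow> computable g \<Longrightarrow> decidable (\<lambda>x. f x < g x)"
proof -
  assume "computable f" "computable g"
  then have "decidable (\<lambda>x. g x - f x \<noteq> 0)" by (intro decidable_nonzero computable_diff)
  moreover have "(\<lambda>x. g x - f x \<noteq> 0) = (\<lambda>x. f x < g x)" by auto
  ultimately show ?thesis by simp
qed

lemma decidable_le: "computable f \<Longrightarrow> computable g \<Longrightarrow> decidable (\<lambda>x. f x \<le> g x)"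
  using decidable_not[OF decidable_less, of g f] by (simp add: not_less)

lemma decidable_eq: "computable f \<Longrightarrow> computable g \<Longrightarrow> decidable (\<lambda>x. f x = g x)"
  using decidable_conj[OF decidable_le decidable_le, of f g g f] by (simp add: eq_iff)

text \<open>A conditional is a primitive recursion of length 0 or 1.\<close>

lemma computable_if:
  assumes "decidable P" "computable f" "computable g"
  shows "computable (\<lambda>x. if P x then f x else g x)"
proof -
  have "computable (\<lambda>x. rec_nat (g x) (\<lambda>k r. f x) (if P x then 1 else 0))"
    by (rule computable_rec[where g = "\<lambda>k r x. f x"])
      (use assms in \<open>auto intro!: computable_comp[of f] computable_psnd computable_id simp: decidable_def\<close>)
  moreover have "rec_nat (g x) (\<lambda>k r. f x) (if P x then 1 else 0) = (if P x then f x else g x)" for x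
    by simp
  ultimately show ?thesis by simp
qed

lemma decidable_All_less:
  assumes P: "decidable (\<lambda>z. P (pfst z) (psnd z))" and n: "computable n"
  shows "decidable (\<lambda>x. \<forall>k<n x. P k x)"
proof -
  have "computable (\<lambda>x. rec_nat 1 (\<lambda>k r. if P k x then r else 0) (n x))"
  proof (rule computable_rec[where g = "\<lambda>k r x. if P k x then r else 0"])
    have "computable (\<lambda>z. (\<lambda>z. if P (pfst z) (psnd z) then 1 else 0) (prod_encode (pfst z, psnd (psnd z))))"
      by (rule computable_comp[where f = "\<lambda>z. if P (pfst z) (psnd z) then 1 else 0"])
        (use P in \<open>auto intro!: computable_prod_encode computable_psnd computable_pfst computable_id simp: decidable_def\<close>)
    then have "decidable (\<lambda>z. P (pfst z) (psnd (psnd z)))" by (simp add: decidable_def)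
    then show "computable (\<lambda>z. if P (pfst z) (psnd (psnd z)) then pfst (psnd z) else 0)"
      by (intro computable_if computable_pfst computable_psnd computable_id computable_const)
  qed (use n in \<open>auto intro: computable_const\<close>)
  moreover have "rec_nat 1 (\<lambda>k r. if P k x then r else 0) m = (if \<forall>k<m. P k x then 1 else (0::nat))" for m x
    by (induction m) (auto simp: less_Suc_eq)
  ultimately show ?thesis by (simp only: decidable_def)
qed

lemma decidable_Ex_less:
  assumes P: "decidable (\<lambda>z. P (pfst z) (psnd z))" and n: "computable n"
  shows "decidable (\<lambda>x. \<exists>k<n x. P k x)"
  using decidable_not[OF decidable_All_less[OF decidable_not, of P n]] assms by simp

lemma computable_Least:
  assumes P: "decidable (\<lambda>z. P (pfst z) (psnd z))" and ex: "\<And>x. \<exists>k. P k x"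
  shows "computable (\<lambda>x. LEAST k. P k x)"
proof -
  have "computable (\<lambda>x. LEAST k. (if \<not> P k x then 1 else 0) = (0::nat))"
    by (rule computable_Least_zero) (use decidable_not[OF P] ex in \<open>auto simp: decidable_def\<close>)
  then show ?thesis by (simp split: if_splits cong: if_cong)
qed

lemma computable_mult: "computable f \<Longrightarrow> computable g \<Longrightarrow> computable (\<lambda>x. f x * g x)"
proof -
  assume fg: "computable f" "computable g"
  have "computable (\<lambda>x. rec_nat 0 (\<lambda>k r. r + f x) (g x))"
    by (rule computable_rec[where g = "\<lambda>k r x. r + f x"])
      (use fg in \<open>auto intro!: computable_add computable_comp[of f] computable_psnd computable_pfst computable_id computable_const\<close>)
  moreover have "rec_nat 0 (\<lambda>k r. r + a) b = a * b" for a b :: nat by (induction b) auto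
  ultimately show ?thesis by simp
qed

lemma computable_pow2: "computable g \<Longrightarrow> computable (\<lambda>x. 2 ^ g x)"
proof -
  assume g: "computable g"
  have "computable (\<lambda>x. rec_nat 1 (\<lambda>k r. r * 2) (g x))"
    by (rule computable_rec[where g = "\<lambda>k r x. r * 2"])
      (use g in \<open>auto intro!: computable_mult computable_psnd computable_pfst computable_id computable_const\<close>)
  moreover have "rec_nat 1 (\<lambda>k r. r * 2) b = (2::nat) ^ b" for b by (induction b) auto
  ultimately show ?thesis by simp
qed

text \<open>The disjunct \<open>b = 0\<close> makes the search succeed at once with value
  \<open>0\<close>, which agrees with \<open>a div 0 = 0\<close> and keeps the minimization
  total.\<close>

lemma div_Least: "a div b = (LEAST q. b = 0 \<or> a < Suc q * b)" for a b :: nat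
proof (cases "b = 0")
  case False
  show ?thesis
  proof (rule Least_equality[symmetric])
    show "b = 0 \<or> a < Suc (a div b) * b"
      using False dividend_less_times_div[of b a] by (simp add: mult.commute)
    show "a div b \<le> q" if "b = 0 \<or> a < Suc q * b" for q
      using that False less_mult_imp_div_less[of a "Suc q" b] by simp
  qed
qed (simp add: Least_equality)

lemma computable_div: "computable f \<Longrightarrow> computable g \<Longrightarrow> computable (\<lambda>x. f x div g x)"
  unfolding div_Least
proof (rule computable_Least)
  fix x show "\<exists>k. g x = 0 \<or> f x < Suc k * g x"
    by (intro exI[of _ "f x"]) (cases "g x", auto)
qed (auto intro!: decidable_disj decidable_less decidable_eq computable_mult computable_Suc computable_const
    computable_pfst computable_comp[of f "psnd"] computable_comp[of g "psnd"] computable_psnd computable_id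
    simp del: mult_Suc)

lemma computable_mod: "computable f \<Longrightarrow> computable g \<Longrightarrow> computable (\<lambda>x. f x mod g x)"
  using computable_diff[OF _ computable_mult[OF _ computable_div], of f g f g] by (simp add: minus_mult_div_eq_mod)

lemma decidable_member: "finite F \<Longrightarrow> computable f \<Longrightarrow> decidable (\<lambda>x. f x \<in> F)"
proof (induction F rule: finite_induct)
  case empty
  then show ?case by (simp add: decidable_def computable_const)
next
  case (insert a F)
  then show ?case by (auto intro!: decidable_disj decidable_eq computable_const)
qed

text \<open>Such a function is a finite table. The transition table of an automaton enters the
  arithmetical test of runs in this way.\<close>

lemma computable_finite_support:
  assumes "finite F" "\<And>x. x \<notin> F \<Longrightarrow> h x = 0" "computable f"
  shows "computable (\<lambda>x. h (f x))"
proof -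
  have "computable h" using assms(1,2)
  proof (induction F arbitrary: h rule: finite_induct)
    case empty
    then have "h = (\<lambda>x. 0)" by auto
    then show ?case by (simp add: computable_const)
  next
    case (insert a F)
    have "computable (h(a := 0))" by (rule insert.IH) (use insert in auto)
    then have "computable (\<lambda>x. if x = a then h a else (h(a := 0)) x)"
      by (intro computable_if decidable_eq computable_id computable_const)
    moreover have "(\<lambda>x. if x = a then h a else (h(a := 0)) x) = h" by auto
    ultimately show ?case by simp
  qed
  then show ?thesis using assms(3) by (rule computable_comp)
qed

named_theorems computable_intros

lemmas [computable_intros] = computable_id computable_const computable_Suc computable_add computable_diff
  computable_prod_encode computable_pfst computable_psnd computable_mult computable_div computable_mod
  computable_pow2 computable_if decidable_not decidable_disj decidable_conj decidable_less
  decidable_le decidable_eq decidable_All_less decidable_Ex_less computable_rec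

section \<open>Codes of lists\<close>

text \<open>With \<open>0 - 1 = 0\<close> the code \<open>0\<close> of the empty list becomes its
  own tail, so iterated tails reach \<open>0\<close> exactly from the length of the list on.\<close>

lemma prod_decode_0: "prod_decode 0 = (0, 0)"
  using prod_encode_inverse[of "(0, 0)"] by (simp add: prod_encode_def)

definition tl_code :: "nat \<Rightarrow> nat" where "tl_code W = psnd (W - 1)"
definition hd_code :: "nat \<Rightarrow> nat" where "hd_code W = pfst (W - 1)"
definition nth_code :: "nat \<Rightarrow> nat \<Rightarrow> nat" where "nth_code W i = hd_code (rec_nat W (\<lambda>_. tl_code) i)"
definition length_code :: "nat \<Rightarrow> nat" where "length_code W = (LEAST k. rec_nat W (\<lambda>_. tl_code) k = 0)"

lemma tl_code_encode: "tl_code (list_encode w) = list_encode (tl w)"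
  by (cases w) (auto simp: tl_code_def prod_decode_0)

lemma hd_code_encode: "w \<noteq> [] \<Longrightarrow> hd_code (list_encode w) = hd w"
  by (cases w) (auto simp: hd_code_def)

lemma rec_tl_code_encode: "rec_nat (list_encode w) (\<lambda>_. tl_code) k = list_encode (drop k w)"
  by (induction k) (auto simp: tl_code_encode drop_Suc tl_drop)

lemma nth_code_encode: "i < length w \<Longrightarrow> nth_code (list_encode w) i = w ! i"
  unfolding nth_code_def rec_tl_code_encode by (simp add: hd_code_encode hd_drop_conv_nth)

lemma list_encode_eq_0: "list_encode w = 0 \<longleftrightarrow> w = []"
  by (cases w) auto

lemma length_code_encode: "length_code (list_encode w) = length w"
  unfolding length_code_def rec_tl_code_encode list_encode_eq_0 by (rule Least_equality) auto

lemma computable_rec_tl_code: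
  "computable f \<Longrightarrow> computable g \<Longrightarrow> computable (\<lambda>x. rec_nat (f x) (\<lambda>_. tl_code) (g x))"
  unfolding tl_code_def[abs_def]
  by (rule computable_rec[where g = "\<lambda>k r x. psnd (r - 1)"]) (assumption | intro computable_intros)+

lemma computable_nth_code [computable_intros]:
  "computable f \<Longrightarrow> computable g \<Longrightarrow> computable (\<lambda>x. nth_code (f x) (g x))"
  unfolding nth_code_def hd_code_def by (intro computable_intros computable_rec_tl_code)

lemma computable_length_code [computable_intros]: "computable f \<Longrightarrow> computable (\<lambda>x. length_code (f x))"
  unfolding length_code_def
proof (rule computable_Least)
  fix x
  show "\<exists>k. rec_nat (f x) (\<lambda>_. tl_code) k = 0"
    using rec_tl_code_encode[of "list_decode (f x)" "length (list_decode (f x))"] by auto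
qed (auto intro!: computable_intros computable_rec_tl_code computable_comp[of f])

text \<open>The recursion can only add entries at the front, so the list is built from its last
  entry: step \<open>k\<close> adds the entry with index \<open>n - Suc k\<close>.\<close>

lemma list_encode_map_rec:
  "list_encode (map h [0..<n]) = rec_nat 0 (\<lambda>k r. Suc (prod_encode (h (n - Suc k), r))) n"
proof -
  have "rec_nat 0 (\<lambda>k r. Suc (prod_encode (h (n - Suc k), r))) m = list_encode (map h [n - m..<n])" if "m \<le> n" for m
    using that
  proof (induction m)
    case (Suc m)
    have "[n - Suc m..<n] = (n - Suc m) # [n - m..<n]"
      using Suc.prems by (metis Suc_diff_Suc Suc_le_lessD diff_less less_nat_zero_code linorder_not_less upt_conv_Cons zero_less_Suc le_zero_eq not_less_eq_eq)
    then show ?case using Suc by simp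
  qed simp
  from this[of n] show ?thesis by simp
qed

lemma computable_list_encode_map:
  assumes "computable (\<lambda>z. h (pfst z) (psnd z))" "computable n"
  shows "computable (\<lambda>x. list_encode (map (\<lambda>i. h i x) [0..<n x]))"
proof -
  have n: "computable (\<lambda>z. n (psnd (psnd z)) - Suc (pfst z))"
    by (intro computable_intros computable_comp[OF assms(2)])
  have "computable (\<lambda>z. (\<lambda>z. h (pfst z) (psnd z)) (prod_encode (n (psnd (psnd z)) - Suc (pfst z), psnd (psnd z))))"
    by (rule computable_comp[where f = "\<lambda>z. h (pfst z) (psnd z)"]) (intro computable_intros assms n)+
  then have h: "computable (\<lambda>z. h (n (psnd (psnd z)) - Suc (pfst z)) (psnd (psnd z)))" by simp
  show ?thesis
    unfolding list_encode_map_rec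
    by (rule computable_rec[where g = "\<lambda>k r x. Suc (prod_encode (h (n x - Suc k) x, r))"])
      (intro computable_intros assms h)+
qed

lemma decidable_recursive_rel:
  assumes "recursive_rel R"
  shows "decidable (\<lambda>z. (pfst z, list_decode (psnd z)) \<in> R)"
proof -
  obtain f where f: "recursive_fun 2 f" "\<And>a w. f [a, list_encode w] = (if (a, w) \<in> R then 1 else 0)"
    using assms unfolding recursive_rel_def by blast
  have "recfun 2 (\<lambda>xs. f [xs ! 0, xs ! 1])"
    by (rule recfunI[OF f(1)]) (auto simp: length_Suc_conv numeral_2_eq_2)
  then have "computable (\<lambda>z. f [pfst z, psnd z])" unfolding computable_def
    by (rule recfun_comp2[where f = "\<lambda>a b. f [a, b]"]) (auto intro!: recfun_pfst recfun_psnd recfun_proj)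
  moreover have "f [a, b] = (if (a, list_decode b) \<in> R then 1 else 0)" for a b
    using f(2)[of a "list_decode b"] by simp
  ultimately show ?thesis by (simp add: decidable_def)
qed

lemma recursive_relI:
  assumes "decidable (\<lambda>z. (pfst z, list_decode (psnd z)) \<in> R)"
  shows "recursive_rel R"
proof -
  have "recfun 2 (\<lambda>xs. (\<lambda>z. if (pfst z, list_decode (psnd z)) \<in> R then 1 else 0) (prod_encode (xs ! 0, xs ! 1)))"
    by (rule recfun_computable) (use assms in \<open>auto simp: decidable_def intro!: recfun_prod_encode recfun_proj\<close>)
  then obtain f where f: "recursive_fun 2 f"
    "\<And>xs. length xs = 2 \<Longrightarrow> f xs = (if (xs ! 0, list_decode (xs ! 1)) \<in> R then 1 else 0)"
    unfolding recfun_def by auto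
  then show ?thesis unfolding recursive_rel_def by (intro exI[of _ f]) auto
qed

section \<open>Rational relations are effective analytic\<close>

lemma prefix_Suc: "prefix (Suc n) w = prefix n w @ [w n]"
  by (simp add: subsequence_def)

text \<open>A factorization is given by its cut positions \<open>pos\<close>, because these are what
  can be computed from a coded run.\<close>

lemma is_omega_concatI:
  assumes "pos 0 = 0" "\<And>n. pos n \<le> pos (Suc n)" "\<And>n. us n = map u [pos n..<pos (Suc n)]" "\<And>m. \<exists>n. m \<le> pos n"
  shows "is_omega_concat u us"
proof -
  have *: "concat (prefix n us) = map u [0..<pos n]" for n
  proof (induction n)
    case (Suc n)
    have "[0..<pos (Suc n)] = [0..<pos n] @ [pos n..<pos (Suc n)]"
      using assms(2)[of n] upt_add_eq_append[of 0 "pos n" "pos (Suc n) - pos n"] by simp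
    then show ?case using Suc assms(3) by (simp add: prefix_Suc)
  qed (simp add: assms)
  show ?thesis unfolding is_omega_concat_def * using assms(4) by (auto simp: subsequence_def)
qed

lemma is_omega_concatD:
  assumes "is_omega_concat u us"
  defines "pos \<equiv> \<lambda>n. length (concat (prefix n us))"
  shows "pos 0 = 0" "pos (Suc n) = pos n + length (us n)" "us n = map u [pos n..<pos (Suc n)]" "\<exists>n. m \<le> pos n"
proof -
  show "pos 0 = 0" by (simp add: pos_def)
  show s: "pos (Suc n) = pos n + length (us n)" by (simp add: pos_def prefix_Suc)
  have *: "concat (prefix n us) = map u [0..<pos n]" for n
    using assms(1) unfolding is_omega_concat_def pos_def subsequence_def by metis
  have "[0..<pos (Suc n)] = [0..<pos n] @ [pos n..<pos (Suc n)]"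
    using upt_add_eq_append[of 0 "pos n" "length (us n)"] s by simp
  then have "concat (prefix n us) @ us n = concat (prefix n us) @ map u [pos n..<pos (Suc n)]"
    using *[of "Suc n"] *[of n] by (simp add: prefix_Suc)
  then show "us n = map u [pos n..<pos (Suc n)]" by simp
  show "\<exists>n. m \<le> pos n" using assms(1) unfolding is_omega_concat_def pos_def by blast
qed

section \<open>Games under an injective renaming of the letters\<close>

lemma omega_wordsD: "x \<in> omega_words X \<Longrightarrow> x i \<in> X"
  by (auto simp: omega_words_def)

lemma rounds_nth: "i < n \<Longrightarrow> rounds x n ! i = (x (2 * i), x (2 * i + 1))"
  by (simp add: rounds_def)

lemma length_rounds [simp]: "length (rounds x n) = n"
  by (simp add: rounds_def)

lemma rounds_comp: "rounds (\<lambda>i. f (x i)) n = map (map_prod f f) (rounds x n)"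
  by (simp add: rounds_def)

lemma rounds_in_lists: "x \<in> omega_words X \<Longrightarrow> rounds x n \<in> lists (X \<times> X)"
  unfolding rounds_def omega_words_def by (auto simp: in_lists_conv_set image_subset_iff)

text \<open>A renaming of letters is an isomorphism of games: strategies are conjugated with
  \<open>f\<close> and its inverse \<open>g\<close>. This passes from pairs of letters, over which a
  relation is a game, to numbers, over which \<open>Sigma11\<close> is defined.\<close>

lemma determined_comp_inj:
  fixes f :: "'a \<Rightarrow> 'b"
  assumes inj: "inj_on f X" and A: "A \<subseteq> omega_words X"
    and det: "determined (f ` X) ((\<lambda>x i. f (x i)) ` A)"
  shows "determined X A"
proof -
  define g where "g = inv_into X f"
  have gf: "g (f a) = a" if "a \<in> X" for a using that inj by (simp add: g_def)
  have fg: "f (g b) = b" if "b \<in> f ` X" for b using that by (simp add: g_def f_inv_into_f)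
  have gX: "g b \<in> X" if "b \<in> f ` X" for b using that by (simp add: g_def inv_into_into)
  have fw: "(\<lambda>i. f (x i)) \<in> omega_words (f ` X)" if "x \<in> omega_words X" for x
    using that by (auto simp: omega_words_def)
  \<comment> \<open>Injectivity on \<open>X\<close> is applied letter by letter, which uses that the
    members of \<open>A\<close> are words over \<open>X\<close>.\<close>
  have mem: "x \<in> A" if x: "x \<in> omega_words X" and fx: "(\<lambda>i. f (x i)) \<in> (\<lambda>x i. f (x i)) ` A" for x
  proof -
    obtain a where a: "a \<in> A" "(\<lambda>i. f (x i)) = (\<lambda>i. f (a i))" using fx by auto
    have "x i = a i" for i
      using fun_cong[OF a(2), of i] inj omega_wordsD[OF x, of i] omega_wordsD[of a X i] A a(1)
      by (auto simp: inj_on_def)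
    then have "x = a" by auto
    then show ?thesis using a by simp
  qed
  have lst: "map (map_prod f f) r \<in> lists (f ` X \<times> f ` X)" if "r \<in> lists (X \<times> X)" for r
    using that by (auto simp: in_lists_conv_set)
  from det show ?thesis unfolding determined_def
  proof (elim disjE exE)
    fix \<sigma> assume w: "winning1 (f ` X) ((\<lambda>x i. f (x i)) ` A) \<sigma>"
    have s: "\<sigma> (map (map_prod f f) r) \<in> f ` X" if "r \<in> lists (X \<times> X)" for r
      using w lst[OF that] by (auto simp: winning1_def strategy1_def)
    have "winning1 X A (\<lambda>r. g (\<sigma> (map (map_prod f f) r)))"
      unfolding winning1_def
    proof (intro conjI ballI impI)
      show "strategy1 X (\<lambda>r. g (\<sigma> (map (map_prod f f) r)))"
        unfolding strategy1_def using s gX by auto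
      fix x assume x: "x \<in> omega_words X" "follows1 (\<lambda>r. g (\<sigma> (map (map_prod f f) r))) x"
      have "follows1 \<sigma> (\<lambda>i. f (x i))"
        using x s[OF rounds_in_lists[OF x(1)]] by (simp add: follows1_def rounds_comp fg)
      then have "(\<lambda>i. f (x i)) \<in> (\<lambda>x i. f (x i)) ` A" using w fw[OF x(1)] by (simp add: winning1_def)
      then show "x \<in> A" by (rule mem[OF x(1)])
    qed
    then show "(\<exists>\<sigma>. winning1 X A \<sigma>) \<or> (\<exists>\<tau>. winning2 X A \<tau>)" by blast
  next
    fix \<tau> assume w: "winning2 (f ` X) ((\<lambda>x i. f (x i)) ` A) \<tau>"
    have s: "\<tau> (map (map_prod f f) r) (f c) \<in> f ` X" if "r \<in> lists (X \<times> X)" "c \<in> X" for r c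
    proof -
      have "\<tau> \<in> lists (f ` X \<times> f ` X) \<rightarrow> f ` X \<rightarrow> f ` X" using w by (simp add: winning2_def strategy2_def)
      then have "\<tau> (map (map_prod f f) r) \<in> f ` X \<rightarrow> f ` X" using lst[OF that(1)] by (rule funcset_mem)
      then show ?thesis using that(2) by auto
    qed
    have "winning2 X A (\<lambda>r c. g (\<tau> (map (map_prod f f) r) (f c)))"
      unfolding winning2_def
    proof (intro conjI ballI impI)
      show "strategy2 X (\<lambda>r c. g (\<tau> (map (map_prod f f) r) (f c)))"
        unfolding strategy2_def using s gX by auto
      fix x assume x: "x \<in> omega_words X" "follows2 (\<lambda>r c. g (\<tau> (map (map_prod f f) r) (f c))) x"
      have xX: "x n \<in> X" for n using x(1) by (auto simp: omega_words_def)
      have "follows2 \<tau> (\<lambda>i. f (x i))"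
        using x s[OF rounds_in_lists[OF x(1)]] xX by (simp add: follows2_def rounds_comp fg)
      then have "(\<lambda>i. f (x i)) \<notin> (\<lambda>x i. f (x i)) ` A" using w fw[OF x(1)] by (simp add: winning2_def)
      then show "x \<notin> A" by auto
    qed
    then show "(\<exists>\<sigma>. winning1 X A \<sigma>) \<or> (\<exists>\<tau>. winning2 X A \<tau>)" by blast
  qed
qed

lemma determined_empty: "determined X {}"
proof -
  have "winning2 X {} (\<lambda>r c. c)" by (auto simp: winning2_def strategy2_def)
  then show ?thesis unfolding determined_def by blast
qed

text \<open>
  A run is coded by the one-hot word \<open>y\<close> in which \<open>y (n * T + k) = 1\<close> means that the \<open>n\<close>-th
  transition of the run is the \<open>k\<close>-th of the \<open>T\<close> transitions. Every \<open>y\<close> codes some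
  sequence of transitions.
\<close>

definition decode_hot :: "nat \<Rightarrow> (nat \<Rightarrow> nat) \<Rightarrow> nat \<Rightarrow> nat" where
  "decode_hot T y n = (LEAST k. T \<le> Suc k \<or> y (n * T + k) = 1)"

definition psum :: "(nat \<Rightarrow> nat) \<Rightarrow> nat \<Rightarrow> nat" where
  "psum l n = rec_nat 0 (\<lambda>k r. r + l k) n"

lemma psum_simps [simp]: "psum l 0 = 0" "psum l (Suc n) = psum l n + l n"
  by (simp_all add: psum_def)

lemma psum_cong: "(\<And>k. k < n \<Longrightarrow> l k = l' k) \<Longrightarrow> psum l n = psum l' n"
  by (induction n) auto

text \<open>The search stops at \<open>k = T - 1\<close> if no earlier bit of the block is
  \<open>1\<close>; by this default every block of \<open>T\<close> bits denotes a
  transition.\<close>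

lemma decode_hot_less: "0 < T \<Longrightarrow> decode_hot T y n < T"
  unfolding decode_hot_def using Least_le[of "\<lambda>k. T \<le> Suc k \<or> y (n * T + k) = 1" "T - 1"] by simp

lemma decode_hot_cong:
  assumes "\<And>i. i < Suc n * T \<Longrightarrow> y i = y' i" "0 < T"
  shows "decode_hot T y n = decode_hot T y' n"
proof -
  have "(T \<le> Suc k \<or> y (n * T + k) = 1) = (T \<le> Suc k \<or> y' (n * T + k) = 1)" for k
    using assms(1)[of "n * T + k"] by (cases "T \<le> Suc k") auto
  then show ?thesis unfolding decode_hot_def by simp
qed

lemma decode_hot_encode:
  assumes "\<And>n. t n < T"
  shows "decode_hot T (\<lambda>i. if i mod T = t (i div T) then 1 else 0) n = t n"
  unfolding decode_hot_def
proof (rule Least_equality)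
  have T: "0 < T" using assms[of n] by simp
  have *: "(n * T + k) mod T = k" "(n * T + k) div T = n" if "k < T" for k using that by auto
  show "T \<le> Suc (t n) \<or> (if (n * T + t n) mod T = t ((n * T + t n) div T) then 1 else 0::nat) = 1"
    using *[OF assms] by simp
  fix k assume k: "T \<le> Suc k \<or> (if (n * T + k) mod T = t ((n * T + k) div T) then 1 else 0::nat) = 1"
  show "t n \<le> k"
  proof (cases "T \<le> Suc k")
    case True
    then show ?thesis using assms[of n] by simp
  next
    case False
    then show ?thesis using k * [of k] by (simp split: if_splits)
  qed
qed

section \<open>The arithmetical test of a coded run\<close>

locale buchi2_table =
  fixes \<Sigma> \<Gamma> :: "nat set" and M :: "(nat, nat, nat) buchi2" and ts :: "(nat \<times> nat list \<times> nat list \<times> nat) list"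
  assumes fin: "finite \<Sigma>" "finite \<Gamma>" and M: "buchi2_automaton \<Sigma> \<Gamma> M" and ts: "set ts = trans M" "ts \<noteq> []"
begin

abbreviation T where "T \<equiv> length ts"

lemma T_pos: "0 < T" using ts by simp

text \<open>The default values of the tables beyond \<open>T\<close>, namely \<open>0\<close> and
  \<open>[]\<close>, have code \<open>0\<close>, so that the tables have finite support and are
  computable.\<close>

definition src where "src k = (if k < T then fst (ts ! k) else 0)"
definition dst where "dst k = (if k < T then snd (snd (snd (ts ! k))) else 0)"
definition labu where "labu k = (if k < T then fst (snd (ts ! k)) else [])"
definition labv where "labv k = (if k < T then fst (snd (snd (ts ! k))) else [])"

lemma trans_iff: "(p, a, b, q) \<in> trans M \<longleftrightarrow> (\<exists>k<T. p = src k \<and> a = labu k \<and> b = labv k \<and> q = dst k)"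
proof -
  have "(p, a, b, q) \<in> trans M \<longleftrightarrow> (\<exists>k<T. ts ! k = (p, a, b, q))"
    unfolding ts(1)[symmetric] in_set_conv_nth ..
  also have "\<dots> \<longleftrightarrow> (\<exists>k<T. p = src k \<and> a = labu k \<and> b = labv k \<and> q = dst k)"
    by (intro ex_cong) (auto simp: src_def dst_def labu_def labv_def prod_eq_iff)
  finally show ?thesis .
qed

lemma computable_table:
  assumes "computable f" "\<And>k. T \<le> k \<Longrightarrow> h k = 0"
  shows "computable (\<lambda>x. h (f x))"
  by (rule computable_finite_support[of "{..<T}"]) (use assms in auto)

definition hot :: "(nat \<Rightarrow> nat) \<Rightarrow> nat \<Rightarrow> nat" where
  "hot z n = decode_hot T (\<lambda>i. psnd (z i)) n"
definition posu :: "(nat \<Rightarrow> nat) \<Rightarrow> nat \<Rightarrow> nat" where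
  "posu z n = psum (\<lambda>k. length (labu (hot z k))) n"
definition posv :: "(nat \<Rightarrow> nat) \<Rightarrow> nat \<Rightarrow> nat" where
  "posv z n = psum (\<lambda>k. length (labv (hot z k))) n"

text \<open>Quantified over all \<open>a\<close>, with some \<open>len\<close> for each, this is a
  \<open>\<Pi>\<^sup>0\<^sub>2\<close> condition. Stage \<open>a\<close> checks only transition
  \<open>a\<close> and asks for one visit \<open>m \<ge> a\<close> to an accepting state at which
  both heads have reached position \<open>a\<close>; all stages together give infinitely many such
  visits and two infinite words. The bounds by \<open>len\<close> keep everything that is inspected
  inside the prefix.\<close>

definition run_test :: "nat \<Rightarrow> nat \<Rightarrow> (nat \<Rightarrow> nat) \<Rightarrow> bool" where
  "run_test a len z \<longleftrightarrow>
    (\<forall>i<len. z i \<in> prod_encode ` (prod_encode ` (\<Sigma> \<times> \<Gamma>) \<times> {0, 1})) \<and>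
    (a + 2) * T \<le> len \<and> src (hot z 0) = init M \<and> dst (hot z a) = src (hot z (Suc a)) \<and>
    posu z (Suc a) \<le> len \<and> posv z (Suc a) \<le> len \<and>
    (\<forall>k<length (labu (hot z a)). pfst (pfst (z (posu z a + k))) = nth_code (list_encode (labu (hot z a))) k) \<and>
    (\<forall>k<length (labv (hot z a)). psnd (pfst (z (posv z a + k))) = nth_code (list_encode (labv (hot z a))) k) \<and>
    (\<exists>m<len. a \<le> m \<and> Suc m * T \<le> len \<and> a \<le> posu z m \<and> a \<le> posv z m \<and> src (hot z m) \<in> accepting M)"

lemma hot_less: "hot z n < T"
  unfolding hot_def by (rule decode_hot_less[OF T_pos])

text \<open>The blocks and letters that are inspected lie below \<open>len\<close>, so the test may
  be evaluated on the code of a prefix instead of the infinite word.\<close>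

lemma run_test_cong:
  assumes eq: "\<And>i. i < len \<Longrightarrow> z i = z' i" and t: "run_test a len z"
  shows "run_test a len z'"
proof -
  have len: "(a + 2) * T \<le> len" and posa: "posu z (Suc a) \<le> len" "posv z (Suc a) \<le> len"
    using t by (auto simp: run_test_def)
  have h: "hot z n = hot z' n" if "Suc n * T \<le> len" for n
    unfolding hot_def by (rule decode_hot_cong) (use that eq T_pos in auto)
  have le: "Suc k * T \<le> len" if "Suc n * T \<le> len" "k \<le> n" for n k
    using that by (meson Suc_le_mono le_trans mult_le_mono1)
  have pu: "posu z n = posu z' n" and pv: "posv z n = posv z' n" if "n * T \<le> len" for n
  proof -
    have "hot z k = hot z' k" if "k < n" for k
      using h[of k] \<open>n * T \<le> len\<close> mult_le_mono1[of "Suc k" n T] that by simp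
    then show "posu z n = posu z' n" "posv z n = posv z' n"
      unfolding posu_def posv_def by (auto intro: psum_cong)
  qed
  have a: "Suc k * T \<le> len" if "k \<le> Suc a" for k
    using mult_le_mono1[of "Suc k" "a + 2" T] that len by simp
  have a': "a * T \<le> len" "Suc a * T \<le> len" using a[of a] by auto
  have hs: "hot z' 0 = hot z 0" "hot z' a = hot z a" "hot z' (Suc a) = hot z (Suc a)"
    "posu z' a = posu z a" "posv z' a = posv z a" "posu z' (Suc a) = posu z (Suc a)" "posv z' (Suc a) = posv z (Suc a)"
    using h[of 0] h[of a] h[of "Suc a"] a[of 0] a[of a] a[of "Suc a"] pu[OF a'(1)] pv[OF a'(1)] pu[OF a'(2)] pv[OF a'(2)]
    by auto
  have zu: "z' (posu z a + k) = z (posu z a + k)" if "k < length (labu (hot z a))" for k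
    using eq[of "posu z a + k"] posa(1) that by (auto simp: posu_def)
  have zv: "z' (posv z a + k) = z (posv z a + k)" if "k < length (labv (hot z a))" for k
    using eq[of "posv z a + k"] posa(2) that by (auto simp: posv_def)
  obtain m where m: "m < len" "a \<le> m" "Suc m * T \<le> len" "a \<le> posu z m" "a \<le> posv z m" "src (hot z m) \<in> accepting M"
    using t unfolding run_test_def by blast
  have m': "a \<le> posu z' m" "a \<le> posv z' m" "src (hot z' m) \<in> accepting M"
    using m h[OF m(3)] pu[of m] pv[of m] by auto
  show ?thesis
    using t m(1-3) m' unfolding run_test_def hs by (auto simp: zu zv eq[symmetric])
qed

lemma decidable_run_test:
  "decidable (\<lambda>z. run_test (pfst z) (length_code (psnd z)) (nth_code (psnd z)))"
proof -
  have fX: "finite (prod_encode ` (prod_encode ` (\<Sigma> \<times> \<Gamma>) \<times> {0, 1}))" using fin by auto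
  have fA: "finite (accepting M)" using M by (auto simp: buchi2_automaton_def intro: finite_subset)
  have hot: "computable (\<lambda>x. hot (nth_code (f x)) (g x))" if "computable f" "computable g" for f g
    unfolding hot_def decode_hot_def
  proof (rule computable_Least)
    show "\<exists>k. T \<le> Suc k \<or> psnd (nth_code (f x) (g x * T + k)) = 1" for x by (intro exI[of _ T]) simp
  qed (intro computable_intros computable_comp[OF that(1)] computable_comp[OF that(2)])
  have src: "computable (\<lambda>x. src (f x))" and dst: "computable (\<lambda>x. dst (f x))"
    and lu: "computable (\<lambda>x. list_encode (labu (f x)))" and lv: "computable (\<lambda>x. list_encode (labv (f x)))"
    and llu: "computable (\<lambda>x. length (labu (f x)))" and llv: "computable (\<lambda>x. length (labv (f x)))"
    if "computable f" for f
    using computable_table[OF that, of src] computable_table[OF that, of dst]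
      computable_table[OF that, of "\<lambda>k. list_encode (labu k)"] computable_table[OF that, of "\<lambda>k. list_encode (labv k)"]
      computable_table[OF that, of "\<lambda>k. length (labu k)"] computable_table[OF that, of "\<lambda>k. length (labv k)"]
    by (auto simp: src_def dst_def labu_def labv_def)
  have pu: "computable (\<lambda>x. posu (nth_code (f x)) (g x))" and pv: "computable (\<lambda>x. posv (nth_code (f x)) (g x))"
    if "computable f" "computable g" for f g
    unfolding posu_def posv_def psum_def
    by (rule computable_rec; (intro computable_intros that hot llu llv computable_comp[OF that(1)]))+
  show ?thesis unfolding run_test_def
    by (intro computable_intros decidable_member[OF fX] decidable_member[OF fA] hot src dst lu lv llu llv pu pv)
qed

definition run_rel :: "(nat \<times> nat list) set" where
  "run_rel = {(a, w). run_test a (length w) (nth_code (list_encode w))}"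

lemma recursive_run_rel: "recursive_rel run_rel"
  by (rule recursive_relI)
    (use decidable_run_test length_code_encode[of "list_decode _"] in \<open>simp add: run_rel_def\<close>)

lemma run_rel_prefix: "(a, prefix n z) \<in> run_rel \<longleftrightarrow> run_test a n z"
proof -
  have "nth_code (list_encode (prefix n z)) i = z i" if "i < n" for i
    using that by (simp add: nth_code_encode)
  then show ?thesis unfolding run_rel_def
    using run_test_cong[of n z "nth_code (list_encode (prefix n z))" a]
      run_test_cong[of n "nth_code (list_encode (prefix n z))" z a] by auto
qed

lemma run_rel_lists: "run_rel \<subseteq> UNIV \<times> lists (prod_encode ` (prod_encode ` (\<Sigma> \<times> \<Gamma>) \<times> {0, 1}))"
proof -
  have "w \<in> lists (prod_encode ` (prod_encode ` (\<Sigma> \<times> \<Gamma>) \<times> {0, 1}))"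
    if "run_test a (length w) (nth_code (list_encode w))" for a w
    using that by (auto simp: run_test_def in_lists_conv_set in_set_conv_nth nth_code_encode)
  then show ?thesis by (auto simp: run_rel_def simp del: lists_Int_eq)
qed

lemma accepts_iff_run_test:
  assumes u: "u \<in> omega_words \<Sigma>" and v: "v \<in> omega_words \<Gamma>"
  defines "zz \<equiv> \<lambda>y i. prod_encode (prod_encode (u i, v i), y i)"
  shows "accepts M u v \<longleftrightarrow> (\<exists>y\<in>omega_words {0, 1}. \<forall>a. \<exists>b. run_test a (Suc b) (zz y))"
proof
  assume "accepts M u v"
  then obtain q us vs where q0: "q 0 = init M" and tr: "\<And>n. (q n, us n, vs n, q (Suc n)) \<in> trans M"
    and lim: "limit q \<inter> accepting M \<noteq> {}" and us: "is_omega_concat u us" and vs: "is_omega_concat v vs"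
    unfolding accepts_def by blast
  obtain t where t: "\<And>n. t n < T" "\<And>n. q n = src (t n)" "\<And>n. us n = labu (t n)" "\<And>n. vs n = labv (t n)"
    "\<And>n. q (Suc n) = dst (t n)"
    using tr unfolding trans_iff by metis
  define y :: "nat \<Rightarrow> nat" where "y = (\<lambda>i. if i mod T = t (i div T) then 1 else 0)"
  have y: "y \<in> omega_words {0, 1}" by (auto simp: omega_words_def y_def)
  have hot: "hot (zz y) = t"
    using decode_hot_encode[of t T, OF t(1)] by (auto simp: hot_def zz_def y_def)
  note U = is_omega_concatD[OF us] and V = is_omega_concatD[OF vs]
  have pu: "posu (zz y) n = length (concat (prefix n us))" for n
    by (induction n) (auto simp: posu_def hot prefix_Suc t)
  have pv: "posv (zz y) n = length (concat (prefix n vs))" for n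
    by (induction n) (auto simp: posv_def hot prefix_Suc t)
  have Tm: "n \<le> n * T" for n using T_pos by (cases T) auto
  have "\<exists>b. run_test a (Suc b) (zz y)" for a
  proof -
    \<comment> \<open>From \<open>n1\<close> and \<open>n2\<close> on, the heads have reached
      position \<open>a\<close>; the accepting visit \<open>m\<close> is taken after both and after
      \<open>a\<close>.\<close>
    obtain n1 where n1: "a \<le> posu (zz y) n1" using U(4) pu by metis
    obtain n2 where n2: "a \<le> posv (zz y) n2" using V(4) pv by metis
    have "\<exists>\<^sub>\<infinity>n. q n \<in> accepting M" using limit_inter_INF[OF lim] .
    then obtain m where m: "m \<ge> a + n1 + n2" "q m \<in> accepting M" unfolding INFM_nat_le by blast
    have mono: "posu (zz y) i \<le> posu (zz y) j" "posv (zz y) i \<le> posv (zz y) j" if "i \<le> j" for i j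
      using that by (induction rule: dec_induct) (auto simp: posu_def posv_def)
    have mm: "a \<le> posu (zz y) m" "a \<le> posv (zz y) m"
      using n1 n2 mono(1)[of n1 m] mono(2)[of n2 m] m(1) by auto
    \<comment> \<open>Long enough for the blocks of the transitions up to \<open>m\<close> and for
      the letters that transition \<open>a\<close> reads on both tapes.\<close>
    define b where "b = (m + 2) * T + posu (zz y) (Suc a) + posv (zz y) (Suc a)"
    have "m \<le> b" unfolding b_def using Tm[of "m + 2"] by simp
    moreover have "(a + 2) * T \<le> b" unfolding b_def using m(1) by (simp add: trans_le_add1)
    ultimately have "run_test a (Suc b) (zz y)"
      unfolding run_test_def hot
    proof (intro conjI)
      show "\<forall>i<Suc b. zz y i \<in> prod_encode ` (prod_encode ` (\<Sigma> \<times> \<Gamma>) \<times> {0, 1})"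
        using omega_wordsD[OF u] omega_wordsD[OF v] omega_wordsD[OF y] by (simp add: zz_def image_iff)
      show "src (t 0) = init M" using q0 t(2) by simp
      show "dst (t a) = src (t (Suc a))" using t(2,5) by metis
      show "\<forall>k<length (labu (t a)). pfst (pfst (zz y (posu (zz y) a + k))) = nth_code (list_encode (labu (t a))) k"
      proof (intro allI impI)
        fix k assume k: "k < length (labu (t a))"
        have "labu (t a) = map u [posu (zz y) a..<posu (zz y) (Suc a)]" using U(3)[of a] t(3) pu by simp
        then have "labu (t a) ! k = u (posu (zz y) a + k)" using k
          by (metis length_map length_upt less_diff_conv add.commute nth_map nth_upt)
        then show "pfst (pfst (zz y (posu (zz y) a + k))) = nth_code (list_encode (labu (t a))) k"
          using k by (simp add: zz_def nth_code_encode)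
      qed
      show "\<forall>k<length (labv (t a)). psnd (pfst (zz y (posv (zz y) a + k))) = nth_code (list_encode (labv (t a))) k"
      proof (intro allI impI)
        fix k assume k: "k < length (labv (t a))"
        have "labv (t a) = map v [posv (zz y) a..<posv (zz y) (Suc a)]" using V(3)[of a] t(4) pv by simp
        then have "labv (t a) ! k = v (posv (zz y) a + k)" using k
          by (metis length_map length_upt less_diff_conv add.commute nth_map nth_upt)
        then show "psnd (pfst (zz y (posv (zz y) a + k))) = nth_code (list_encode (labv (t a))) k"
          using k by (simp add: zz_def nth_code_encode)
      qed
      have "m < Suc b" "a \<le> m" "Suc m * T \<le> Suc b" using \<open>m \<le> b\<close> m(1) by (auto simp: b_def)
      then show "\<exists>ma<Suc b. a \<le> ma \<and> Suc ma * T \<le> Suc b \<and> a \<le> posu (zz y) ma \<and> a \<le> posv (zz y) ma \<and> src (t ma) \<in> accepting M"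
        using mm m(2) t(2) by (intro exI[of _ m]) auto
    qed (auto simp: b_def)
    then show ?thesis by blast
  qed
  then show "\<exists>y\<in>omega_words {0, 1}. \<forall>a. \<exists>b. run_test a (Suc b) (zz y)" using y by blast
next
  assume "\<exists>y\<in>omega_words {0, 1}. \<forall>a. \<exists>b. run_test a (Suc b) (zz y)"
  then obtain y where "\<forall>a. \<exists>b. run_test a (Suc b) (zz y)" by blast
  then obtain b where b: "\<And>a. run_test a (Suc (b a)) (zz y)" by metis
  \<comment> \<open>Any sequence of bits decodes to some transitions; the stages of the test make
    them an accepting run.\<close>
  define t where "t = hot (zz y)"
  have T1: "\<And>a. dst (t a) = src (t (Suc a))" "src (t 0) = init M"
    using b unfolding run_test_def t_def by auto
  have lab: "labu (t a) = map u [posu (zz y) a..<posu (zz y) (Suc a)]" "labv (t a) = map v [posv (zz y) a..<posv (zz y) (Suc a)]" for a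
  proof -
    have 1: "\<forall>k<length (labu (t a)). u (posu (zz y) a + k) = labu (t a) ! k"
      using b[of a] unfolding run_test_def t_def[symmetric] by (auto simp: zz_def nth_code_encode)
    have 2: "\<forall>k<length (labv (t a)). v (posv (zz y) a + k) = labv (t a) ! k"
      using b[of a] unfolding run_test_def t_def[symmetric] by (auto simp: zz_def nth_code_encode)
    show "labu (t a) = map u [posu (zz y) a..<posu (zz y) (Suc a)]"
      using 1 by (auto intro!: nth_equalityI simp: posu_def t_def)
    show "labv (t a) = map v [posv (zz y) a..<posv (zz y) (Suc a)]"
      using 2 by (auto intro!: nth_equalityI simp: posv_def t_def)
  qed
  have acc: "\<exists>m. a \<le> m \<and> a \<le> posu (zz y) m \<and> a \<le> posv (zz y) m \<and> src (t m) \<in> accepting M" for a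
    using b[of a] unfolding run_test_def t_def by blast
  show "accepts M u v" unfolding accepts_def
  proof (intro exI conjI allI)
    show "src (t 0) = init M" by (rule T1)
    show "(src (t n), labu (t n), labv (t n), src (t (Suc n))) \<in> trans M" for n
      using T1(1)[of n] hot_less[of "zz y" n] unfolding trans_iff t_def by metis
    have "\<exists>\<^sub>\<infinity>n. src (t n) \<in> accepting M" unfolding INFM_nat_le using acc by blast
    moreover have "finite (accepting M)" using M by (auto simp: buchi2_automaton_def intro: finite_subset)
    ultimately show "limit (\<lambda>n. src (t n)) \<inter> accepting M \<noteq> {}" using fin_ex_inf_eq_limit by fastforce
    have "\<exists>n. a \<le> posu (zz y) n" "\<exists>n. a \<le> posv (zz y) n" for a using acc[of a] by blast+
    moreover have "posu (zz y) 0 = 0" "posv (zz y) 0 = 0" "posu (zz y) n \<le> posu (zz y) (Suc n)" "posv (zz y) n \<le> posv (zz y) (Suc n)" for n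
      by (auto simp: posu_def posv_def)
    ultimately show "is_omega_concat u (\<lambda>n. labu (t n))" "is_omega_concat v (\<lambda>n. labv (t n))"
      using is_omega_concatI[of "posu (zz y)" "\<lambda>n. labu (t n)" u] is_omega_concatI[of "posv (zz y)" "\<lambda>n. labv (t n)" v] lab by blast+
  qed
qed

lemma Sigma11_rel_lang:
  "Sigma11 (prod_encode ` (\<Sigma> \<times> \<Gamma>)) ((\<lambda>x i. prod_encode (x i)) ` zip_words (rel_lang \<Sigma> \<Gamma> M))"
proof -
  let ?X = "prod_encode ` (\<Sigma> \<times> \<Gamma>)"
  let ?Y = "prod_encode ` (?X \<times> {0, 1})"
  define P where "P = {x \<in> omega_words ?Y. \<forall>a. \<exists>b. (a, prefix (Suc b) x) \<in> run_rel}"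
  have P: "Pi02 ?Y P" unfolding Pi02_def P_def
    using recursive_run_rel run_rel_lists by blast
  have uv: "\<exists>u\<in>omega_words \<Sigma>. \<exists>v\<in>omega_words \<Gamma>. x = (\<lambda>i. prod_encode (u i, v i))" if x: "x \<in> omega_words ?X" for x
  proof (intro bexI)
    have "x i \<in> ?X" for i using x by (auto simp: omega_words_def)
    then have *: "pfst (x i) \<in> \<Sigma>" "psnd (x i) \<in> \<Gamma>" for i by (metis SigmaE fst_conv imageE prod_encode_inverse snd_conv)+
    show "x = (\<lambda>i. prod_encode (pfst (x i), psnd (x i)))" by simp
    show "(\<lambda>i. pfst (x i)) \<in> omega_words \<Sigma>" "(\<lambda>i. psnd (x i)) \<in> omega_words \<Gamma>" using * by (auto simp: omega_words_def)
  qed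
  have lang: "(\<lambda>i. prod_encode (u i, v i)) \<in> (\<lambda>x i. prod_encode (x i)) ` zip_words (rel_lang \<Sigma> \<Gamma> M) \<longleftrightarrow> accepts M u v"
    if "u \<in> omega_words \<Sigma>" "v \<in> omega_words \<Gamma>" for u v
  proof
    assume "accepts M u v"
    then have "(\<lambda>i. (u i, v i)) \<in> zip_words (rel_lang \<Sigma> \<Gamma> M)"
      using that by (auto simp: zip_words_def rel_lang_def image_iff intro!: bexI[of _ "(u, v)"])
    then show "(\<lambda>i. prod_encode (u i, v i)) \<in> (\<lambda>x i. prod_encode (x i)) ` zip_words (rel_lang \<Sigma> \<Gamma> M)"
      by (auto simp: image_iff intro!: bexI[of _ "(\<lambda>i. (u i, v i))"])
  next
    assume "(\<lambda>i. prod_encode (u i, v i)) \<in> (\<lambda>x i. prod_encode (x i)) ` zip_words (rel_lang \<Sigma> \<Gamma> M)"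
    then obtain u' v' where *: "(\<lambda>i. prod_encode (u i, v i)) = (\<lambda>i. prod_encode (u' i, v' i))" "accepts M u' v'"
      by (auto simp: zip_words_def rel_lang_def)
    have "u i = u' i" "v i = v' i" for i using fun_cong[OF *(1), of i] by auto
    then have "u = u'" "v = v'" by auto
    then show "accepts M u v" using * by simp
  qed
  have wordsP: "(\<lambda>i. prod_encode (prod_encode (u i, v i), y i)) \<in> P \<longleftrightarrow>
      (\<forall>a. \<exists>b. run_test a (Suc b) (\<lambda>i. prod_encode (prod_encode (u i, v i), y i)))"
    if "u \<in> omega_words \<Sigma>" "v \<in> omega_words \<Gamma>" "y \<in> omega_words {0, 1}" for u v y
  proof -
    have "u i \<in> \<Sigma>" "v i \<in> \<Gamma>" "y i \<in> {0, 1}" for i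
      using that(1,2) omega_wordsD[OF that(3), of i] by (auto intro: omega_wordsD)
    then have "prod_encode (prod_encode (u i, v i), y i) \<in> ?Y" for i by blast
    then show ?thesis unfolding P_def run_rel_prefix by (auto simp: omega_words_def)
  qed
  have "(\<lambda>x i. prod_encode (x i)) ` zip_words (rel_lang \<Sigma> \<Gamma> M) =
    {x \<in> omega_words ?X. \<exists>y \<in> omega_words {0, 1}. (\<lambda>i. prod_encode (x i, y i)) \<in> P}" (is "?L = ?R")
  proof (rule set_eqI)
    fix x
    have sub: "?L \<subseteq> omega_words ?X"
      by (auto simp: zip_words_def rel_lang_def omega_words_def)
    show "x \<in> ?L \<longleftrightarrow> x \<in> ?R"
    proof (cases "x \<in> omega_words ?X")
      case True
      then obtain u v where u: "u \<in> omega_words \<Sigma>" "v \<in> omega_words \<Gamma>" "x = (\<lambda>i. prod_encode (u i, v i))"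
        using uv by blast
      show ?thesis using True lang[OF u(1,2)] accepts_iff_run_test[OF u(1,2)] wordsP[OF u(1,2)] unfolding u(3) by auto
    next
      case False
      then show ?thesis using sub by auto
    qed
  qed
  then show ?thesis unfolding Sigma11_def using P by blast
qed

end

lemma Det_RAT_if_Det_Sigma11:
  assumes "Det_Sigma11"
  shows "Det_RAT"
  unfolding Det_RAT_def
proof (intro allI impI)
  fix \<Sigma> \<Gamma> :: "nat set" and R
  assume "finite \<Sigma> \<and> finite \<Gamma> \<and> inf_rational \<Sigma> \<Gamma> R"
  then obtain M :: "(nat, nat, nat) buchi2" where fin: "finite \<Sigma>" "finite \<Gamma>" and M: "buchi2_automaton \<Sigma> \<Gamma> M"
    and R: "R = rel_lang \<Sigma> \<Gamma> M" unfolding inf_rational_def by blast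
  obtain ts where ts: "set ts = trans M" using M finite_list unfolding buchi2_automaton_def by metis
  show "determined (\<Sigma> \<times> \<Gamma>) (zip_words R)"
  proof (cases "ts = []")
    \<comment> \<open>Decoding needs at least one transition; without any, the relation is empty and
      Player 2 wins every play.\<close>
    case True
    then have "R = {}" using ts by (auto simp: R rel_lang_def accepts_def)
    then show ?thesis by (simp add: zip_words_def determined_empty)
  next
    case False
    interpret buchi2_table \<Sigma> \<Gamma> M ts by unfold_locales (use fin M ts False in auto)
    have "determined (prod_encode ` (\<Sigma> \<times> \<Gamma>)) ((\<lambda>x i. prod_encode (x i)) ` zip_words R)"
      using assms Sigma11_rel_lang fin unfolding Det_Sigma11_def R by (metis finite_SigmaI finite_imageI)
    then show ?thesis
      by (rule determined_comp_inj[rotated 2])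
        (auto simp: R zip_words_def rel_lang_def omega_words_def inj_on_def)
  qed
qed

section \<open>A normal form for effective analytic sets\<close>

text \<open>The nodes of level \<open>n\<close> of the binary tree are numbered from left to right
  by \<open>0, ..., 2 ^ n - 1\<close>, so that node \<open>k\<close> has the children
  \<open>2 * k\<close> and \<open>2 * k + 1\<close>. This is the node of level \<open>n\<close> on
  the branch \<open>y\<close>.\<close>

primrec binval :: "(nat \<Rightarrow> nat) \<Rightarrow> nat \<Rightarrow> nat" where
  "binval y 0 = 0"
| "binval y (Suc n) = 2 * binval y n + y n"

lemma binval_div:
  assumes "y \<in> omega_words {0, 1}"
  shows "m \<le> n \<Longrightarrow> binval y n div 2 ^ (n - m) = binval y m"
proof (induction n)
  case (Suc n)
  show ?case
  proof (cases "m = Suc n")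
    case False
    then have "m \<le> n" using Suc.prems by simp
    have "binval y (Suc n) div 2 = binval y n" using omega_wordsD[OF assms, of n] by auto
    then have "binval y (Suc n) div 2 ^ (Suc n - m) = binval y n div 2 ^ (n - m)"
      using \<open>m \<le> n\<close> by (simp only: Suc_diff_le power_Suc div_mult2_eq)
    then show ?thesis using Suc.IH[OF \<open>m \<le> n\<close>] by simp
  qed simp
qed simp

lemma binval_less: "y \<in> omega_words {0, 1} \<Longrightarrow> binval y n < 2 ^ n"
proof (induction n)
  case (Suc n)
  then show ?case using omega_wordsD[OF Suc.prems, of n] by auto
qed simp

text \<open>The letters are reversed so that a further round is pushed onto the front of the code,
  as in \<open>push_round\<close>.\<close>

definition rounds_code :: "(nat \<Rightarrow> nat) \<Rightarrow> nat \<Rightarrow> nat" where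
  "rounds_code x n = list_encode (rev (map x [0..<2 * n]))"

lemma length_rounds_code: "length_code (rounds_code x n) = 2 * n"
  by (simp add: rounds_code_def length_code_encode)

lemma nth_rounds_code: "i < 2 * n \<Longrightarrow> nth_code (rounds_code x n) (2 * n - Suc i) = x i"
  by (simp add: rounds_code_def nth_code_encode rev_nth)

lemma monotone_increments_iff:
  fixes A :: "nat \<Rightarrow> nat"
  assumes mono: "\<And>n. A n \<le> A (Suc n)"
  shows "(\<exists>\<^sub>\<infinity>n. A n < A (Suc n)) \<longleftrightarrow> (\<forall>a. \<exists>n. a < A n)"
proof
  assume inf: "\<exists>\<^sub>\<infinity>n. A n < A (Suc n)"
  show "\<forall>a. \<exists>n. a < A n"
  proof
    fix a show "\<exists>n. a < A n"
    proof (induction a)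
      case 0
      obtain n where "A n < A (Suc n)" using inf by (meson INFM_nat_le)
      then show ?case by (intro exI[of _ "Suc n"]) simp
    next
      case (Suc a)
      then obtain n where n: "a < A n" by blast
      obtain m where m: "m \<ge> n" "A m < A (Suc m)" using inf by (meson INFM_nat_le)
      have "A n \<le> A m" using m(1) mono by (rule lift_Suc_mono_le[rotated])
      then show ?case using n m by (intro exI[of _ "Suc m"]) simp
    qed
  qed
next
  assume unb: "\<forall>a. \<exists>n. a < A n"
  show "\<exists>\<^sub>\<infinity>n. A n < A (Suc n)"
  proof (rule ccontr)
    assume "\<not> ?thesis"
    then obtain m where nl: "\<And>n. n \<ge> m \<Longrightarrow> \<not> A n < A (Suc n)"
      unfolding INFM_nat_le by blast
    then have m: "A n = A (Suc n)" if "n \<ge> m" for n using mono[of n] nl[OF that] by simp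
    have *: "A n = A m" if "n \<ge> m" for n using that
    proof (induction rule: dec_induct)
      case (step k)
      then show ?case using m[of k] by (simp only:)
    qed simp
    obtain n where "A m < A n" using unb by blast
    then show False using *[of n] lift_Suc_mono_le[of A n m, OF mono] by (cases "n \<ge> m") auto
  qed
qed

text \<open>\<open>A\<close> counts how many requirements \<open>a = 0, 1, ...\<close> in a row are
  met by prefixes of length at most \<open>n\<close>, capped at \<open>n\<close>. The count is
  monotone in \<open>n\<close>, and it is unbounded iff every requirement is met; \<open>G\<close>
  marks the levels at which it grows. Only the first \<open>n\<close> letters of \<open>x\<close>
  and \<open>y\<close> enter, so the rounds played so far determine the mark of every node of level
  \<open>n\<close>.\<close>

lemma Pi02_normal_form:
  assumes "Pi02 (prod_encode ` (X \<times> {0, 1})) P"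
  obtains G :: "nat \<Rightarrow> nat \<Rightarrow> nat" where "computable (\<lambda>z. G (pfst z) (psnd z))"
    "\<And>x y. x \<in> omega_words X \<Longrightarrow> y \<in> omega_words {0, 1} \<Longrightarrow>
      (\<lambda>i. prod_encode (x i, y i)) \<in> P \<longleftrightarrow> (\<exists>\<^sub>\<infinity>n. G (rounds_code x (Suc n)) (binval y n) \<noteq> 0)"
proof -
  obtain R where R: "recursive_rel R"
    and P: "P = {x \<in> omega_words (prod_encode ` (X \<times> {0, 1})). \<forall>a. \<exists>b. (a, prefix (Suc b) x) \<in> R}"
    using assms unfolding Pi02_def by blast
  define level where "level C = length_code C div 2 - 1" for C
  \<comment> \<open>The binary digits of \<open>k\<close>, from the most significant one, are the
    letters of the branch; the letters of the play stand in \<open>C\<close> in reverse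
    order.\<close>
  define letter where "letter C k i = prod_encode (nth_code C (length_code C - Suc i), k div 2 ^ (level C - Suc i) mod 2)"
    for C k i
  define pre where "pre C k b = list_encode (map (letter C k) [0..<b])" for C k b
  \<comment> \<open>The cap \<open>n \<le> a\<close> makes the search total; it can only delay the
    counting of a requirement.\<close>
  define A where "A C k n = (LEAST a. n \<le> a \<or> (\<forall>b<n. \<not> (a, list_decode (pre C k (Suc b))) \<in> R))" for C k n
  define G where "G C k = A C k (level C) - A C k (level C - 1)" for C k
  have dR: "decidable (\<lambda>x. (f x, list_decode (g x)) \<in> R)" if "computable f" "computable g" for f g
    using computable_comp[OF decidable_recursive_rel[OF R, unfolded decidable_def] computable_prod_encode[OF that]]
    by (simp add: decidable_def)
  have lev: "computable (\<lambda>x. level (f x))" if "computable f" for f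
    unfolding level_def by (intro computable_intros that)
  have pre: "computable (\<lambda>x. pre (f x) (g x) (h x))" if "computable f" "computable g" "computable h" for f g h
    unfolding pre_def
    by (rule computable_list_encode_map)
      ((unfold letter_def)?, intro computable_intros lev computable_comp[OF that(1)] computable_comp[OF that(2)] that)+
  have A: "computable (\<lambda>x. A (f x) (g x) (h x))" if "computable f" "computable g" "computable h" for f g h
    unfolding A_def
  proof (rule computable_Least)
    show "\<exists>k. h x \<le> k \<or> (\<forall>b<h x. (k, list_decode (pre (f x) (g x) (Suc b))) \<notin> R)" for x by blast
  qed (intro computable_intros dR pre computable_comp[OF that(1)] computable_comp[OF that(2)] computable_comp[OF that(3)])
  have "computable (\<lambda>z. G (pfst z) (psnd z))"
    unfolding G_def by (intro computable_intros A lev)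
  moreover
  have "(\<lambda>i. prod_encode (x i, y i)) \<in> P \<longleftrightarrow> (\<exists>\<^sub>\<infinity>n. G (rounds_code x (Suc n)) (binval y n) \<noteq> 0)"
    if x: "x \<in> omega_words X" and y: "y \<in> omega_words {0, 1}" for x y
  proof -
    let ?z = "\<lambda>i. prod_encode (x i, y i)"
    define AA where "AA n = (LEAST a. n \<le> a \<or> (\<forall>b<n. \<not> (a, prefix (Suc b) ?z) \<in> R))" for n
    have level: "level (rounds_code x (Suc n)) = n" for n by (simp add: level_def length_rounds_code)
    have letter: "letter (rounds_code x (Suc n)) (binval y n) i = ?z i" if "i < n" for i n
    proof -
      have "binval y n div 2 ^ (n - Suc i) mod 2 = y i"
        using binval_div[OF y, of "Suc i" n] that omega_wordsD[OF y, of i] by auto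
      then show ?thesis
        using that nth_rounds_code[of i "Suc n" x] by (simp add: letter_def level length_rounds_code)
    qed
    have pre': "list_decode (pre (rounds_code x (Suc n)) (binval y n) b) = prefix b ?z" if "b \<le> n" for b n
      using that letter by (auto simp: pre_def subsequence_def)
    have AA': "A (rounds_code x (Suc n)) (binval y n) m = AA m" if "m \<le> n" for m n
    proof -
      have "(m \<le> a \<or> (\<forall>b<m. \<not> (a, list_decode (pre (rounds_code x (Suc n)) (binval y n) (Suc b))) \<in> R))
        = (m \<le> a \<or> (\<forall>b<m. \<not> (a, prefix (Suc b) ?z) \<in> R))" for a
        using that pre' by auto
      then show ?thesis unfolding A_def AA_def by simp
    qed
    have G: "G (rounds_code x (Suc n)) (binval y n) = AA n - AA (n - 1)" for n
      unfolding G_def level using AA' by simp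
    have AA_iff: "a < AA n \<longleftrightarrow> (\<forall>a'\<le>a. a' < n \<and> (\<exists>b<n. (a', prefix (Suc b) ?z) \<in> R))" for a n
    proof
      assume "a < AA n"
      then have "\<not> (n \<le> a' \<or> (\<forall>b<n. \<not> (a', prefix (Suc b) ?z) \<in> R))" if "a' \<le> a" for a'
        using not_less_Least[of a' "\<lambda>a. n \<le> a \<or> (\<forall>b<n. \<not> (a, prefix (Suc b) ?z) \<in> R)"] that
        unfolding AA_def by (meson le_less_trans)
      then show "\<forall>a'\<le>a. a' < n \<and> (\<exists>b<n. (a', prefix (Suc b) ?z) \<in> R)" by (meson not_le)
    next
      assume a: "\<forall>a'\<le>a. a' < n \<and> (\<exists>b<n. (a', prefix (Suc b) ?z) \<in> R)"
      have "n \<le> AA n \<or> (\<forall>b<n. \<not> (AA n, prefix (Suc b) ?z) \<in> R)"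
        unfolding AA_def by (rule LeastI[of _ n]) simp
      then show "a < AA n" using a by (meson not_le)
    qed
    have mono: "AA n \<le> AA (Suc n)" for n
    proof (rule ccontr)
      assume "\<not> ?thesis"
      then have "AA (Suc n) < AA n" by simp
      then have "AA (Suc n) < AA (Suc n)" unfolding AA_iff by (meson less_SucI)
      then show False by simp
    qed
    have "(\<exists>\<^sub>\<infinity>n. G (rounds_code x (Suc n)) (binval y n) \<noteq> 0) \<longleftrightarrow> (\<exists>\<^sub>\<infinity>n. AA n < AA (Suc n))"
      unfolding G INFM_nat_le
    proof (intro iffI allI)
      fix m assume "\<forall>m. \<exists>n\<ge>m. AA n - AA (n - 1) \<noteq> 0"
      then obtain n where "n \<ge> Suc m" "AA n - AA (n - 1) \<noteq> 0" by blast
      then show "\<exists>n\<ge>m. AA n < AA (Suc n)" by (intro exI[of _ "n - 1"]) auto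
    next
      fix m assume "\<forall>m. \<exists>n\<ge>m. AA n < AA (Suc n)"
      then obtain n where "n \<ge> m" "AA n < AA (Suc n)" by blast
      then show "\<exists>n\<ge>m. AA n - AA (n - 1) \<noteq> 0" by (intro exI[of _ "Suc n"]) auto
    qed
    also have "\<dots> \<longleftrightarrow> (\<forall>a. \<exists>n. a < AA n)" by (rule monotone_increments_iff) (rule mono)
    also have "\<dots> \<longleftrightarrow> (\<forall>a. \<exists>b. (a, prefix (Suc b) ?z) \<in> R)"
    proof (intro iffI allI)
      fix a assume "\<forall>a. \<exists>n. a < AA n"
      then show "\<exists>b. (a, prefix (Suc b) ?z) \<in> R" unfolding AA_iff by blast
    next
      fix a assume "\<forall>a. \<exists>b. (a, prefix (Suc b) ?z) \<in> R"
      then obtain b where b: "\<And>a. (a, prefix (Suc (b a)) ?z) \<in> R" by metis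
      \<comment> \<open>The sum bounds the witnesses of all requirements up to \<open>a\<close>, and
        the summand \<open>a\<close> lifts the cap.\<close>
      have "a < AA (Suc (a + (\<Sum>a'\<le>a. b a')))" unfolding AA_iff
      proof (intro allI impI conjI)
        fix a' assume "a' \<le> a"
        then have "b a' \<le> (\<Sum>a'\<le>a. b a')" by (intro member_le_sum) auto
        then show "\<exists>ba<Suc (a + (\<Sum>a'\<le>a. b a')). (a', prefix (Suc ba) ?z) \<in> R"
          using b[of a'] by (intro exI[of _ "b a'"]) auto
      qed simp
      then show "\<exists>n. a < AA n" by blast
    qed
    also have "\<dots> \<longleftrightarrow> ?z \<in> P"
    proof -
      have "x i \<in> X" "y i \<in> {0, 1}" for i using x y omega_wordsD by blast+
      then have "?z \<in> omega_words (prod_encode ` (X \<times> {0, 1}))" by (auto simp: omega_words_def)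
      then show ?thesis by (simp add: P)
    qed
    finally show ?thesis by simp
  qed
  ultimately show ?thesis by (rule that)
qed

section \<open>While programs\<close>

text \<open>The observable output of the machine: \<open>In c d\<close> records a round that is
  read, \<open>Node\<close> ends the treatment of one tree node, a \<open>Mark\<close> in front of
  it marks that node, and \<open>End\<close> closes a level.\<close>

datatype label = Mark | Node | End | In nat nat

datatype com = Lab label | Inc nat | Dec nat | Seq com com (infixr ";;" 60) | While nat com

type_synonym store = "nat \<Rightarrow> nat"

inductive exec :: "com \<Rightarrow> store \<Rightarrow> label list \<Rightarrow> store \<Rightarrow> bool" where
  Lab: "exec (Lab l) s [l] s"
| Inc: "exec (Inc r) s [] (s(r := Suc (s r)))"
| Dec: "exec (Dec r) s [] (s(r := s r - 1))"
| Seq: "exec a s l s' \<Longrightarrow> exec b s' l' s'' \<Longrightarrow> exec (a ;; b) s (l @ l') s''"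
| While_zero: "s r = 0 \<Longrightarrow> exec (While r c) s [] s"
| While_step: "s r \<noteq> 0 \<Longrightarrow> exec c s l s' \<Longrightarrow> exec (While r c) s' l' s'' \<Longrightarrow> exec (While r c) s (l @ l') s''"

lemma exec_Seq_silent: "exec a s [] s' \<Longrightarrow> exec b s' [] s'' \<Longrightarrow> exec (a ;; b) s [] s''"
  using Seq[of a s "[]" s' b "[]" s''] by simp

lemma exec_While_silent: "s r \<noteq> 0 \<Longrightarrow> exec c s [] s' \<Longrightarrow> exec (While r c) s' [] s'' \<Longrightarrow> exec (While r c) s [] s''"
  using While_step[of s r c "[]" s' "[]" s''] by simp

lemma exec_While_invariant:
  fixes m :: "store \<Rightarrow> nat"
  assumes "I s" and step: "\<And>s. I s \<Longrightarrow> s r \<noteq> 0 \<Longrightarrow> \<exists>s'. exec c s [] s' \<and> I s' \<and> m s' < m s"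
  shows "\<exists>s'. exec (While r c) s [] s' \<and> I s' \<and> s' r = 0"
  using assms(1)
proof (induction "m s" arbitrary: s rule: less_induct)
  case less
  show ?case
  proof (cases "s r = 0")
    case True
    then show ?thesis using less.prems While_zero by blast
  next
    case False
    then obtain s' where "exec c s [] s'" "I s'" "m s' < m s" using step less.prems by blast
    then show ?thesis using less.hyps[of s'] exec_While_silent[of s r c s'] False by blast
  qed
qed

section \<open>Register programs for the recursive functions\<close>

definition clear :: "nat \<Rightarrow> com" where "clear r = While r (Dec r)"

lemma exec_clear: "exec (clear r) s [] (s(r := 0))"
proof -
  have "\<exists>s'. exec (While r (Dec r)) s [] s' \<and> (\<forall>j. j \<noteq> r \<longrightarrow> s' j = s j) \<and> s' r = 0"
  proof (rule exec_While_invariant[where m = "\<lambda>s. s r"])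
    fix s' assume "\<forall>j. j \<noteq> r \<longrightarrow> s' j = s j" "s' r \<noteq> 0"
    then show "\<exists>s''. exec (Dec r) s' [] s'' \<and> (\<forall>j. j \<noteq> r \<longrightarrow> s'' j = s j) \<and> s'' r < s' r"
      by (intro exI[of _ "s'(r := s' r - 1)"] conjI exec.Dec) auto
  qed simp
  then obtain s' where s': "exec (While r (Dec r)) s [] s'" "\<And>j. j \<noteq> r \<Longrightarrow> s' j = s j" "s' r = 0" by blast
  have "s' = s(r := 0)" using s'(2,3) by auto
  then show ?thesis using s'(1) by (simp add: clear_def)
qed

text \<open>Registers can only be counted up and down, so \<open>a\<close> is emptied into
  \<open>b\<close> and \<open>t\<close> and then restored from \<open>t\<close>.\<close>

definition copy :: "nat \<Rightarrow> nat \<Rightarrow> nat \<Rightarrow> com" where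
  "copy a b t = clear b ;; clear t ;; While a (Dec a ;; Inc b ;; Inc t) ;; While t (Dec t ;; Inc a)"

lemma exec_copy:
  assumes d: "a \<noteq> b" "a \<noteq> t" "b \<noteq> t"
  shows "exec (copy a b t) s [] (s(b := s a, t := 0))"
proof -
  have 1: "exec (While a (Dec a ;; Inc b ;; Inc t)) s [] (s(a := 0, b := s b + s a, t := s t + s a))" for s
  proof (induction "s a" arbitrary: s)
    case 0
    then have "s(a := 0, b := s b + s a, t := s t + s a) = s" by auto
    then show ?case using While_zero[of s a] 0 by (simp only:)
  next
    case (Suc n)
    let ?s = "s(a := n, b := Suc (s b), t := Suc (s t))"
    have "exec (Dec a) s [] (s(a := s a - 1))" by (rule exec.Dec)
    moreover have "exec (Inc b) (s(a := s a - 1)) [] (s(a := n, b := Suc (s b)))"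
      using exec.Inc[of b "s(a := s a - 1)"] d by (simp add: Suc(2)[symmetric])
    moreover have "exec (Inc t) (s(a := n, b := Suc (s b))) [] ?s"
      using exec.Inc[of t "s(a := n, b := Suc (s b))"] d by simp
    ultimately have "exec (Dec a ;; Inc b ;; Inc t) s [] ?s" by (meson exec_Seq_silent)
    moreover have "exec (While a (Dec a ;; Inc b ;; Inc t)) ?s [] (?s(a := 0, b := ?s b + ?s a, t := ?s t + ?s a))"
      by (rule Suc.hyps(1)) (use d in simp)
    moreover have "?s(a := 0, b := ?s b + ?s a, t := ?s t + ?s a) = s(a := 0, b := s b + s a, t := s t + s a)"
      using d by (auto simp: fun_eq_iff Suc(2)[symmetric])
    ultimately show ?case using exec_While_silent[of s _ _ ?s] by (metis Suc(2) Zero_not_Suc)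
  qed
  have 2: "exec (While t (Dec t ;; Inc a)) s [] (s(t := 0, a := s a + s t))" for s
  proof (induction "s t" arbitrary: s)
    case 0
    then have "s(t := 0, a := s a + s t) = s" by auto
    then show ?case using While_zero[of s t] 0 by (simp only:)
  next
    case (Suc n)
    let ?s = "s(t := n, a := Suc (s a))"
    have "exec (Dec t) s [] (s(t := s t - 1))" by (rule exec.Dec)
    moreover have "exec (Inc a) (s(t := s t - 1)) [] ?s"
      using exec.Inc[of a "s(t := s t - 1)"] d by (simp add: Suc(2)[symmetric])
    ultimately have "exec (Dec t ;; Inc a) s [] ?s" by (meson exec_Seq_silent)
    moreover have "exec (While t (Dec t ;; Inc a)) ?s [] (?s(t := 0, a := ?s a + ?s t))"
      by (rule Suc.hyps(1)) (use d in simp)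
    moreover have "?s(t := 0, a := ?s a + ?s t) = s(t := 0, a := s a + s t)"
      using d by (auto simp: fun_eq_iff Suc(2)[symmetric])
    ultimately show ?case using exec_While_silent[of s _ _ ?s] by (metis Suc(2) Zero_not_Suc)
  qed
  let ?s1 = "s(b := 0)" let ?s2 = "?s1(t := 0)" let ?s3 = "?s2(a := 0, b := ?s2 b + ?s2 a, t := ?s2 t + ?s2 a)"
  let ?s4 = "?s3(t := 0, a := ?s3 a + ?s3 t)"
  have "exec (copy a b t) s [] ?s4"
    unfolding copy_def by (intro exec_Seq_silent[OF exec_clear] exec_Seq_silent[OF 1] 2)
  moreover have "?s4 = s(b := s a, t := 0)" using d by (auto simp: fun_eq_iff)
  ultimately show ?thesis by simp
qed

text \<open>A subroutine is silent and starts from an arbitrary store. Registers from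
  \<open>base\<close> on are its scratch space; a caller keeps its own data below
  \<open>base\<close>.\<close>

definition computes :: "com \<Rightarrow> nat \<Rightarrow> nat \<Rightarrow> (store \<Rightarrow> nat) \<Rightarrow> bool" where
  "computes c out base v \<longleftrightarrow>
    (\<forall>s. \<exists>s'. exec c s [] s' \<and> s' out = v s \<and> (\<forall>r<base. r \<noteq> out \<longrightarrow> s' r = s r))"

lemma computesD:
  "computes c out base v \<Longrightarrow> \<exists>s'. exec c s [] s' \<and> s' out = v s \<and> (\<forall>r<base. r \<noteq> out \<longrightarrow> s' r = s r)"
  unfolding computes_def by blast

definition programmable :: "nat \<Rightarrow> (nat list \<Rightarrow> nat) \<Rightarrow> bool" where
  "programmable n f \<longleftrightarrow>
    (\<forall>ins (out::nat) base. length ins = n \<longrightarrow> set ins \<subseteq> {..<base} \<longrightarrow> out < base \<longrightarrow> out \<notin> set ins \<longrightarrow>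
      (\<exists>c. computes c out base (\<lambda>s. f (map s ins))))"

lemma programmableD:
  "programmable n f \<Longrightarrow> length ins = n \<Longrightarrow> set ins \<subseteq> {..<base} \<Longrightarrow> out < base \<Longrightarrow> out \<notin> set ins \<Longrightarrow>
    \<exists>c. computes c out base (\<lambda>s. f (map s ins))"
  unfolding programmable_def by blast

lemma map_store_cong: "set ins \<subseteq> {..<base} \<Longrightarrow> (\<And>r. r < base \<Longrightarrow> s' r = s r) \<Longrightarrow> map s' ins = map s ins"
  by (induction ins) auto

lemma programmable_list:
  assumes "\<And>g. g \<in> set gs \<Longrightarrow> programmable n g" "length ins = n" "set ins \<subseteq> {..<b}"
  shows "\<exists>c. \<forall>s. \<exists>s'. exec c s [] s' \<and> (\<forall>i<length gs. s' (b + i) = (gs ! i) (map s ins)) \<and> (\<forall>r<b. s' r = s r)"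
  using assms(1)
proof (induction gs rule: rev_induct)
  case Nil
  \<comment> \<open>There is no empty command; clearing a scratch register serves as one.\<close>
  have "exec (clear b) s [] (s(b := 0))" for s by (rule exec_clear)
  then show ?case by (intro exI[of _ "clear b"]) (metis fun_upd_other less_irrefl less_nat_zero_code list.size(3))
next
  case (snoc g gs)
  obtain c where c: "\<And>s. \<exists>s'. exec c s [] s' \<and> (\<forall>i<length gs. s' (b + i) = (gs ! i) (map s ins)) \<and> (\<forall>r<b. s' r = s r)"
    using snoc by auto
  obtain c' where c': "computes c' (b + length gs) (Suc (b + length gs)) (\<lambda>s. g (map s ins))"
    using programmableD[of n g ins "Suc (b + length gs)" "b + length gs"] snoc.prems assms(2,3) by fastforce
  have "\<exists>s''. exec (c ;; c') s [] s'' \<and> (\<forall>i<length (gs @ [g]). s'' (b + i) = ((gs @ [g]) ! i) (map s ins)) \<and> (\<forall>r<b. s'' r = s r)"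
    for s
  proof -
    obtain s' where s': "exec c s [] s'" "\<And>i. i < length gs \<Longrightarrow> s' (b + i) = (gs ! i) (map s ins)" "\<And>r. r < b \<Longrightarrow> s' r = s r"
      using c by metis
    obtain s'' where s'': "exec c' s' [] s''" "s'' (b + length gs) = g (map s' ins)"
      "\<And>r. r < Suc (b + length gs) \<Longrightarrow> r \<noteq> b + length gs \<Longrightarrow> s'' r = s' r"
      using computesD[OF c', of s'] by metis
    have eq: "map s' ins = map s ins" using assms(3) s'(3) by (rule map_store_cong)
    show ?thesis using s' s''[unfolded eq] by (intro exI[of _ s''] conjI exec_Seq_silent[of c s s']) (auto simp: less_Suc_eq nth_append)
  qed
  then show ?case by blast
qed

lemma programmable_comp:
  assumes f: "programmable (length gs) f" and gs: "\<And>g. g \<in> set gs \<Longrightarrow> programmable n g"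
  shows "programmable n (\<lambda>xs. f (map (\<lambda>g. g xs) gs))"
  unfolding programmable_def
proof (intro allI impI)
  fix ins and out base :: nat
  assume a: "length ins = n" "set ins \<subseteq> {..<base}" "out < base" "out \<notin> set ins"
  obtain c where c: "\<And>s. \<exists>s'. exec c s [] s' \<and> (\<forall>i<length gs. s' (base + i) = (gs ! i) (map s ins)) \<and> (\<forall>r<base. s' r = s r)"
    using programmable_list[OF gs a(1,2)] by blast
  obtain c' where c': "computes c' out (base + length gs) (\<lambda>s. f (map s [base..<base + length gs]))"
    using programmableD[OF f, of "[base..<base + length gs]" "base + length gs" out] a(3)
    by (auto simp: subset_iff)
  have "computes (c ;; c') out base (\<lambda>s. f (map (\<lambda>g. g (map s ins)) gs))"
    unfolding computes_def
  proof
    fix s :: store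
    obtain s' where s': "exec c s [] s'" "\<And>i. i < length gs \<Longrightarrow> s' (base + i) = (gs ! i) (map s ins)" "\<And>r. r < base \<Longrightarrow> s' r = s r"
      using c by metis
    obtain s'' where s'': "exec c' s' [] s''" "s'' out = f (map s' [base..<base + length gs])"
      "\<And>r. r < base + length gs \<Longrightarrow> r \<noteq> out \<Longrightarrow> s'' r = s' r"
      using computesD[OF c', of s'] by metis
    have "map s' [base..<base + length gs] = map (\<lambda>g. g (map s ins)) gs"
      using s'(2) by (auto intro: nth_equalityI)
    then show "\<exists>s'. exec (c ;; c') s [] s' \<and> s' out = f (map (\<lambda>g. g (map s ins)) gs) \<and> (\<forall>r<base. r \<noteq> out \<longrightarrow> s' r = s r)"
      using s' s'' by (intro exI[of _ s''] conjI exec_Seq_silent[of c s s']) auto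
  qed
  then show "\<exists>c. computes c out base (\<lambda>s. f (map (\<lambda>g. g (map s ins)) gs))" by blast
qed

lemma programmable_prim_rec:
  assumes f: "programmable n f" and g: "programmable (n + 2) g"
  shows "programmable (n + 1) (\<lambda>xs. rec_nat (f (tl xs)) (\<lambda>k r. g (k # r # tl xs)) (hd xs))"
  unfolding programmable_def
proof (intro allI impI)
  fix ins and out base :: nat
  assume a: "length ins = n + 1" "set ins \<subseteq> {..<base}" "out < base" "out \<notin> set ins"
  obtain i0 rest where ins: "ins = i0 # rest" using a(1) by (cases ins) auto
  let ?k = "base" and ?a = "base + 1" and ?t = "base + 2" and ?c = "base + 3" and ?tmp = "base + 4"
  obtain cf where cf: "computes cf ?a (base + 5) (\<lambda>s. f (map s rest))"
    using programmableD[OF f, of rest "base + 5" ?a] a ins by fastforce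
  obtain cg where cg: "computes cg ?t (base + 5) (\<lambda>s. g (map s (?k # ?a # rest)))"
    using programmableD[OF g, of "?k # ?a # rest" "base + 5" ?t] a ins by fastforce
  define body where "body = cg ;; copy ?t ?a ?tmp ;; Inc ?k ;; Dec ?c"
  have "computes (cf ;; clear ?k ;; copy i0 ?c ?tmp ;; While ?c body ;; copy ?a out ?tmp) out base
    (\<lambda>s. rec_nat (f (tl (map s ins))) (\<lambda>k r. g (k # r # tl (map s ins))) (hd (map s ins)))"
    unfolding computes_def
  proof
    fix s :: store
    let ?xs = "map s rest"
    define h where "h = rec_nat (f ?xs) (\<lambda>k r. g (k # r # ?xs))"
    have xs: "map s' rest = ?xs" if "\<And>r. r < base \<Longrightarrow> s' r = s r" for s'
      by (rule map_store_cong[of _ base]) (use a ins that in auto)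
    obtain s1 where s1: "exec cf s [] s1" "s1 ?a = f ?xs" "\<And>r. r < base + 5 \<Longrightarrow> r \<noteq> ?a \<Longrightarrow> s1 r = s r"
      using computesD[OF cf, of s] by metis
    let ?s2 = "s1(?k := 0)" let ?s3 = "?s2(?c := ?s2 i0, ?tmp := 0)"
    \<comment> \<open>Register \<open>?k\<close> counts the steps done and \<open>?c\<close> the
      steps left, while \<open>?a\<close> holds the value of the recursion at
      \<open>?k\<close>.\<close>
    define I where "I s' \<longleftrightarrow> s' ?k + s' ?c = s i0 \<and> s' ?a = h (s' ?k) \<and> (\<forall>r<base. s' r = s r)" for s' :: store
    have i0: "i0 < base" using a ins by simp
    have I3: "I ?s3" using s1 i0 by (simp add: I_def h_def)
    have "\<exists>s'. exec (While ?c body) ?s3 [] s' \<and> I s' \<and> s' ?c = 0"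
    proof (rule exec_While_invariant[where I = I and m = "\<lambda>s. s ?c", OF I3])
      fix u assume u: "I u" "u ?c \<noteq> 0"
      obtain u1 where u1: "exec cg u [] u1" "u1 ?t = g (map u (?k # ?a # rest))"
        "\<And>r. r < base + 5 \<Longrightarrow> r \<noteq> ?t \<Longrightarrow> u1 r = u r"
        using computesD[OF cg, of u] by metis
      let ?u2 = "u1(?a := u1 ?t, ?tmp := 0)" let ?u3 = "?u2(?k := Suc (?u2 ?k))" let ?u4 = "?u3(?c := ?u3 ?c - 1)"
      have "exec body u [] ?u4" unfolding body_def
        by (intro exec_Seq_silent[OF u1(1)] exec_Seq_silent[OF exec_copy] exec_Seq_silent[OF exec.Inc] exec.Dec) auto
      moreover have "I ?u4" using u u1 xs[of u] by (auto simp: I_def h_def)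
      moreover have "?u4 ?c < u ?c" using u u1 by simp
      ultimately show "\<exists>s'. exec body u [] s' \<and> I s' \<and> s' ?c < u ?c" by blast
    qed
    then obtain s4 where s4: "exec (While ?c body) ?s3 [] s4" "I s4" "s4 ?c = 0" by blast
    let ?s5 = "s4(out := s4 ?a, ?tmp := 0)"
    have "exec (cf ;; clear ?k ;; copy i0 ?c ?tmp ;; While ?c body ;; copy ?a out ?tmp) s [] ?s5"
      by (intro exec_Seq_silent[OF s1(1)] exec_Seq_silent[OF exec_clear] exec_Seq_silent[OF exec_copy]
          exec_Seq_silent[OF s4(1)] exec_copy) (use i0 a in auto)
    moreover have "?s5 out = h (s i0)" using s4 a by (auto simp: I_def)
    moreover have "\<forall>r<base. r \<noteq> out \<longrightarrow> ?s5 r = s r" using s4 by (auto simp: I_def)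
    ultimately show "\<exists>s'. exec (cf ;; clear ?k ;; copy i0 ?c ?tmp ;; While ?c body ;; copy ?a out ?tmp) s [] s' \<and>
      s' out = rec_nat (f (tl (map s ins))) (\<lambda>k r. g (k # r # tl (map s ins))) (hd (map s ins)) \<and>
      (\<forall>r<base. r \<noteq> out \<longrightarrow> s' r = s r)" unfolding h_def ins by auto
  qed
  then show "\<exists>c. computes c out base (\<lambda>s. rec_nat (f (tl (map s ins))) (\<lambda>k r. g (k # r # tl (map s ins))) (hd (map s ins)))"
    by blast
qed

lemma programmable_minimization:
  assumes f: "programmable (n + 1) f" and ex: "\<And>xs. length xs = n \<Longrightarrow> \<exists>k. f (k # xs) = 0"
  shows "programmable n (\<lambda>xs. LEAST k. f (k # xs) = 0)"
  unfolding programmable_def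
proof (intro allI impI)
  fix ins and out base :: nat
  assume a: "length ins = n" "set ins \<subseteq> {..<base}" "out < base" "out \<notin> set ins"
  let ?k = "base" and ?t = "base + 1" and ?tmp = "base + 2"
  obtain c where c: "computes c ?t (base + 3) (\<lambda>s. f (map s (?k # ins)))"
    using programmableD[OF f, of "?k # ins" "base + 3" ?t] a by fastforce
  define body where "body = Inc ?k ;; c"
  have "computes (clear ?k ;; c ;; While ?t body ;; copy ?k out ?tmp) out base (\<lambda>s. LEAST k. f (k # map s ins) = 0)"
    unfolding computes_def
  proof
    fix s :: store
    let ?xs = "map s ins"
    \<comment> \<open>Any zero of \<open>f\<close> bounds the search and supplies the variant
      \<open>K - s ?k\<close> of the loop.\<close>
    obtain K where K: "f (K # ?xs) = 0" using ex[of ?xs] a by auto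
    have xs: "map s' ins = ?xs" if "\<And>r. r < base \<Longrightarrow> s' r = s r" for s'
      by (rule map_store_cong[of _ base]) (use a that in auto)
    let ?s1 = "s(?k := 0)"
    obtain s2 where s2: "exec c ?s1 [] s2" "s2 ?t = f (map ?s1 (?k # ins))" "\<And>r. r < base + 3 \<Longrightarrow> r \<noteq> ?t \<Longrightarrow> s2 r = ?s1 r"
      using computesD[OF c, of ?s1] by metis
    define I where "I s' \<longleftrightarrow> s' ?t = f (s' ?k # ?xs) \<and> (\<forall>i<s' ?k. f (i # ?xs) \<noteq> 0) \<and> (\<forall>r<base. s' r = s r)" for s' :: store
    have I2: "I s2" using s2 xs[of ?s1] by (simp add: I_def)
    have "\<exists>s'. exec (While ?t body) s2 [] s' \<and> I s' \<and> s' ?t = 0"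
    proof (rule exec_While_invariant[where I = I and m = "\<lambda>s. K - s ?k", OF I2])
      fix u assume u: "I u" "u ?t \<noteq> 0"
      let ?u1 = "u(?k := Suc (u ?k))"
      obtain u2 where u2: "exec c ?u1 [] u2" "u2 ?t = f (map ?u1 (?k # ins))" "\<And>r. r < base + 3 \<Longrightarrow> r \<noteq> ?t \<Longrightarrow> u2 r = ?u1 r"
        using computesD[OF c, of ?u1] by metis
      have "exec body u [] u2" unfolding body_def by (rule exec_Seq_silent[OF exec.Inc u2(1)])
      moreover have "I u2" using u u2 xs[of ?u1] by (auto simp: I_def less_Suc_eq)
      moreover have "u ?k < K"
      proof (rule ccontr)
        assume "\<not> u ?k < K"
        then have "K = u ?k \<or> K < u ?k" by linarith
        then show False using u K by (auto simp: I_def)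
      qed
      then have "K - u2 ?k < K - u ?k" using u2 by simp
      ultimately show "\<exists>s'. exec body u [] s' \<and> I s' \<and> K - s' ?k < K - u ?k" by blast
    qed
    then obtain s4 where s4: "exec (While ?t body) s2 [] s4" "I s4" "s4 ?t = 0" by blast
    let ?s5 = "s4(out := s4 ?k, ?tmp := 0)"
    have "exec (clear ?k ;; c ;; While ?t body ;; copy ?k out ?tmp) s [] ?s5"
      by (intro exec_Seq_silent[OF exec_clear] exec_Seq_silent[OF s2(1)] exec_Seq_silent[OF s4(1)] exec_copy) (use a in auto)
    moreover have "?s5 out = (LEAST k. f (k # ?xs) = 0)"
    proof -
      have "(LEAST k. f (k # ?xs) = 0) = s4 ?k"
        by (rule Least_equality) (use s4 in \<open>auto simp: I_def not_less[symmetric]\<close>)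
      then show ?thesis using a by auto
    qed
    moreover have "\<forall>r<base. r \<noteq> out \<longrightarrow> ?s5 r = s r" using s4 by (auto simp: I_def)
    ultimately show "\<exists>s'. exec (clear ?k ;; c ;; While ?t body ;; copy ?k out ?tmp) s [] s' \<and>
      s' out = (LEAST k. f (k # map s ins) = 0) \<and> (\<forall>r<base. r \<noteq> out \<longrightarrow> s' r = s r)" by blast
  qed
  then show "\<exists>c. computes c out base (\<lambda>s. LEAST k. f (k # map s ins) = 0)" by blast
qed

lemma recursive_fun_programmable: "recursive_fun n f \<Longrightarrow> programmable n f"
proof (induction rule: recursive_fun.induct)
  case (zero n)
  have "computes (clear out) out base (\<lambda>s. 0)" for out base
    unfolding computes_def by (intro allI exI[of _ "_(out := 0)"] conjI) (auto intro: exec_clear)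
  then show ?case unfolding programmable_def by blast
next
  case succ
  show ?case unfolding programmable_def
  proof (intro allI impI)
    fix ins and out base :: nat
    assume a: "length ins = 1" "set ins \<subseteq> {..<base}" "out < base" "out \<notin> set ins"
    then obtain i where i: "ins = [i]" "i < base" "i \<noteq> out" by (cases ins) auto
    have "exec (copy i out base ;; Inc out) s [] (s(out := Suc (s i), base := 0))" for s
    proof -
      have "exec (Inc out) (s(out := s i, base := 0)) [] (s(out := Suc (s i), base := 0))"
        using exec.Inc[of out "s(out := s i, base := 0)"] a by (simp add: fun_upd_twist)
      then show ?thesis using exec_Seq_silent[OF exec_copy[of i out base s]] i a by auto
    qed
    then have "computes (copy i out base ;; Inc out) out base (\<lambda>s. Suc (map s ins ! 0))"
      unfolding computes_def i using a(3) by (intro allI exI[of _ "_(out := Suc (_ i), base := 0)"] conjI) (auto simp: i)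
    then show "\<exists>c. computes c out base (\<lambda>s. Suc (map s ins ! 0))" by blast
  qed
next
  case (proj i n)
  show ?case unfolding programmable_def
  proof (intro allI impI)
    fix ins and out base :: nat
    assume a: "length ins = n" "set ins \<subseteq> {..<base}" "out < base" "out \<notin> set ins"
    have i: "ins ! i \<in> set ins" using proj a by simp
    then have i': "ins ! i < base" "ins ! i \<noteq> out" using a by auto
    then have "computes (copy (ins ! i) out base) out base (\<lambda>s. map s ins ! i)"
      unfolding computes_def using a proj
      by (intro allI exI[of _ "_(out := _ (ins ! i), base := 0)"] conjI) (auto intro!: exec_copy)
    then show "\<exists>c. computes c out base (\<lambda>s. map s ins ! i)" by blast
  qed
next
  case (comp gs f n)
  then show ?case by (intro programmable_comp)
next
  case (prim_rec n f g)
  then show ?case by (intro programmable_prim_rec)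
next
  case (minimization n f)
  then show ?case by (intro programmable_minimization)
qed

lemma computable_program1:
  assumes "computable f" "r < base" "out < base" "out \<noteq> r"
  obtains c where "computes c out base (\<lambda>s. f (s r))"
proof -
  obtain f' where f': "recursive_fun 1 f'" "\<And>xs. length xs = 1 \<Longrightarrow> f' xs = f (xs ! 0)"
    using assms(1) unfolding computable_def recfun_def by blast
  obtain c where "computes c out base (\<lambda>s. f' (map s [r]))"
    using programmableD[OF recursive_fun_programmable[OF f'(1)], of "[r]" base out] assms by auto
  then show ?thesis using f' that by simp
qed

lemma computable_program2:
  assumes "computable (\<lambda>z. f (pfst z) (psnd z))" "r < base" "r' < base" "out < base" "out \<noteq> r" "out \<noteq> r'"
  obtains c where "computes c out base (\<lambda>s. f (s r) (s r'))"
proof -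
  have "recfun 2 (\<lambda>xs. (\<lambda>z. f (pfst z) (psnd z)) (prod_encode (xs ! 0, xs ! 1)))"
    by (rule recfun_computable[OF assms(1)]) (auto intro!: recfun_prod_encode recfun_proj)
  then obtain f' where f': "recursive_fun 2 f'" "\<And>xs. length xs = 2 \<Longrightarrow> f' xs = f (xs ! 0) (xs ! 1)"
    unfolding recfun_def by auto
  obtain c where "computes c out base (\<lambda>s. f' (map s [r, r']))"
    using programmableD[OF recursive_fun_programmable[OF f'(1)], of "[r, r']" base out] assms by auto
  then show ?thesis using f' that by simp
qed

section \<open>Small-step semantics with continuations\<close>

text \<open>A continuation is the stack of commands still to be executed. The store enters the
  choice of the next one through a single zero test, so a finite acceptor can check it while reading
  one line.\<close>

fun next_cont :: "com list \<Rightarrow> bool \<Rightarrow> com list" where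
  "next_cont [] z = []"
| "next_cont (Lab l # K) z = K"
| "next_cont (Inc r # K) z = K"
| "next_cont (Dec r # K) z = K"
| "next_cont ((a ;; b) # K) z = a # b # K"
| "next_cont (While r c # K) z = (if z then K else c # While r c # K)"

fun test_reg :: "com list \<Rightarrow> nat" where
  "test_reg (While r c # K) = r"
| "test_reg _ = 0"

fun upd_reg :: "com list \<Rightarrow> nat \<Rightarrow> nat \<Rightarrow> nat" where
  "upd_reg (Inc r # K) j v = (if j = r then Suc v else v)"
| "upd_reg (Dec r # K) j v = (if j = r then v - 1 else v)"
| "upd_reg _ j v = v"

fun labels :: "com list \<Rightarrow> label list" where
  "labels (Lab l # K) = [l]"
| "labels _ = []"

lemma length_labels: "length (labels K) \<le> 1"
  by (cases K rule: labels.cases) auto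

type_synonym config = "com list \<times> store"

definition step :: "config \<Rightarrow> config" where
  "step c = (next_cont (fst c) (snd c (test_reg (fst c)) = 0), \<lambda>j. upd_reg (fst c) j (snd c j))"

inductive mpath :: "config \<Rightarrow> label list \<Rightarrow> config \<Rightarrow> bool" where
  here: "mpath c [] c"
| there: "fst c \<noteq> [] \<Longrightarrow> mpath (step c) ls c' \<Longrightarrow> mpath c (labels (fst c) @ ls) c'"

lemma mpath_trans: "mpath c ls c' \<Longrightarrow> mpath c' ls' c'' \<Longrightarrow> mpath c (ls @ ls') c''"
proof (induction rule: mpath.induct)
  case (there c ls c')
  then show ?case using mpath.there[of c "ls @ ls'" c''] by simp
qed simp

lemma mpath_step: "fst c \<noteq> [] \<Longrightarrow> mpath c (labels (fst c)) (step c)"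
  using mpath.there[OF _ mpath.here, of c] by simp

lemma exec_mpath: "exec c s ls s' \<Longrightarrow> mpath (c # K, s) ls (K, s')"
proof (induction arbitrary: K rule: exec.induct)
  case (Lab l s)
  then show ?case using mpath_step[of "(Lab l # K, s)"] by (simp add: step_def)
next
  case (Inc r s)
  show ?case using mpath_step[of "(Inc r # K, s)"] by (simp add: step_def fun_upd_def if_distrib cong: if_cong)
next
  case (Dec r s)
  show ?case using mpath_step[of "(Dec r # K, s)"] by (simp add: step_def fun_upd_def if_distrib cong: if_cong)
next
  case (Seq a s l s' b l' s'')
  have "mpath ((a ;; b) # K, s) [] (a # b # K, s)"
    using mpath_step[of "((a ;; b) # K, s)"] by (simp add: step_def)
  from mpath_trans[OF this mpath_trans[OF Seq.IH]] show ?case by simp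
next
  case (While_zero s r c)
  then show ?case using mpath_step[of "(While r c # K, s)"] by (simp add: step_def)
next
  case (While_step s r c l s' l' s'')
  have "mpath (While r c # K, s) [] (c # While r c # K, s)"
    using mpath_step[of "(While r c # K, s)"] While_step.hyps by (simp add: step_def)
  from mpath_trans[OF this mpath_trans[OF While_step.IH]] show ?case by simp
qed

text \<open>Outside the empty continuation a run is forced, so every path reappears as a segment of
  it.\<close>

lemma mpath_run:
  assumes run: "\<And>n. fst (cf n) \<noteq> [] \<Longrightarrow> cf (Suc n) = step (cf n)"
  shows "mpath c ls c' \<Longrightarrow> cf n = c \<Longrightarrow> \<exists>m\<ge>n. cf m = c' \<and> concat (map (\<lambda>i. labels (fst (cf i))) [n..<m]) = ls"
proof (induction arbitrary: n rule: mpath.induct)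
  case (here c)
  then show ?case by (intro exI[of _ n]) simp
next
  case (there c ls c')
  have "cf (Suc n) = step c" using run[of n] there by simp
  then obtain m where m: "m \<ge> Suc n" "cf m = c'" "concat (map (\<lambda>i. labels (fst (cf i))) [Suc n..<m]) = ls"
    using there.IH by blast
  have "[n..<m] = n # [Suc n..<m]" using m(1) by (simp add: upt_conv_Cons)
  then show ?case using m there.prems by (intro exI[of _ m]) auto
qed

text \<open>The continuations that can arise while \<open>c\<close> is executed on top of
  \<open>K\<close>. A loop body always runs on the same continuation, so the set is finite and
  continuations can serve as letters.\<close>

primrec conts :: "com \<Rightarrow> com list \<Rightarrow> com list set" where
  "conts (Lab l) K = {Lab l # K, K}"
| "conts (Inc r) K = {Inc r # K, K}"
| "conts (Dec r) K = {Dec r # K, K}"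
| "conts (Seq a b) K = insert ((a ;; b) # K) (conts a (b # K) \<union> conts b K)"
| "conts (While r c) K = insert K (insert (While r c # K) (conts c (While r c # K)))"

lemma finite_conts: "finite (conts c K)"
  by (induction c arbitrary: K) auto

lemma conts_start: "c # K \<in> conts c K"
  by (cases c) auto

lemma conts_end: "K \<in> conts c K"
  by (induction c arbitrary: K) auto

lemma next_cont_conts: "K' \<in> conts c K \<Longrightarrow> K' \<noteq> K \<Longrightarrow> next_cont K' z \<in> conts c K"
proof (induction c arbitrary: K)
  case (Seq a b)
  then show ?case using conts_start conts_end by (cases "K' = b # K") auto
next
  case (While r c)
  then show ?case using conts_start[of c "While r c # K"] by (cases "K' = While r c # K") auto
qed (auto split: if_splits)

section \<open>The label stream of a round program\<close>

text \<open>The value \<open>g k\<close> appears in unary as marks in front of the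
  \<open>k\<close>-th \<open>Node\<close>, because a loop emits one mark per decrement.\<close>

definition node_labels :: "(nat \<Rightarrow> nat) \<Rightarrow> nat \<Rightarrow> label list" where
  "node_labels g n = concat (map (\<lambda>k. replicate (g k) Mark @ [Node]) [0..<n])"

lemma node_labels_Suc: "node_labels g (Suc n) = node_labels g n @ replicate (g n) Mark @ [Node]"
  by (simp add: node_labels_def)

definition push_round :: "nat \<Rightarrow> nat \<Rightarrow> nat \<Rightarrow> nat" where
  "push_round c d C = Suc (prod_encode (d, Suc (prod_encode (c, C))))"

lemma push_round_rounds_code: "push_round (x (2 * n)) (x (Suc (2 * n))) (rounds_code x n) = rounds_code x (Suc n)"
  by (simp add: push_round_def rounds_code_def)

definition level_size :: "nat \<Rightarrow> nat" where
  "level_size C = 2 ^ (length_code C div 2 - 1)"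

lemma level_size_rounds_code: "level_size (rounds_code x (Suc n)) = 2 ^ n"
  by (simp add: level_size_def length_rounds_code)

lemma exec_Mark_loop: "s r = n \<Longrightarrow> exec (While r (Lab Mark ;; Dec r)) s (replicate n Mark) (s(r := 0))"
proof (induction n arbitrary: s)
  case 0
  then have "s(r := 0) = s" by auto
  then show ?case using 0 While_zero[of s r] by simp
next
  case (Suc n)
  have "exec (Lab Mark ;; Dec r) s ([Mark] @ []) (s(r := s r - 1))" by (rule exec.Seq[OF exec.Lab exec.Dec])
  from exec.While_step[OF _ this Suc.IH[of "s(r := s r - 1)"]] show ?case using Suc.prems by (simp add: fun_upd_idem_iff fun_upd_def) (simp cong: if_cong)
qed

text \<open>Register \<open>0\<close> keeps the code of the play, \<open>1\<close> the number of
  nodes still to be listed, \<open>2\<close> computed values, and \<open>3\<close> is the auxiliary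
  register of \<open>copy\<close>. The new code is computed into \<open>2\<close> and copied back,
  since the output register of a subroutine differs from its inputs. The current node is
  \<open>level_size C - s 1\<close>.\<close>

lemma round_program:
  assumes G: "computable (\<lambda>z. G (pfst z) (psnd z))"
  obtains prog where "\<And>c d s. let C = push_round c d (s 0) in
    \<exists>s'. exec (prog c d) s (node_labels (G C) (level_size C) @ [End]) s' \<and> s' 0 = C"
proof -
  have "computable (push_round c d)" for c d
    unfolding push_round_def[abs_def] by (intro computable_intros)
  then have "\<exists>p. computes p 2 4 (\<lambda>s. push_round c d (s 0))" for c d
    using computable_program1[of "push_round c d" 0 4 2] by fastforce
  then obtain pu where pu: "\<And>c d. computes (pu c d) 2 4 (\<lambda>s. push_round c d (s 0))" by metis
  have "computable level_size" unfolding level_size_def[abs_def] by (intro computable_intros)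
  then obtain pn where pn: "computes pn 1 4 (\<lambda>s. level_size (s 0))"
    using computable_program1[of level_size 0 4 1] by fastforce
  have ls: "computable (\<lambda>x. level_size (f x))" if "computable f" for f
    unfolding level_size_def by (intro computable_intros that)
  have "computable (\<lambda>z. (\<lambda>z. G (pfst z) (psnd z)) (prod_encode (pfst z, level_size (pfst z) - psnd z)))"
    by (rule computable_comp[OF G]) (intro computable_intros ls)
  then have "computable (\<lambda>z. G (pfst z) (level_size (pfst z) - psnd z))" by simp
  then obtain pg where pg: "computes pg 2 4 (\<lambda>s. G (s 0) (level_size (s 0) - s 1))"
    using computable_program2[of "\<lambda>C i. G C (level_size C - i)" 0 4 1 2] by fastforce
  define body where "body = pg ;; While 2 (Lab Mark ;; Dec 2) ;; Lab Node ;; Dec 1"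
  define prog where "prog c d = pu c d ;; copy 2 0 3 ;; pn ;; While 1 body ;; Lab End" for c d
  \<comment> \<open>\<open>i\<close> nodes remain to be listed, and \<open>ls\<close> is the part of
    the listing that they produce.\<close>
  have loop: "\<exists>s'. exec (While 1 body) s ls s' \<and> s' 0 = C"
    if "s 0 = C" "s 1 = i" "i \<le> level_size C" "node_labels (G C) (level_size C) = node_labels (G C) (level_size C - i) @ ls"
    for s C i ls
    using that
  proof (induction i arbitrary: s ls)
    case 0
    then show ?case using While_zero[of s 1 body] by auto
  next
    case (Suc i)
    let ?k = "level_size C - Suc i"
    obtain s1 where s1: "exec pg s [] s1" "s1 2 = G (s 0) (level_size (s 0) - s 1)" "\<And>r. r < 4 \<Longrightarrow> r \<noteq> 2 \<Longrightarrow> s1 r = s r"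
      using computesD[OF pg, of s] by metis
    let ?s2 = "s1(2 := 0)" let ?s3 = "?s2(1 := ?s2 1 - 1)"
    have "exec body s ([] @ replicate (s1 2) Mark @ [Node] @ []) ?s3"
      unfolding body_def by (intro exec.Seq[OF s1(1)] exec.Seq[OF exec_Mark_loop[OF refl]] exec.Seq[OF exec.Lab] exec.Dec)
    then have b: "exec body s (replicate (G C ?k) Mark @ [Node]) ?s3" using s1(2) Suc.prems by simp
    have k: "level_size C - i = Suc ?k" using Suc.prems(3) by simp
    have pre: "\<exists>ls'. node_labels (G C) n = node_labels (G C) m @ ls'" if "m \<le> n" for m n
      using that by (induction rule: dec_induct) (auto simp: node_labels_Suc)
    obtain ls' where ls': "node_labels (G C) (level_size C) = node_labels (G C) (level_size C - i) @ ls'"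
      using pre[of "level_size C - i" "level_size C"] by auto
    have "ls = (replicate (G C ?k) Mark @ [Node]) @ ls'"
      using Suc.prems(4) ls' unfolding k node_labels_Suc by simp
    moreover have "\<exists>s'. exec (While 1 body) ?s3 ls' s' \<and> s' 0 = C"
      by (rule Suc.IH) (use s1 Suc.prems ls' in auto)
    moreover have "s 1 \<noteq> 0" using Suc.prems by simp
    ultimately show ?case using exec.While_step[OF _ b] by blast
  qed
  have "\<exists>s'. exec (prog c d) s (node_labels (G C) (level_size C) @ [End]) s' \<and> s' 0 = C"
    if C: "C = push_round c d (s 0)" for c d s C
  proof -
    obtain s1 where s1: "exec (pu c d) s [] s1" "s1 2 = C" using computesD[OF pu[of c d], of s] C by metis
    let ?s2 = "s1(0 := s1 2, 3 := 0)"
    have s2: "exec (copy 2 0 3) s1 [] ?s2" by (rule exec_copy) auto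
    obtain s3 where s3: "exec pn ?s2 [] s3" "s3 1 = level_size C" "s3 0 = C"
      using computesD[OF pn, of ?s2] s1(2) by (auto simp: fun_upd_apply)
    obtain s4 where s4: "exec (While 1 body) s3 (node_labels (G C) (level_size C)) s4" "s4 0 = C"
      using loop[of s3 C "level_size C" "node_labels (G C) (level_size C)"] s3 by (auto simp: node_labels_def)
    have "exec (prog c d) s ([] @ [] @ [] @ node_labels (G C) (level_size C) @ [End]) s4"
      unfolding prog_def by (intro exec.Seq[OF s1(1)] exec.Seq[OF s2] exec.Seq[OF s3(1)] exec.Seq[OF s4(1)] exec.Lab)
    then show ?thesis using s4(2) by auto
  qed
  then show ?thesis using that[of prog] by (simp add: Let_def)
qed

definition block :: "(nat \<Rightarrow> nat \<Rightarrow> nat) \<Rightarrow> (nat \<Rightarrow> nat) \<Rightarrow> nat \<Rightarrow> label list" where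
  "block G x n = In (x (2 * n)) (x (2 * n + 1)) # node_labels (G (rounds_code x (Suc n))) (2 ^ n) @ [End]"

definition blocks :: "(nat \<Rightarrow> nat \<Rightarrow> nat) \<Rightarrow> (nat \<Rightarrow> nat) \<Rightarrow> nat \<Rightarrow> label list" where
  "blocks G x n = concat (map (block G x) [0..<n])"

lemma blocks_Suc: "blocks G x (Suc n) = blocks G x n @ block G x n"
  by (simp add: blocks_def)

lemma blocks_0 [simp]: "blocks G x 0 = []"
  by (simp add: blocks_def)

text \<open>Only the cuts between rounds are prescribed; since a position carries at most one label,
  every other cut can be found as well.\<close>

definition label_stream :: "(nat \<Rightarrow> nat \<Rightarrow> nat) \<Rightarrow> (nat \<Rightarrow> nat) \<Rightarrow> (nat \<Rightarrow> label list) \<Rightarrow> bool" where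
  "label_stream G x lab \<longleftrightarrow>
    (\<forall>i. length (lab i) \<le> 1) \<and> (\<forall>n. \<exists>i. concat (map lab [0..<i]) = blocks G x n)"

locale machine =
  fixes X :: "nat set" and G :: "nat \<Rightarrow> nat \<Rightarrow> nat" and prog :: "nat \<Rightarrow> nat \<Rightarrow> com"
  assumes finX: "finite X" and neX: "X \<noteq> {}"
    and prog: "\<And>c d s. let C = push_round c d (s 0) in
      \<exists>s'. exec (prog c d) s (node_labels (G C) (level_size C) @ [End]) s' \<and> s' 0 = C"
begin

definition entry :: "nat \<Rightarrow> nat \<Rightarrow> com list" where
  "entry c d = [Lab (In c d), prog c d]"

text \<open>The first line of a written run has no predecessor to be compared with, so its store is
  arbitrary. Clearing register \<open>0\<close> installs the code of the empty play.\<close>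

definition start :: "com list" where
  "start = [clear 0]"

definition pcs :: "com list set" where
  "pcs = conts (clear 0) [] \<union> (\<Union>c\<in>X. \<Union>d\<in>X. conts (Lab (In c d) ;; prog c d) [])"

lemma finite_pcs: "finite pcs"
  unfolding pcs_def using finX finite_conts by auto

lemma start_pcs: "start \<in> pcs"
  unfolding pcs_def start_def using conts_start by blast

lemma entry_pcs: "c \<in> X \<Longrightarrow> d \<in> X \<Longrightarrow> entry c d \<in> pcs"
  using next_cont_conts[of "[Lab (In c d) ;; prog c d]" "Lab (In c d) ;; prog c d" "[]" True]
    conts_start[of "Lab (In c d) ;; prog c d" "[]"] unfolding pcs_def entry_def by auto

lemma next_pcs: "K \<in> pcs \<Longrightarrow> K \<noteq> [] \<Longrightarrow> next_cont K z \<in> pcs"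
  unfolding pcs_def using next_cont_conts by blast

text \<open>The empty continuation waits for the next round of the play.\<close>

definition succ_cont :: "com list \<Rightarrow> bool \<Rightarrow> com list \<Rightarrow> bool" where
  "succ_cont K z K' \<longleftrightarrow> (if K = [] then \<exists>c\<in>X. \<exists>d\<in>X. K' = entry c d else K' = next_cont K z)"

definition is_run :: "(nat \<Rightarrow> config) \<Rightarrow> bool" where
  "is_run cf \<longleftrightarrow> fst (cf 0) = start \<and>
    (\<forall>n. succ_cont (fst (cf n)) (snd (cf n) (test_reg (fst (cf n))) = 0) (fst (cf (Suc n))) \<and>
      snd (cf (Suc n)) = (\<lambda>j. upd_reg (fst (cf n)) j (snd (cf n) j)))"

text \<open>Every round program terminates, so the empty continuation recurs forever. Each time one
  round is read, and these rounds form \<open>x\<close>. An \<open>In\<close> label stands directly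
  after such a moment, since round programs emit none.\<close>

lemma label_stream_run:
  assumes "is_run cf"
  shows "\<exists>x\<in>omega_words X. label_stream G x (\<lambda>i. labels (fst (cf i)))"
    and "\<And>n c d. labels (fst (cf n)) = [In c d] \<Longrightarrow> \<exists>m. n = Suc m \<and> fst (cf m) = []"
proof -
  let ?lab = "\<lambda>n m. concat (map (\<lambda>i. labels (fst (cf i))) [n..<m])"
  have run: "cf (Suc n) = step (cf n)" if "fst (cf n) \<noteq> []" for n
    using assms that unfolding is_run_def succ_cont_def step_def by (metis prod.collapse)
  have wait: "\<exists>c\<in>X. \<exists>d\<in>X. cf (Suc n) = (entry c d, snd (cf n))" if "fst (cf n) = []" for n
  proof -
    have "succ_cont [] (snd (cf n) (test_reg []) = 0) (fst (cf (Suc n)))" "snd (cf (Suc n)) = (\<lambda>j. upd_reg [] j (snd (cf n) j))"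
      using assms that unfolding is_run_def by metis+
    then show ?thesis unfolding succ_cont_def by (auto simp: prod_eq_iff)
  qed
  have ex: "\<exists>c\<in>X. \<exists>d\<in>X. \<exists>m>n. fst (cf m) = [] \<and> snd (cf m) 0 = push_round c d (snd (cf n) 0) \<and>
      ?lab n m = In c d # node_labels (G (push_round c d (snd (cf n) 0))) (level_size (push_round c d (snd (cf n) 0))) @ [End]"
    if n: "fst (cf n) = []" for n
  proof -
    obtain c d where cd: "c \<in> X" "d \<in> X" "cf (Suc n) = (entry c d, snd (cf n))" using wait[OF n] by blast
    define C where "C = push_round c d (snd (cf n) 0)"
    obtain s' where s': "exec (prog c d) (snd (cf n)) (node_labels (G C) (level_size C) @ [End]) s'" "s' 0 = C"
      using prog[of c d "snd (cf n)"] unfolding C_def Let_def by blast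
    have "mpath (entry c d, snd (cf n)) ([In c d] @ node_labels (G C) (level_size C) @ [End]) ([], s')"
      unfolding entry_def by (rule mpath_trans[OF exec_mpath exec_mpath]) (auto intro: exec.Lab s'(1))
    from mpath_run[of cf, OF run this cd(3)] obtain m where
      m: "m \<ge> Suc n" "cf m = ([], s')" "?lab (Suc n) m = In c d # node_labels (G C) (level_size C) @ [End]" by auto
    have "[n..<m] = n # [Suc n..<m]" using m(1) by (simp add: upt_conv_Cons)
    then have "?lab n m = In c d # node_labels (G C) (level_size C) @ [End]" using m(3) n by simp
    then show ?thesis using cd m s'(2) unfolding C_def by (intro bexI[of _ c] bexI[of _ d] exI[of _ m]) auto
  qed
  obtain a0 where a0: "fst (cf a0) = []" "snd (cf a0) 0 = 0" "?lab 0 a0 = []"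
  proof -
    have "cf 0 = (start, snd (cf 0))" using assms unfolding is_run_def by (metis prod.collapse)
    moreover have "mpath (start, snd (cf 0)) [] ([], (snd (cf 0))(0 := 0))"
      unfolding start_def by (rule exec_mpath[OF exec_clear])
    ultimately obtain m where "cf m = ([], (snd (cf 0))(0 := 0))" "?lab 0 m = []" using mpath_run[of cf "(start, snd (cf 0))" "[]" "([], (snd (cf 0))(0 := 0))" 0, OF run] by metis
    then show thesis using that[of m] by (simp only: fst_conv snd_conv fun_upd_same)
  qed
  define reads where "reads c d n m \<longleftrightarrow> c \<in> X \<and> d \<in> X \<and> m > n \<and> fst (cf m) = [] \<and>
      snd (cf m) 0 = push_round c d (snd (cf n) 0) \<and>
      ?lab n m = In c d # node_labels (G (push_round c d (snd (cf n) 0)))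
        (level_size (push_round c d (snd (cf n) 0))) @ [End]" for c d n m
  have "\<exists>c d m. reads c d n m" if "fst (cf n) = []" for n
    using ex[OF that] unfolding reads_def by blast
  then obtain fc fd nx where "\<And>n. fst (cf n) = [] \<Longrightarrow> reads (fc n) (fd n) n (nx n)" by metis
  then have nx: "\<And>n. fst (cf n) = [] \<Longrightarrow> fc n \<in> X \<and> fd n \<in> X \<and> nx n > n \<and> fst (cf (nx n)) = [] \<and>
      snd (cf (nx n)) 0 = push_round (fc n) (fd n) (snd (cf n) 0) \<and>
      ?lab n (nx n) = In (fc n) (fd n) # node_labels (G (push_round (fc n) (fd n) (snd (cf n) 0)))
        (level_size (push_round (fc n) (fd n) (snd (cf n) 0))) @ [End]"
    unfolding reads_def by blast
  \<comment> \<open>\<open>a k\<close> is the moment of waiting for round \<open>k\<close>; the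
    letters chosen there make up \<open>x\<close>.\<close>
  define a where "a k = (nx ^^ k) a0" for k
  define x where "x i = (if even i then fc (a (i div 2)) else fd (a (i div 2)))" for i
  have a: "fst (cf (a k)) = []" for k by (induction k) (auto simp: a_def a0 nx)
  have x: "x (2 * k) = fc (a k)" "x (Suc (2 * k)) = fd (a k)" for k by (auto simp: x_def)
  have code: "snd (cf (a k)) 0 = rounds_code x k" for k
  proof (induction k)
    case 0
    then show ?case by (simp add: a_def a0 rounds_code_def)
  next
    case (Suc k)
    have "a (Suc k) = nx (a k)" by (simp add: a_def)
    then have "snd (cf (a (Suc k))) 0 = push_round (x (2 * k)) (x (Suc (2 * k))) (rounds_code x k)"
      using nx[OF a, of k] Suc x by simp
    then show ?case by (simp only: push_round_rounds_code)
  qed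
  have lab: "?lab 0 (a k) = blocks G x k" for k
  proof (induction k)
    case 0
    then show ?case by (simp add: a_def a0)
  next
    case (Suc k)
    have ak: "a (Suc k) = nx (a k)" by (simp add: a_def)
    have "push_round (fc (a k)) (fd (a k)) (snd (cf (a k)) 0) = rounds_code x (Suc k)"
      using push_round_rounds_code[of x k] x code by simp
    then have "?lab (a k) (nx (a k)) = block G x k"
      using nx[OF a, of k] x by (simp add: block_def level_size_rounds_code)
    moreover have "[0..<nx (a k)] = [0..<a k] @ [a k..<nx (a k)]"
      using nx[OF a, of k] upt_add_eq_append[of 0 "a k" "nx (a k) - a k"] by simp
    ultimately show ?case using Suc by (simp add: ak blocks_Suc)
  qed
  have "x i \<in> X" for i using nx[OF a] by (simp add: x_def)
  then have "x \<in> omega_words X" by (auto simp: omega_words_def)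
  then show "\<exists>x\<in>omega_words X. label_stream G x (\<lambda>i. labels (fst (cf i)))" unfolding label_stream_def
    by (intro bexI[of _ x] conjI allI exI) (rule length_labels lab | assumption)+
  fix n c d assume In: "labels (fst (cf n)) = [In c d]"
  have mono: "strict_mono a" using nx[OF a] by (simp add: strict_mono_Suc_iff a_def)
  have no_In: "In c d \<notin> set (node_labels g N @ [End])" for g N by (auto simp: node_labels_def)
  show "\<exists>m. n = Suc m \<and> fst (cf m) = []"
  proof (cases "n < a0")
    case True
    then show ?thesis using a0(3) In by auto
  next
    case False
    \<comment> \<open>The interval \<open>a k \<le> n < a (Suc k)\<close> contains one
      \<open>In\<close> label, at its second position.\<close>
    define k where "k = (LEAST k. n < a (Suc k))"
    have "n < a (Suc n)" using strict_mono_imp_increasing[OF mono, of "Suc n"] by simp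
    then have k: "n < a (Suc k)" unfolding k_def by (rule LeastI)
    have ak: "a k \<le> n"
    proof (cases k)
      case 0
      then show ?thesis using False by (simp add: a_def)
    next
      case (Suc k')
      then show ?thesis using not_less_Least[of k' "\<lambda>k. n < a (Suc k)"] unfolding k_def[symmetric] by simp
    qed
    have aS: "a (Suc k) = nx (a k)" by (simp add: a_def)
    obtain c' d' where w: "cf (Suc (a k)) = (entry c' d', snd (cf (a k)))" using wait[OF a] by blast
    have "n \<noteq> a k" using In a[of k] by auto
    moreover have "\<not> Suc (a k) < n"
    proof
      assume n: "Suc (a k) < n"
      then have "[a k..<a (Suc k)] = a k # Suc (a k) # [Suc (Suc (a k))..<a (Suc k)]" using k by (simp add: upt_conv_Cons)
      then have "?lab (a k) (a (Suc k)) = In c' d' # ?lab (Suc (Suc (a k))) (a (Suc k))"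
        using a[of k] w by (simp add: entry_def)
      then obtain g N where "?lab (Suc (Suc (a k))) (a (Suc k)) = node_labels g N @ [End]"
        using nx[OF a, of k] unfolding aS by (metis list.inject)
      moreover have "In c d \<in> set (?lab (Suc (Suc (a k))) (a (Suc k)))" using n k In
        by (auto intro!: bexI[of _ n])
      ultimately show False using no_In by metis
    qed
    ultimately have "n = Suc (a k)" using ak by simp
    then show ?thesis using a by blast
  qed
qed

end

section \<open>Places of labels in the stream and the number of nodes before them\<close>

lemma append_Cons_eq_append:
  assumes "us @ l # vs = as @ bs"
  shows "(\<exists>vs'. as = us @ l # vs') \<or> (\<exists>us'. us = as @ us' \<and> bs = us' @ l # vs)"
  using assms by (fastforce simp: append_eq_append_conv2 Cons_eq_append_conv)

lemma node_labels_split: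
  "node_labels g n = us @ l # vs \<Longrightarrow>
    \<exists>k<n. \<exists>r. us = node_labels g k @ replicate r Mark \<and> (l = Mark \<and> r < g k \<or> l = Node \<and> r = g k)"
proof (induction n arbitrary: vs)
  case 0
  then show ?case by (simp add: node_labels_def)
next
  case (Suc n)
  from append_Cons_eq_append[OF Suc.prems[unfolded node_labels_Suc, symmetric]]
  show ?case
  proof (elim disjE exE conjE)
    fix vs' assume "node_labels g n = us @ l # vs'"
    then show ?case using Suc.IH less_SucI by blast
  next
    fix us' assume us': "us = node_labels g n @ us'" "replicate (g n) Mark @ [Node] = us' @ l # vs"
    from append_Cons_eq_append[OF us'(2)[symmetric]]
    have "\<exists>r. us' = replicate r Mark \<and> (l = Mark \<and> r < g n \<or> l = Node \<and> r = g n)"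
    proof (elim disjE exE conjE)
      fix vs' assume *: "replicate (g n) Mark = us' @ l # vs'"
      have "us' = replicate (length us') Mark \<and> l = Mark"
      proof -
        have "\<forall>a\<in>set (us' @ l # vs'). a = Mark" unfolding *[symmetric] by simp
        then show ?thesis by (auto intro: replicate_eqI)
      qed
      moreover have "length us' < g n" using arg_cong[OF *, of length] by simp
      ultimately show ?thesis by blast
    next
      fix us'' assume "us' = replicate (g n) Mark @ us''" "[Node] = us'' @ l # vs"
      then show ?thesis by (auto simp: Cons_eq_append_conv)
    qed
    then show ?case using us'(1) by blast
  qed
qed

lemma block_split:
  assumes "block G x m = us @ l # vs"
  defines "g \<equiv> G (rounds_code x (Suc m))"
  shows "(us = [] \<and> l = In (x (2 * m)) (x (2 * m + 1))) \<or>
    (\<exists>us'. us = In (x (2 * m)) (x (2 * m + 1)) # us' \<and>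
      ((l = End \<and> us' = node_labels g (2 ^ m)) \<or>
       (\<exists>k<2 ^ m. \<exists>r. us' = node_labels g k @ replicate r Mark \<and> (l = Mark \<and> r < g k \<or> l = Node \<and> r = g k))))"
proof (cases us)
  case Nil
  then show ?thesis using assms by (simp add: block_def)
next
  case (Cons a us')
  then have a: "a = In (x (2 * m)) (x (2 * m + 1))" "us' @ l # vs = node_labels g (2 ^ m) @ [End]"
    using assms by (auto simp: block_def)
  from append_Cons_eq_append[OF a(2)] show ?thesis
  proof (elim disjE exE conjE)
    fix vs' assume "node_labels g (2 ^ m) = us' @ l # vs'"
    then show ?thesis using node_labels_split[of g "2 ^ m" us' l vs'] Cons a(1) by auto
  next
    fix us'' assume "us' = node_labels g (2 ^ m) @ us''" "[End] = us'' @ l # vs"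
    then show ?thesis using Cons a(1) by (auto simp: Cons_eq_append_conv)
  qed
qed

lemma blocks_split:
  "blocks G x n = us @ l # vs \<Longrightarrow> \<exists>m us' vs'. us = blocks G x m @ us' \<and> block G x m = us' @ l # vs'"
proof (induction n arbitrary: vs)
  case (Suc n)
  from append_Cons_eq_append[OF Suc.prems[unfolded blocks_Suc, symmetric]] Suc.IH show ?case by blast
qed simp

lemma count_node_labels [simp]:
  "count_list (node_labels g n) Node = n" "count_list (node_labels g n) End = 0"
  by (induction n) (auto simp: node_labels_Suc count_list_0_iff node_labels_def)

fun is_In :: "label \<Rightarrow> bool" where
  "is_In (In c d) = True"
| "is_In _ = False"

lemma filter_In_node_labels [simp]: "filter is_In (node_labels g n) = []"
  by (auto simp: node_labels_def filter_empty_conv)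

lemma count_list_replicate_Mark [simp]:
  "count_list (replicate r Mark) Node = 0" "count_list (replicate r Mark) End = 0"
  by (auto simp: count_list_0_iff)

lemma filter_In_replicate [simp]: "filter is_In (replicate r Mark) = []"
  by (auto simp: filter_empty_conv)

text \<open>The levels before level \<open>n\<close> contain
  \<open>1 + 2 + ... + 2 ^ (n - 1) = 2 ^ n - 1\<close> nodes, and each round contributes one
  \<open>End\<close> and one \<open>In\<close>.\<close>

lemma count_blocks [simp]:
  "Suc (count_list (blocks G x n) Node) = 2 ^ n" "count_list (blocks G x n) End = n"
  "length (filter is_In (blocks G x n)) = n"
proof -
  have "Suc (count_list (blocks G x n) Node) = 2 ^ n \<and> count_list (blocks G x n) End = n \<and> length (filter is_In (blocks G x n)) = n"
    by (induction n) (auto simp: blocks_Suc block_def)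
  then show "Suc (count_list (blocks G x n) Node) = 2 ^ n" "count_list (blocks G x n) End = n"
    "length (filter is_In (blocks G x n)) = n" by auto
qed

locale stream =
  fixes G :: "nat \<Rightarrow> nat \<Rightarrow> nat" and x :: "nat \<Rightarrow> nat" and lab :: "nat \<Rightarrow> label list"
  assumes stream: "label_stream G x lab"
begin

definition labs :: "nat \<Rightarrow> label list" where
  "labs i = concat (map lab [0..<i])"

text \<open>The number of nodes before position \<open>i\<close> is shifted by one, so that level \<open>n\<close> is numbered from \<open>2 ^ n\<close>.\<close>

definition nodes :: "nat \<Rightarrow> nat" where "nodes i = Suc (count_list (labs i) Node)"
definition ends :: "nat \<Rightarrow> nat" where "ends i = count_list (labs i) End"
definition ins :: "nat \<Rightarrow> nat" where "ins i = length (filter is_In (labs i))"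

lemma labs_0 [simp]: "labs 0 = []" and labs_Suc: "labs (Suc i) = labs i @ lab i"
  by (simp_all add: labs_def)

lemma length_lab: "length (lab i) \<le> 1"
  using stream by (simp add: label_stream_def)

lemma labs_mono: "i \<le> j \<Longrightarrow> \<exists>vs. labs j = labs i @ vs"
  by (induction rule: dec_induct) (auto simp: labs_Suc)

lemma labs_prefix: "\<exists>n vs. blocks G x n = labs i @ vs"
proof -
  have len: "n \<le> length (blocks G x n)" for n by (induction n) (auto simp: blocks_Suc block_def)
  obtain j where j: "labs j = blocks G x (Suc (length (labs i)))"
    using stream unfolding label_stream_def labs_def by blast
  have "i \<le> j"
  proof (rule ccontr)
    assume "\<not> i \<le> j"
    then obtain vs where "labs i = labs j @ vs" using labs_mono[of j i] by auto
    then show False using len[of "Suc (length (labs i))"] j by (metis le_trans length_append le_add1 not_less_eq_eq)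
  qed
  then show ?thesis using labs_mono j by metis
qed

lemma occurrence:
  assumes "lab i = [l]"
  obtains m us vs where "labs i = blocks G x m @ us" "block G x m = us @ l # vs"
proof -
  obtain n vs where "blocks G x n = labs (Suc i) @ vs" using labs_prefix by blast
  then have "blocks G x n = labs i @ l # vs" using assms by (simp add: labs_Suc)
  then show thesis using blocks_split that by blast
qed

text \<open>Each position adds at most one label, so the length of \<open>labs\<close> takes every
  intermediate value and any split of the blocks occurs at a position.\<close>

lemma position:
  assumes "blocks G x n = us @ l # vs"
  obtains i where "labs i = us" "lab i = [l]"
proof -
  obtain j where j: "labs j = us @ l # vs" using stream assms unfolding label_stream_def labs_def by metis
  define k where "k = (LEAST k. length us < length (labs k))"
  have k: "length us < length (labs k)" unfolding k_def by (rule LeastI[of _ j]) (simp add: j)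
  then obtain i where i: "k = Suc i" by (cases k) auto
  have "length (labs i) \<le> length us" using not_less_Least[of i "\<lambda>k. length us < length (labs k)"] i unfolding k_def by simp
  then have len: "length (labs i) = length us" "length (lab i) = 1" using k length_lab[of i] unfolding i labs_Suc by auto
  have "k \<le> j" unfolding k_def by (rule Least_le) (simp add: j)
  then obtain vs' where "labs j = labs i @ lab i @ vs'" using labs_mono[of k j] i labs_Suc by auto
  then have "labs i = us" "lab i @ vs' = l # vs" using j len(1) by (metis append_eq_append_conv)+
  then show thesis using that len(2) by (cases "lab i") auto
qed

lemma nodes_0 [simp]: "nodes 0 = 1" and ends_0 [simp]: "ends 0 = 0"
  by (simp_all add: nodes_def ends_def)

lemma nodes_Suc: "nodes (Suc i) = nodes i + (if lab i = [Node] then 1 else 0)"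
  and ends_Suc: "ends (Suc i) = ends i + (if lab i = [End] then 1 else 0)"
  using length_lab[of i] by (cases "lab i"; auto simp: nodes_def ends_def labs_Suc)+

lemma nodes_mono: "i \<le> j \<Longrightarrow> nodes i \<le> nodes j"
  by (rule lift_Suc_mono_le[of nodes]) (auto simp: nodes_Suc)

lemma ends_mono: "i \<le> j \<Longrightarrow> ends i \<le> ends j"
  by (rule lift_Suc_mono_le[of ends]) (auto simp: ends_Suc)

text \<open>Level \<open>n\<close> carries the numbers from \<open>2 ^ n\<close> to
  \<open>2 ^ Suc n - 1\<close>, as in a binary heap; at its end all of them have been
  passed.\<close>

lemma End_nodes: "lab i = [End] \<Longrightarrow> nodes i = 2 ^ Suc (ends i)"
proof (elim occurrence)
  fix m us vs assume "labs i = blocks G x m @ us" "block G x m = us @ End # vs"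
  then show ?thesis using block_split[of G x m us End vs] count_blocks(1)[of G x m] by (auto simp: nodes_def ends_def simp del: count_blocks(1))
qed

lemma Mark_nodes:
  "lab i = [Mark] \<Longrightarrow> 2 ^ ends i \<le> nodes i \<and> nodes i < 2 ^ Suc (ends i) \<and>
    G (rounds_code x (Suc (ends i))) (nodes i - 2 ^ ends i) \<noteq> 0"
proof (elim occurrence)
  fix m us vs assume "labs i = blocks G x m @ us" "block G x m = us @ Mark # vs"
  moreover have "Suc (count_list (blocks G x m) Node + k) - 2 ^ m = k" for k
    using count_blocks(1)[of G x m] by linarith
  ultimately show ?thesis using block_split[of G x m us Mark vs] count_blocks(1)[of G x m]
    by (auto simp: nodes_def ends_def simp del: count_blocks(1))
qed

lemma In_letters: "lab i = [In c d] \<Longrightarrow> c = x (2 * ins i) \<and> d = x (2 * ins i + 1)"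
proof (elim occurrence)
  fix m us vs assume "labs i = blocks G x m @ us" "block G x m = us @ In c d # vs"
  then show ?thesis using block_split[of G x m us "In c d" vs] by (auto simp: ins_def)
qed

lemma ex_End: "\<exists>i. lab i = [End] \<and> ends i = n \<and> nodes i = 2 ^ Suc n"
proof -
  have "blocks G x (Suc n) = (blocks G x n @ In (x (2 * n)) (x (2 * n + 1)) #
    node_labels (G (rounds_code x (Suc n))) (2 ^ n)) @ End # []" by (simp add: blocks_Suc block_def)
  then obtain i where i: "labs i = blocks G x n @ In (x (2 * n)) (x (2 * n + 1)) #
    node_labels (G (rounds_code x (Suc n))) (2 ^ n)" "lab i = [End]" by (rule position)
  then show ?thesis using count_blocks(1)[of G x n]
    by (intro exI[of _ i]) (auto simp: nodes_def ends_def simp del: count_blocks(1))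
qed

lemma ex_In: "\<exists>i c d. lab i = [In c d] \<and> ins i = n"
proof -
  obtain vs where "blocks G x (Suc n) = blocks G x n @ In (x (2 * n)) (x (2 * n + 1)) # vs"
    by (simp add: blocks_Suc block_def)
  then obtain i where i: "labs i = blocks G x n" "lab i = [In (x (2 * n)) (x (2 * n + 1))]" by (rule position)
  then have "ins i = n" by (simp add: ins_def)
  then show ?thesis using i(2) by blast
qed

lemma node_labels_prefix: "k < n \<Longrightarrow> \<exists>vs. node_labels g n = node_labels g k @ replicate (g k) Mark @ Node # vs"
  by (induction n) (auto simp: node_labels_Suc less_Suc_eq)

lemma ex_Node:
  assumes "2 ^ n \<le> m" "m < 2 ^ Suc n"
  shows "\<exists>i. lab i = [Node] \<and> ends i = n \<and> nodes i = m"
proof -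
  define k where "k = m - 2 ^ n"
  have k: "k < 2 ^ n" "m = 2 ^ n + k" using assms by (auto simp: k_def)
  let ?g = "G (rounds_code x (Suc n))"
  obtain vs where "node_labels ?g (2 ^ n) = node_labels ?g k @ replicate (?g k) Mark @ Node # vs"
    using node_labels_prefix[OF k(1)] by blast
  then have "blocks G x (Suc n) = (blocks G x n @ In (x (2 * n)) (x (2 * n + 1)) #
      node_labels ?g k @ replicate (?g k) Mark) @ Node # vs @ [End]" by (simp add: blocks_Suc block_def)
  then obtain i where "labs i = blocks G x n @ In (x (2 * n)) (x (2 * n + 1)) #
      node_labels ?g k @ replicate (?g k) Mark" "lab i = [Node]" by (rule position)
  then show ?thesis using count_blocks(1)[of G x n] k
    by (intro exI[of _ i]) (auto simp: nodes_def ends_def simp del: count_blocks(1))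
qed

lemma ex_Mark:
  assumes "k < 2 ^ n" "G (rounds_code x (Suc n)) k \<noteq> 0"
  shows "\<exists>i. lab i = [Mark] \<and> ends i = n \<and> nodes i = 2 ^ n + k"
proof -
  let ?g = "G (rounds_code x (Suc n))"
  obtain vs where "node_labels ?g (2 ^ n) = node_labels ?g k @ replicate (?g k) Mark @ Node # vs"
    using node_labels_prefix[OF assms(1)] by blast
  then obtain vs' where "node_labels ?g (2 ^ n) = node_labels ?g k @ Mark # vs'"
    using assms(2) by (cases "?g k") auto
  then have "blocks G x (Suc n) = (blocks G x n @ In (x (2 * n)) (x (2 * n + 1)) #
      node_labels ?g k) @ Mark # vs' @ [End]" by (simp add: blocks_Suc block_def)
  then obtain i where "labs i = blocks G x n @ In (x (2 * n)) (x (2 * n + 1)) #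
      node_labels ?g k" "lab i = [Mark]" by (rule position)
  then show ?thesis using count_blocks(1)[of G x n]
    by (intro exI[of _ i]) (auto simp: nodes_def ends_def simp del: count_blocks(1))
qed

end

section \<open>Lines of a written run\<close>

text \<open>
  A configuration \<open>(K, s)\<close> is written as \<open>Pc K\<close> followed by letters among which \<open>Tick j\<close> occurs
  \<open>s j\<close> times, in any order.
\<close>

datatype letter = Pc "com list" | Tick nat

fun letter_labels :: "letter \<Rightarrow> label list" where
  "letter_labels (Pc K) = labels K"
| "letter_labels (Tick j) = []"

fun is_Pc :: "letter \<Rightarrow> bool" where
  "is_Pc (Pc K) = True"
| "is_Pc (Tick j) = False"

definition next_pc :: "(nat \<Rightarrow> letter) \<Rightarrow> nat \<Rightarrow> nat" where
  "next_pc e i = (LEAST k. i \<le> k \<and> is_Pc (e k))"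

text \<open>Counted from \<open>i\<close> to the end of the line: the value falls as a head reads,
  and so it can enter invariants about heads in the middle of a line.\<close>

definition ticks :: "(nat \<Rightarrow> letter) \<Rightarrow> nat \<Rightarrow> nat \<Rightarrow> nat" where
  "ticks e j i = card {m. i \<le> m \<and> m < next_pc e i \<and> e m = Tick j}"

lemma next_pc_Pc: "e i = Pc K \<Longrightarrow> next_pc e i = i"
  unfolding next_pc_def by (rule Least_equality) auto

lemma ticks_Pc: "e i = Pc K \<Longrightarrow> ticks e j i = 0"
  by (simp add: ticks_def next_pc_Pc)

lemma next_pc:
  assumes "\<exists>\<^sub>\<infinity>i. is_Pc (e i)"
  shows "i \<le> next_pc e i" "is_Pc (e (next_pc e i))" "i \<le> k \<Longrightarrow> k < next_pc e i \<Longrightarrow> \<not> is_Pc (e k)"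
proof -
  obtain m where "i \<le> m" "is_Pc (e m)" using assms unfolding INFM_nat_le by blast
  then have "i \<le> next_pc e i \<and> is_Pc (e (next_pc e i))" unfolding next_pc_def by (intro LeastI) auto
  then show "i \<le> next_pc e i" "is_Pc (e (next_pc e i))" by auto
  show "i \<le> k \<Longrightarrow> k < next_pc e i \<Longrightarrow> \<not> is_Pc (e k)" unfolding next_pc_def using not_less_Least by blast
qed

lemma next_pc_Tick: "e i = Tick r \<Longrightarrow> next_pc e i = next_pc e (Suc i)"
proof -
  assume "e i = Tick r"
  then have "(i \<le> k \<and> is_Pc (e k)) = (Suc i \<le> k \<and> is_Pc (e k))" for k by (cases "k = i") auto
  then show ?thesis unfolding next_pc_def by simp
qed

lemma ticks_Tick:
  assumes "\<exists>\<^sub>\<infinity>i. is_Pc (e i)" "e i = Tick r"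
  shows "ticks e j i = ticks e j (Suc i) + (if r = j then 1 else 0)"
proof -
  have n: "next_pc e i = next_pc e (Suc i)" by (rule next_pc_Tick) (rule assms)
  have le: "Suc i \<le> next_pc e (Suc i)" using next_pc(1)[OF assms(1)] .
  have "{m. i \<le> m \<and> m < next_pc e i \<and> e m = Tick j} =
    {m. Suc i \<le> m \<and> m < next_pc e (Suc i) \<and> e m = Tick j} \<union> (if r = j then {i} else {})"
  proof (rule set_eqI)
    fix m show "m \<in> {m. i \<le> m \<and> m < next_pc e i \<and> e m = Tick j} \<longleftrightarrow>
      m \<in> {m. Suc i \<le> m \<and> m < next_pc e (Suc i) \<and> e m = Tick j} \<union> (if r = j then {i} else {})"
      using le assms(2) unfolding n by (cases "m = i") auto
  qed
  then show ?thesis unfolding ticks_def by (auto simp: card_insert_if)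
qed

context machine
begin

text \<open>Each clause has the form that its failure can be guessed and verified by two heads,
  comparing one register of two consecutive lines at a time.\<close>

definition well_formed :: "(nat \<Rightarrow> letter) \<Rightarrow> bool" where
  "well_formed e \<longleftrightarrow> e 0 = Pc start \<and> (\<exists>\<^sub>\<infinity>i. is_Pc (e i)) \<and>
    (\<forall>i K. e i = Pc K \<longrightarrow>
      (\<exists>K'. e (next_pc e (Suc i)) = Pc K' \<and> succ_cont K (ticks e (test_reg K) (Suc i) = 0) K') \<and>
      (\<forall>j. ticks e j (Suc (next_pc e (Suc i))) = upd_reg K j (ticks e j (Suc i))))"

text \<open>A round is read at the position where Player 1 has just written its first letter; the
  second letter \<open>d\<close> is the free choice of Player 2.\<close>

definition correct :: "(nat \<Rightarrow> nat) \<Rightarrow> (nat \<Rightarrow> letter) \<Rightarrow> bool" where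
  "correct p e \<longleftrightarrow> well_formed e \<and> (\<forall>i c d. letter_labels (e i) = [In c d] \<longrightarrow> p i = c)"

text \<open>The lines of \<open>e\<close>, with their numbers of ticks as stores, form a run of the
  machine, and the letters between the line starts carry no labels.\<close>

lemma label_stream_well_formed:
  assumes "well_formed e"
  shows "\<exists>x\<in>omega_words X. label_stream G x (\<lambda>i. letter_labels (e i))"
    and "\<And>i c d. letter_labels (e i) = [In c d] \<Longrightarrow> \<exists>k. e k = Pc [] \<and> i = next_pc e (Suc k)"
proof -
  have inf: "\<exists>\<^sub>\<infinity>i. is_Pc (e i)" using assms by (simp add: well_formed_def)
  define l where "l n = ((\<lambda>i. next_pc e (Suc i)) ^^ n) 0" for n
  have l0: "l 0 = 0" and lS: "l (Suc n) = next_pc e (Suc (l n))" for n by (simp_all add: l_def)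
  have "\<exists>K. e (l n) = Pc K" for n
  proof (induction n)
    case 0
    then show ?case using assms by (auto simp: l0 well_formed_def)
  next
    case (Suc n)
    then show ?case using assms unfolding lS well_formed_def by blast
  qed
  then obtain K where K: "\<And>n. e (l n) = Pc (K n)" by metis
  define cf where "cf n = (K n, \<lambda>j. ticks e j (Suc (l n)))" for n
  have "is_run cf" unfolding is_run_def
  proof (intro conjI allI)
    have "Pc (K 0) = Pc start" using K[of 0] assms by (simp add: l0 well_formed_def)
    then show "fst (cf 0) = start" by (simp add: cf_def)
    fix n
    have *: "\<exists>K'. e (l (Suc n)) = Pc K' \<and> succ_cont (K n) (ticks e (test_reg (K n)) (Suc (l n)) = 0) K'"
      "\<And>j. ticks e j (Suc (l (Suc n))) = upd_reg (K n) j (ticks e j (Suc (l n)))"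
      using assms K[of n] unfolding lS well_formed_def by blast+
    show "succ_cont (fst (cf n)) (snd (cf n) (test_reg (fst (cf n))) = 0) (fst (cf (Suc n)))"
      using *(1) K[of "Suc n"] by (simp add: cf_def)
    show "snd (cf (Suc n)) = (\<lambda>j. upd_reg (fst (cf n)) j (snd (cf n) j))"
      using *(2) by (auto simp: cf_def)
  qed
  note run = label_stream_run[OF this]
  obtain x where x: "x \<in> omega_words X" "label_stream G x (\<lambda>i. labels (fst (cf i)))"
    using run(1) by blast
  have "concat (map (\<lambda>i. letter_labels (e i)) [0..<l n]) = concat (map (\<lambda>i. labels (fst (cf i))) [0..<n])" for n
  proof (induction n)
    case 0
    then show ?case by (simp add: l0)
  next
    case (Suc n)
    have le: "Suc (l n) \<le> l (Suc n)" unfolding lS using next_pc(1)[OF inf] .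
    have "[0..<l (Suc n)] = [0..<l n] @ l n # [Suc (l n)..<l (Suc n)]"
      using le upt_add_eq_append[of 0 "l n" "l (Suc n) - l n"] by (simp add: upt_conv_Cons)
    moreover have "letter_labels (e i) = []" if "i \<in> set [Suc (l n)..<l (Suc n)]" for i
      using next_pc(3)[OF inf, of "Suc (l n)" i] that unfolding lS by (cases "e i") auto
    then have "concat (map (\<lambda>i. letter_labels (e i)) [Suc (l n)..<l (Suc n)]) = []" by simp
    ultimately show ?case using Suc K[of n] by (simp add: cf_def)
  qed
  moreover have "length (letter_labels a) \<le> 1" for a
    using length_labels by (cases a) auto
  ultimately have "label_stream G x (\<lambda>i. letter_labels (e i))"
    using x(2) unfolding label_stream_def by metis
  then show "\<exists>x\<in>omega_words X. label_stream G x (\<lambda>i. letter_labels (e i))" using x(1) by blast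
  fix i c d assume In: "letter_labels (e i) = [In c d]"
  have mono: "strict_mono l" unfolding strict_mono_Suc_iff lS using next_pc(1)[OF inf] Suc_le_lessD by blast
  define n where "n = (LEAST n. i < l (Suc n))"
  have "i < l (Suc i)" using strict_mono_imp_increasing[OF mono, of "Suc i"] by simp
  then have n: "i < l (Suc n)" unfolding n_def by (rule LeastI)
  have ln: "l n \<le> i"
  proof (cases n)
    case 0
    then show ?thesis by (simp add: l0)
  next
    case (Suc n')
    then show ?thesis using not_less_Least[of n' "\<lambda>n. i < l (Suc n)"] unfolding n_def[symmetric] by simp
  qed
  have "is_Pc (e i)" using In by (cases "e i") auto
  then have "i = l n" using next_pc(3)[OF inf, of "Suc (l n)" i] n ln unfolding lS by (cases "i = l n") auto
  then obtain m where m: "n = Suc m" "fst (cf m) = []" using run(2)[of n c d] In K[of n] by (auto simp: cf_def)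
  then have "e (l m) = Pc []" using K[of m] by (simp add: cf_def)
  then show "\<exists>k. e k = Pc [] \<and> i = next_pc e (Suc k)" using \<open>i = l n\<close> m(1) lS by blast
qed

end

section \<open>Two-head acceptors\<close>


definition head_step :: "('q \<Rightarrow> 'a option \<Rightarrow> 'b option \<Rightarrow> 'q \<Rightarrow> bool) \<Rightarrow> (nat \<Rightarrow> 'a) \<Rightarrow> (nat \<Rightarrow> 'b) \<Rightarrow>
    'q \<times> nat \<times> nat \<Rightarrow> 'q \<times> nat \<times> nat \<Rightarrow> bool" where
  "head_step \<delta> U V c c' \<longleftrightarrow> (\<exists>a b. \<delta> (fst c) a b (fst c') \<and>
    (a = None \<and> fst (snd c') = fst (snd c) \<or> a = Some (U (fst (snd c))) \<and> fst (snd c') = Suc (fst (snd c))) \<and>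
    (b = None \<and> snd (snd c') = snd (snd c) \<or> b = Some (V (snd (snd c))) \<and> snd (snd c') = Suc (snd (snd c))))"

definition heads_accept :: "('q \<Rightarrow> 'a option \<Rightarrow> 'b option \<Rightarrow> 'q \<Rightarrow> bool) \<Rightarrow> 'q \<Rightarrow> 'q set \<Rightarrow> (nat \<Rightarrow> 'a) \<Rightarrow> (nat \<Rightarrow> 'b) \<Rightarrow> bool" where
  "heads_accept \<delta> q0 F U V \<longleftrightarrow> (\<exists>r. r 0 = (q0, 0, 0) \<and> (\<forall>n. head_step \<delta> U V (r n) (r (Suc n))) \<and>
    (\<exists>\<^sub>\<infinity>n. fst (r n) \<in> F) \<and> (\<forall>m. \<exists>n. m \<le> fst (snd (r n))) \<and> (\<forall>m. \<exists>n. m \<le> snd (snd (r n))))"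

lemma head_step_map:
  "head_step (\<lambda>q a b q'. \<delta> q (map_option f a) (map_option g b) q') U V c c' \<longleftrightarrow>
    head_step \<delta> (\<lambda>i. f (U i)) (\<lambda>i. g (V i)) c c'"
proof
  assume "head_step (\<lambda>q a b q'. \<delta> q (map_option f a) (map_option g b) q') U V c c'"
  then show "head_step \<delta> (\<lambda>i. f (U i)) (\<lambda>i. g (V i)) c c'"
    unfolding head_step_def by (elim exE conjE disjE) auto
next
  assume "head_step \<delta> (\<lambda>i. f (U i)) (\<lambda>i. g (V i)) c c'"
  then obtain a b where ab: "\<delta> (fst c) a b (fst c')"
    "a = None \<and> fst (snd c') = fst (snd c) \<or> a = Some (f (U (fst (snd c)))) \<and> fst (snd c') = Suc (fst (snd c))"
    "b = None \<and> snd (snd c') = snd (snd c) \<or> b = Some (g (V (snd (snd c)))) \<and> snd (snd c') = Suc (snd (snd c))"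
    unfolding head_step_def by blast
  then show "head_step (\<lambda>q a b q'. \<delta> q (map_option f a) (map_option g b) q') U V c c'"
    unfolding head_step_def
    by (intro exI[of _ "if a = None then None else Some (U (fst (snd c)))"]
        exI[of _ "if b = None then None else Some (V (snd (snd c)))"]) auto
qed

text \<open>The heads advance by whole rounds of the game, so one move consumes two letters of a
  tape or none.\<close>

fun round_word :: "('a \<times> 'a) option \<Rightarrow> 'a list" where
  "round_word None = []"
| "round_word (Some (a, b)) = [a, b]"

lemma round_word_concat:
  assumes "is_omega_concat u (\<lambda>n. round_word (a n))"
  shows "\<exists>i. i 0 = 0 \<and> (\<forall>n. a n = None \<and> i (Suc n) = i n \<or>
      a n = Some (u (2 * i n), u (2 * i n + 1)) \<and> i (Suc n) = Suc (i n)) \<and> (\<forall>m. \<exists>n. m \<le> i n)"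
proof -
  define pos where "pos n = length (concat (prefix n (\<lambda>n. round_word (a n))))" for n
  note P = is_omega_concatD[OF assms, folded pos_def]
  have len: "length (round_word b) = (if b = None then 0 else 2)" for b :: "('a \<times> 'a) option"
    by (cases b rule: round_word.cases) auto
  have ev: "pos n = 2 * (pos n div 2)" for n
    by (induction n) (auto simp: P(1,2) len)
  have "a n = None \<and> pos (Suc n) div 2 = pos n div 2 \<or>
    a n = Some (u (2 * (pos n div 2)), u (2 * (pos n div 2) + 1)) \<and> pos (Suc n) div 2 = Suc (pos n div 2)" for n
  proof (cases "a n")
    case None
    then show ?thesis using P(2)[of n] by simp
  next
    case (Some b)
    then have "pos (Suc n) = pos n + 2" using P(2)[of n] by (simp add: len)
    moreover then have "round_word (a n) = [u (pos n), u (Suc (pos n))]"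
      using P(3)[of n] by (simp add: upt_conv_Cons)
    ultimately show ?thesis using Some ev[of n] by (cases b) auto
  qed
  moreover have "\<exists>n. m \<le> pos n div 2" for m using P(4)[of "2 * m"] by (auto simp: Suc_le_eq) (metis div_le_mono nonzero_mult_div_cancel_left zero_neq_numeral)
  ultimately show ?thesis by (intro exI[of _ "\<lambda>n. pos n div 2"]) (simp add: P(1))
qed

text \<open>States are renamed to numbers and moves are restricted to the finite set
  \<open>D\<close>; closure of \<open>Q\<close> keeps every run inside \<open>D\<close>. Unbounded
  head positions correspond to infinite concatenations in \<open>accepts\<close>.\<close>

lemma two_head_rational:
  fixes \<delta> :: "'q \<Rightarrow> (nat \<times> nat) option \<Rightarrow> (nat \<times> nat) option \<Rightarrow> 'q \<Rightarrow> bool"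
  assumes Q: "finite Q" "q0 \<in> Q" "F \<subseteq> Q" and S: "finite \<Sigma>"
    and closed: "\<And>q a b q'. q \<in> Q \<Longrightarrow> \<delta> q a b q' \<Longrightarrow> set_option a \<subseteq> \<Sigma> \<times> \<Sigma> \<Longrightarrow> set_option b \<subseteq> \<Sigma> \<times> \<Sigma> \<Longrightarrow> q' \<in> Q"
  obtains M :: "(nat, nat, nat) buchi2" where "buchi2_automaton \<Sigma> \<Sigma> M"
    "\<And>u v. u \<in> omega_words \<Sigma> \<Longrightarrow> v \<in> omega_words \<Sigma> \<Longrightarrow> accepts M u v \<longleftrightarrow>
      heads_accept \<delta> q0 F (\<lambda>i. (u (2 * i), u (2 * i + 1))) (\<lambda>i. (v (2 * i), v (2 * i + 1)))"
proof -
  obtain enc :: "'q \<Rightarrow> nat" where enc: "inj_on enc Q" using finite_imp_inj_to_nat_seg[OF Q(1)] by blast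
  define OP where "OP = insert None (Some ` (\<Sigma> \<times> \<Sigma>))"
  define D where "D = {(q, a, b, q'). q \<in> Q \<and> a \<in> OP \<and> b \<in> OP \<and> q' \<in> Q \<and> \<delta> q a b q'}"
  define M where "M = \<lparr>states = enc ` Q, trans = (\<lambda>(q, a, b, q'). (enc q, round_word a, round_word b, enc q')) ` D,
    init = enc q0, accepting = enc ` F\<rparr>"
  have Msimps: "init M = enc q0" "accepting M = enc ` F" by (simp_all add: M_def)
  have "D \<subseteq> Q \<times> OP \<times> OP \<times> Q" by (auto simp: D_def)
  then have fD: "finite D" by (rule finite_subset) (use Q(1) S in \<open>auto simp: OP_def\<close>)
  have rw: "round_word a \<in> lists \<Sigma>" if "a \<in> OP" for a using that by (auto simp: OP_def)
  have "buchi2_automaton \<Sigma> \<Sigma> M"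
    unfolding buchi2_automaton_def M_def using fD Q rw by (auto simp: D_def simp del: lists_Int_eq in_listsI)
  moreover have "accepts M u v \<longleftrightarrow>
      heads_accept \<delta> q0 F (\<lambda>i. (u (2 * i), u (2 * i + 1))) (\<lambda>i. (v (2 * i), v (2 * i + 1)))" (is "_ \<longleftrightarrow> heads_accept \<delta> q0 F ?U ?V")
    if u: "u \<in> omega_words \<Sigma>" and v: "v \<in> omega_words \<Sigma>" for u v
  proof
    assume "accepts M u v"
    then obtain q us vs where q0: "q 0 = enc q0" and tr: "\<And>n. (q n, us n, vs n, q (Suc n)) \<in> trans M"
      and lim: "limit q \<inter> enc ` F \<noteq> {}" and us: "is_omega_concat u us" and vs: "is_omega_concat v vs"
      unfolding accepts_def Msimps by blast
    have "\<exists>p a b p'. (p, a, b, p') \<in> D \<and> q n = enc p \<and> us n = round_word a \<and> vs n = round_word b \<and> q (Suc n) = enc p'" for n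
      using tr[of n] by (auto simp: M_def)
    then obtain p a b p' where pq: "\<And>n. (p n, a n, b n, p' n) \<in> D" "\<And>n. q n = enc (p n)" "\<And>n. us n = round_word (a n)"
      "\<And>n. vs n = round_word (b n)" "\<And>n. q (Suc n) = enc (p' n)" by metis
    have pQ: "p n \<in> Q" "p' n \<in> Q" and \<delta>: "\<delta> (p n) (a n) (b n) (p' n)" for n using pq(1)[of n] by (auto simp: D_def)
    have p': "p' n = p (Suc n)" for n using pq(2)[of "Suc n"] pq(5)[of n] enc pQ by (metis inj_onD)
    have p0: "p 0 = q0" using pq(2)[of 0] q0 enc pQ Q(2) by (metis inj_onD)
    have "us = (\<lambda>n. round_word (a n))" "vs = (\<lambda>n. round_word (b n))" using pq by auto
    then obtain i j where i: "i 0 = 0" "\<And>n. a n = None \<and> i (Suc n) = i n \<or>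
        a n = Some (?U (i n)) \<and> i (Suc n) = Suc (i n)" "\<And>m. \<exists>n. m \<le> i n"
      and j: "j 0 = 0" "\<And>n. b n = None \<and> j (Suc n) = j n \<or>
        b n = Some (?V (j n)) \<and> j (Suc n) = Suc (j n)" "\<And>m. \<exists>n. m \<le> j n"
    proof -
      assume *: "us = (\<lambda>n. round_word (a n))" "vs = (\<lambda>n. round_word (b n))"
      show ?thesis
        using round_word_concat[of u a] round_word_concat[of v b] us vs that unfolding * by auto
    qed
    have "head_step \<delta> ?U ?V (p n, i n, j n) (p (Suc n), i (Suc n), j (Suc n))" for n
      unfolding head_step_def using \<delta>[of n] i(2)[of n] j(2)[of n] p'[of n] by (intro exI[of _ "a n"] exI[of _ "b n"]) auto
    moreover have "\<exists>\<^sub>\<infinity>n. p n \<in> F"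
    proof -
      have "\<exists>\<^sub>\<infinity>n. q n \<in> enc ` F" using limit_inter_INF[OF lim] .
      then show ?thesis
      proof (rule INFM_mono)
        fix n assume "q n \<in> enc ` F"
        then obtain f where "f \<in> F" "enc (p n) = enc f" using pq(2) by auto
        then show "p n \<in> F" using enc pQ(1) Q(3) by (metis inj_onD subsetD)
      qed
    qed
    ultimately show "heads_accept \<delta> q0 F ?U ?V"
      unfolding heads_accept_def using i j p0 by (intro exI[of _ "\<lambda>n. (p n, i n, j n)"]) simp
  next
    assume "heads_accept \<delta> q0 F ?U ?V"
    then obtain r where r0: "r 0 = (q0, 0, 0)" and st: "\<And>n. head_step \<delta> ?U ?V (r n) (r (Suc n))"
      and inf: "\<exists>\<^sub>\<infinity>n. fst (r n) \<in> F" and unb: "\<And>m. \<exists>n. m \<le> fst (snd (r n))" "\<And>m. \<exists>n. m \<le> snd (snd (r n))"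
      unfolding heads_accept_def by blast
    define i j where "i n = fst (snd (r n))" and "j n = snd (snd (r n))" for n
    obtain a b where ab: "\<And>n. \<delta> (fst (r n)) (a n) (b n) (fst (r (Suc n)))"
      "\<And>n. a n = None \<and> i (Suc n) = i n \<or> a n = Some (?U (i n)) \<and> i (Suc n) = Suc (i n)"
      "\<And>n. b n = None \<and> j (Suc n) = j n \<or> b n = Some (?V (j n)) \<and> j (Suc n) = Suc (j n)"
    proof -
      define moves where "moves n a b \<longleftrightarrow> \<delta> (fst (r n)) a b (fst (r (Suc n))) \<and>
        (a = None \<and> i (Suc n) = i n \<or> a = Some (?U (i n)) \<and> i (Suc n) = Suc (i n)) \<and>
        (b = None \<and> j (Suc n) = j n \<or> b = Some (?V (j n)) \<and> j (Suc n) = Suc (j n))" for n a b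
      have "\<exists>a b. moves n a b" for n
        using st[of n] unfolding head_step_def i_def j_def moves_def .
      then obtain a b where "\<And>n. moves n (a n) (b n)" by metis
      then show thesis using that[of a b] unfolding moves_def by blast
    qed
    have OP: "a n \<in> OP" "b n \<in> OP" for n
      using ab(2)[of n] ab(3)[of n] omega_wordsD[OF u] omega_wordsD[OF v] by (auto simp: OP_def)
    have OP': "set_option (a n) \<subseteq> \<Sigma> \<times> \<Sigma>" "set_option (b n) \<subseteq> \<Sigma> \<times> \<Sigma>" for n
      using OP[of n] by (cases "a n"; cases "b n"; auto simp: OP_def)+
    have rQ: "fst (r n) \<in> Q" for n
      by (induction n) (use r0 Q(2) closed ab(1) OP' in \<open>auto, metis\<close>)
    have D: "(fst (r n), a n, b n, fst (r (Suc n))) \<in> D" for n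
      using rQ ab(1) OP by (auto simp: D_def)
    have wu: "round_word (a n) = map u [2 * i n..<2 * i (Suc n)]" for n
      using ab(2)[of n] by (auto simp: upt_conv_Cons)
    have wv: "round_word (b n) = map v [2 * j n..<2 * j (Suc n)]" for n
      using ab(3)[of n] by (auto simp: upt_conv_Cons)
    show "accepts M u v" unfolding accepts_def
    proof (intro exI conjI allI)
      show "enc (fst (r 0)) = init M" by (simp add: r0 M_def)
      show "(enc (fst (r n)), round_word (a n), round_word (b n), enc (fst (r (Suc n)))) \<in> trans M" for n
        using D[of n] unfolding M_def by force
      have "\<exists>\<^sub>\<infinity>n. enc (fst (r n)) \<in> enc ` F" using inf by (rule INFM_mono) auto
      moreover have "finite (enc ` F)" using Q finite_subset by auto
      ultimately show "limit (\<lambda>n. enc (fst (r n))) \<inter> accepting M \<noteq> {}"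
        using fin_ex_inf_eq_limit by (fastforce simp: M_def)
      have "i n \<le> i (Suc n)" "j n \<le> j (Suc n)" for n using ab(2)[of n] ab(3)[of n] by auto
      moreover have "\<exists>n. m \<le> 2 * i n" "\<exists>n. m \<le> 2 * j n" for m
      proof -
        obtain n1 n2 where "m \<le> i n1" "m \<le> j n2" using unb[of m] unfolding i_def j_def by blast
        then have "m \<le> 2 * i n1" "m \<le> 2 * j n2" by auto
        then show "\<exists>n. m \<le> 2 * i n" "\<exists>n. m \<le> 2 * j n" by blast+
      qed
      moreover have "i 0 = 0" "j 0 = 0" by (simp_all add: i_def j_def r0)
      ultimately show "is_omega_concat u (\<lambda>n. round_word (a n))" "is_omega_concat v (\<lambda>n. round_word (b n))"
        using wu wv is_omega_concatI[of "\<lambda>n. 2 * i n" "\<lambda>n. round_word (a n)" u]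
          is_omega_concatI[of "\<lambda>n. 2 * j n" "\<lambda>n. round_word (b n)" v] by auto
    qed
  qed
  ultimately show ?thesis by (rule that)
qed

text \<open>The segments are nonempty, so \<open>g\<close> is strictly increasing, and gluing them
  with \<open>merge\<close> covers all times.\<close>

lemma infinite_chain:
  assumes "\<And>n. tranclp R (c n) (c (Suc n))"
  obtains f g where "strict_mono (g :: nat \<Rightarrow> nat)" "g 0 = 0" "\<And>n. f (g n) = c n" "\<And>m. R (f m) (f (Suc m))"
proof -
  have "\<exists>l p. 0 < l \<and> p 0 = c n \<and> p l = c (Suc n) \<and> (\<forall>i<l. R (p i) (p (Suc i)))" for n
    using assms[of n] unfolding tranclp_power relpowp_fun_conv by blast
  then obtain l p where lp: "\<And>n. 0 < l n" "\<And>n. p n 0 = c n" "\<And>n. p n (l n) = c (Suc n)"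
    "\<And>n i. i < l n \<Longrightarrow> R (p n i) (p n (Suc i))" by metis
  define g where "g n = (\<Sum>k<n. l k)" for n
  have g: "idx_sequence g" unfolding idx_sequence_def g_def using lp(1) by simp
  define ws where "ws n m = p n (m - g n)" for n m
  define f where "f = merge ws g"
  have f: "f m = p n (m - g n)" if "m \<in> {g n..<g (Suc n)}" for m n
    unfolding f_def using merge[OF g that, of ws] by (simp add: ws_def)
  have gS: "g (Suc n) = g n + l n" for n by (simp add: g_def)
  show thesis
  proof (rule that[of g f])
    show "strict_mono g" using g by (simp add: idx_sequence_def strict_mono_Suc_iff)
    show "g 0 = 0" by (simp add: g_def)
    show fg: "f (g n) = c n" for n using f[of "g n" n] lp(1)[of n] lp(2) by (simp add: gS)
    fix m
    obtain n where n: "m \<in> {g n..<g (Suc n)}" using idx_sequence_interval[OF g] by blast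
    have "f (Suc m) = p n (Suc m - g n)"
    proof (cases "Suc m = g (Suc n)")
      case True
      then show ?thesis using fg[of "Suc n"] lp(3)[of n] by (simp add: gS)
    next
      case False
      then show ?thesis using f[of "Suc m" n] n by auto
    qed
    then show "R (f m) (f (Suc m))" using f[OF n] lp(4)[of "m - g n" n] n by (auto simp: gS Suc_diff_le)
  qed
qed

text \<open>Accepting runs can thus be given by phases of several moves, with the acceptance
  conditions checked only between phases.\<close>

lemma heads_accept_chain:
  assumes "\<And>n. tranclp (head_step \<delta> U V) (c n) (c (Suc n))" "c 0 = (q0, 0, 0)" "\<exists>\<^sub>\<infinity>n. fst (c n) \<in> F"
    "\<And>m. \<exists>n. m \<le> fst (snd (c n))" "\<And>m. \<exists>n. m \<le> snd (snd (c n))"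
  shows "heads_accept \<delta> q0 F U V"
proof -
  obtain g f where fg: "strict_mono g" "g 0 = 0" "\<And>n. f (g n) = c n" "\<And>m. head_step \<delta> U V (f m) (f (Suc m))"
    by (rule infinite_chain[of "head_step \<delta> U V" c, OF assms(1)]) (rule that)
  have "\<exists>\<^sub>\<infinity>n. fst (f n) \<in> F" unfolding INFM_nat_le
  proof
    fix m
    obtain n where "n \<ge> m" "fst (c n) \<in> F" using assms(3) unfolding INFM_nat_le by blast
    then show "\<exists>n\<ge>m. fst (f n) \<in> F"
      using strict_mono_imp_increasing[OF fg(1), of n] fg(3)[of n] by (intro exI[of _ "g n"]) auto
  qed
  moreover have "f 0 = (q0, 0, 0)" using fg(2) fg(3)[of 0] assms(2) by simp
  moreover have "\<exists>n. m \<le> fst (snd (f n))" for m 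
  proof -
    obtain n where "m \<le> fst (snd (c n))" using assms(4) by blast
    then show ?thesis using fg(3)[of n] by (intro exI[of _ "g n"]) simp
  qed
  moreover have "\<exists>n. m \<le> snd (snd (f n))" for m 
  proof -
    obtain n where "m \<le> snd (snd (c n))" using assms(5) by blast
    then show ?thesis using fg(3)[of n] by (intro exI[of _ "g n"]) simp
  qed
  ultimately show ?thesis unfolding heads_accept_def using fg(4) by (intro exI[of _ f]) simp
qed

section \<open>An acceptor for incorrect runs and for branches with infinitely many marks\<close>

text \<open>What remains to be verified about the unread ticks of head 1, in the later line, against
  those of head 2: equally many, one more, or one less truncated at zero.\<close>

datatype mode = Same | Up | Down

fun apply_mode :: "mode \<Rightarrow> nat \<Rightarrow> nat" where
  "apply_mode Same v = v"
| "apply_mode Up v = Suc v"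
| "apply_mode Down v = v - 1"

fun mode_of :: "com list \<Rightarrow> nat \<Rightarrow> mode" where
  "mode_of (Inc r # K) j = (if j = r then Up else Same)"
| "mode_of (Dec r # K) j = (if j = r then Down else Same)"
| "mode_of _ j = Same"

lemma apply_mode_of: "apply_mode (mode_of K j) v = upd_reg K j v"
  by (cases "(K, j)" rule: mode_of.cases) auto

fun touched :: "com list \<Rightarrow> nat" where
  "touched (Inc r # K) = r"
| "touched (Dec r # K) = r"
| "touched _ = 0"

lemma upd_reg_untouched: "touched K < j \<Longrightarrow> upd_reg K j v = v"
  by (cases K rule: touched.cases) auto

text \<open>
  \<open>Line\<close> compares the successor continuation with the tested register. \<open>Skip\<close>, \<open>Cmp\<close> and \<open>Rest\<close>
  compare the ticks of one register in consecutive lines, head 1 reading the later line.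
  \<open>Stuck\<close> verifies that no further line begins. In the remaining states head 1 is on some level of
  the binary tree: in \<open>Path\<close> its offset is the current node and head 2 is at the start of the next level; in
  \<open>Pair\<close> head 2 passes two nodes for each node passed by head 1, up to the end of the level of head 1;
  in \<open>Sync\<close> both heads pass equally many nodes, up to the end of the level of head 2.
\<close>

datatype state = Init | Start | Line "com list" bool | Skip "com list" nat | Cmp mode nat | Rest1 nat | Rest2 nat
  | Err | Stuck | Seek | Path bool | Pair nat | Sync nat

definition final_states :: "state set" where
  "final_states = {Err, Stuck, Path True}"

text \<open>Marks count as silent: they do not move a head to another node.\<close>

definition silent :: "letter \<Rightarrow> bool" where
  "silent a \<longleftrightarrow> letter_labels a \<noteq> [Node] \<and> letter_labels a \<noteq> [End]"

context machine
begin

text \<open>Besides the registers changed by programs, the bound covers the letters of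
  \<open>X\<close>, because a move \<open>c\<close> of Player 1 is coded by the letter
  \<open>Tick c\<close>.\<close>

definition reg_bound :: nat where
  "reg_bound = Suc (Max (insert 0 (touched ` pcs \<union> X)))"

lemma reg_bound: "K \<in> pcs \<Longrightarrow> touched K < reg_bound" "c \<in> X \<Longrightarrow> c < reg_bound"
  unfolding reg_bound_def using finite_pcs finX by (auto intro!: le_imp_less_Suc Max_ge)

definition alphabet :: "letter set" where
  "alphabet = Pc ` pcs \<union> Tick ` {..<reg_bound}"

text \<open>Head 1 reads the move of Player 1 together with the first tape, head 2 only the second
  tape. \<open>Init\<close> guesses between an error and a branch. In \<open>Start\<close> both
  heads advance together up to the guessed error. \<open>Line K z\<close> remembers in
  \<open>z\<close> whether a tick of the tested register was seen, and \<open>Err\<close> accepts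
  whatever follows.\<close>

inductive delta :: "state \<Rightarrow> (nat \<times> letter) option \<Rightarrow> letter option \<Rightarrow> state \<Rightarrow> bool" where
  init: "delta Init None None Start"
| init_seek: "delta Init None None Seek"
| init_err: "a \<noteq> Pc start \<Longrightarrow> delta Init (Some (p, a)) None Err"
| start: "delta Start (Some c) (Some b) Start"
| stuck_guess: "delta Start None None Stuck"
| stuck: "\<not> is_Pc a \<Longrightarrow> delta Stuck (Some (p, a)) (Some b) Stuck"
| copy_err: "a \<noteq> b \<Longrightarrow> delta Start (Some (p, a)) (Some b) Err"
| in_err: "letter_labels a = [In c d] \<Longrightarrow> p \<noteq> c \<Longrightarrow> delta Start (Some (p, a)) None Err"
| line_start: "delta Start (Some (p, Pc K)) None (Line K False)"
| line_tick: "delta (Line K z) (Some (p, Tick j)) None (Line K (z \<or> j = test_reg K))"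
| line_err: "\<not> succ_cont K (\<not> z) K' \<Longrightarrow> delta (Line K z) (Some (p, Pc K')) None Err"
| skip_start: "j < reg_bound \<Longrightarrow> delta Start (Some (p, Pc K)) (Some (Pc K)) (Skip K j)"
| skip_tick: "delta (Skip K j) (Some (p, Tick i)) None (Skip K j)"
| skip_end: "delta (Skip K j) (Some (p, Pc K')) None (Cmp (mode_of K j) j)"
| cmp_skip1: "i \<noteq> j \<Longrightarrow> delta (Cmp m j) (Some (p, Tick i)) None (Cmp m j)"
| cmp_skip2: "i \<noteq> j \<Longrightarrow> delta (Cmp m j) None (Some (Tick i)) (Cmp m j)"
| cmp_same: "delta (Cmp Same j) (Some (p, Tick j)) (Some (Tick j)) (Cmp Same j)"
| cmp_end1: "delta (Cmp Same j) (Some (p, Pc K)) None (Rest2 j)"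
| cmp_end2: "delta (Cmp Same j) None (Some (Pc K)) (Rest1 j)"
| cmp_up: "delta (Cmp Up j) (Some (p, Tick j)) None (Cmp Same j)"
| cmp_up_err: "delta (Cmp Up j) (Some (p, Pc K)) None Err"
| cmp_down: "delta (Cmp Down j) None (Some (Tick j)) (Cmp Same j)"
| cmp_down_end: "delta (Cmp Down j) None (Some (Pc K)) (Rest1 j)"
| rest1_skip: "i \<noteq> j \<Longrightarrow> delta (Rest1 j) (Some (p, Tick i)) None (Rest1 j)"
| rest1_err: "delta (Rest1 j) (Some (p, Tick j)) None Err"
| rest2_skip: "i \<noteq> j \<Longrightarrow> delta (Rest2 j) None (Some (Tick i)) (Rest2 j)"
| rest2_err: "delta (Rest2 j) None (Some (Tick j)) Err"
| err: "delta Err (Some c) (Some b) Err"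
| seek: "letter_labels b \<noteq> [End] \<Longrightarrow> delta Seek None (Some b) Seek"
| seek_end: "letter_labels b = [End] \<Longrightarrow> delta Seek None (Some b) (Path False)"
| path: "silent a \<Longrightarrow> delta (Path f) (Some (p, a)) None (Path (letter_labels a = [Mark]))"
| path_node: "letter_labels a = [Node] \<Longrightarrow> t = 1 \<or> t = 2 \<Longrightarrow> delta (Path f) (Some (p, a)) None (Pair t)"
| pair_skip1: "silent a \<Longrightarrow> delta (Pair t) (Some (p, a)) None (Pair t)"
| pair_skip2: "silent b \<Longrightarrow> delta (Pair t) None (Some b) (Pair t)"
| pair_node2: "letter_labels b = [Node] \<Longrightarrow> delta (Pair (Suc t)) None (Some b) (Pair t)"
| pair_node1: "letter_labels a = [Node] \<Longrightarrow> delta (Pair 0) (Some (p, a)) None (Pair 2)"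
| pair_end: "letter_labels a = [End] \<Longrightarrow> delta (Pair 0) (Some (p, a)) None (Sync 0)"
| sync_skip1: "silent a \<Longrightarrow> delta (Sync t) (Some (p, a)) None (Sync t)"
| sync_skip2: "silent b \<Longrightarrow> delta (Sync t) None (Some b) (Sync t)"
| sync_node2: "letter_labels b = [Node] \<Longrightarrow> delta (Sync 0) None (Some b) (Sync 1)"
| sync_node1: "letter_labels a = [Node] \<Longrightarrow> delta (Sync 1) (Some (p, a)) None (Sync 0)"
| sync_end: "letter_labels b = [End] \<Longrightarrow> delta (Sync 0) None (Some b) (Path False)"

definition state_set :: "state set" where
  "state_set = {Init, Start, Err, Stuck, Seek} \<union> (\<lambda>(K, z). Line K z) ` (pcs \<times> UNIV) \<union>
    (\<lambda>(K, j). Skip K j) ` (pcs \<times> {..<reg_bound}) \<union> (\<lambda>(m, j). Cmp m j) ` (UNIV \<times> {..<reg_bound}) \<union>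
    Rest1 ` {..<reg_bound} \<union> Rest2 ` {..<reg_bound} \<union> range Path \<union> Pair ` {..2} \<union> Sync ` {..1}"

lemma finite_state_set: "finite state_set"
proof -
  have "finite (UNIV :: mode set)" by (rule finite_subset[of _ "{Same, Up, Down}"]) (auto intro: mode.exhaust)
  then show ?thesis unfolding state_set_def using finite_pcs by auto
qed

lemma delta_state_set:
  assumes "delta q a b q'" "q \<in> state_set" "snd ` set_option a \<subseteq> alphabet"
  shows "q' \<in> state_set"
  using assms(1) by cases (use assms(2,3) in \<open>auto simp: state_set_def alphabet_def\<close>)

end

section \<open>Soundness: accepted correct runs have a branch with infinitely many marks\<close>

definition branch_value :: "nat list \<Rightarrow> nat" where
  "branch_value ys = binval (\<lambda>i. ys ! i) (length ys)"

lemma binval_cong: "(\<And>i. i < n \<Longrightarrow> y i = y' i) \<Longrightarrow> binval y n = binval y' n"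
  by (induction n) auto

lemma branch_value_Nil [simp]: "branch_value [] = 0"
  by (simp add: branch_value_def)

lemma branch_value_snoc [simp]: "branch_value (ys @ [b]) = 2 * branch_value ys + b"
  using binval_cong[of "length ys" "\<lambda>i. (ys @ [b]) ! i" "\<lambda>i. ys ! i"] by (simp add: branch_value_def nth_append)

text \<open>\<open>t = 2\<close> selects the left child of the current node and \<open>t = 1\<close>
  the right one.\<close>

fun chosen :: "state \<Rightarrow> state \<Rightarrow> nat list" where
  "chosen (Path f) (Pair t) = [2 - t]"
| "chosen _ _ = []"

locale correct_run = machine + stream G x "\<lambda>i. letter_labels (e i)" for x and e :: "nat \<Rightarrow> letter" +
  fixes p :: "nat \<Rightarrow> nat"
  assumes correct: "correct p e"
begin

lemma inf_Pc: "\<exists>\<^sub>\<infinity>i. is_Pc (e i)"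
  using correct by (simp add: correct_def well_formed_def)

lemma line_succ: "e i = Pc K \<Longrightarrow>
    (\<exists>K'. e (next_pc e (Suc i)) = Pc K' \<and> succ_cont K (ticks e (test_reg K) (Suc i) = 0) K') \<and>
    (\<forall>j. ticks e j (Suc (next_pc e (Suc i))) = upd_reg K j (ticks e j (Suc i)))"
  using correct unfolding correct_def well_formed_def by blast

text \<open>The states that compare lines assert that no discrepancy is left, and \<open>Err\<close>
  is excluded. With offsets counted from the start of a level, \<open>Pair t\<close> says that twice
  the offset of head 1 is the target node plus the offset of head 2 plus \<open>t\<close>;
  \<open>Sync t\<close> says that the target is the offset of head 1 plus the nodes left to head 2
  plus \<open>t\<close>. The equations avoid subtraction.\<close>

fun inv :: "state \<Rightarrow> nat \<Rightarrow> nat \<Rightarrow> nat list \<Rightarrow> bool" where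
  "inv Init i j ys = (i = 0 \<and> j = 0 \<and> ys = [])"
| "inv Start i j ys = (i = j)"
| "inv (Line K z) i j ys = (\<exists>K'. e (next_pc e i) = Pc K' \<and> succ_cont K (\<not> (z \<or> ticks e (test_reg K) i > 0)) K')"
| "inv (Skip K k) i j ys = (ticks e k (Suc (next_pc e i)) = upd_reg K k (ticks e k j))"
| "inv (Cmp m k) i j ys = (ticks e k i = apply_mode m (ticks e k j))"
| "inv (Rest1 k) i j ys = (ticks e k i = 0)"
| "inv (Rest2 k) i j ys = (ticks e k j = 0)"
| "inv Err i j ys = False"
| "inv Stuck i j ys = True"
| "inv Seek i j ys = (ends j = 0 \<and> i = 0 \<and> ys = [])"
| "inv (Path f) i j ys = (length ys = ends i \<and> nodes i = 2 ^ ends i + branch_value ys \<and>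
    ends j = Suc (ends i) \<and> nodes j = 2 ^ ends j \<and>
    (f \<longrightarrow> G (rounds_code x (Suc (length ys))) (branch_value ys) \<noteq> 0))"
| "inv (Pair t) i j ys = (length ys = Suc (ends i) \<and> ends j = Suc (ends i) \<and>
    2 ^ Suc (ends j) + 2 * nodes i = 2 * 2 ^ Suc (ends i) + branch_value ys + nodes j + t)"
| "inv (Sync t) i j ys = (length ys = ends i \<and> ends j = ends i \<and>
    nodes i + t + 2 ^ Suc (ends j) = 2 ^ ends i + branch_value ys + nodes j)"

lemma silent_Suc: "silent (e i) \<Longrightarrow> nodes (Suc i) = nodes i \<and> ends (Suc i) = ends i"
  by (auto simp: silent_def nodes_Suc ends_Suc)

lemma Node_Suc: "letter_labels (e i) = [Node] \<Longrightarrow> nodes (Suc i) = Suc (nodes i) \<and> ends (Suc i) = ends i"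
  by (auto simp: nodes_Suc ends_Suc)

lemma End_Suc: "letter_labels (e i) = [End] \<Longrightarrow>
    nodes i = 2 ^ Suc (ends i) \<and> nodes (Suc i) = 2 ^ Suc (ends i) \<and> ends (Suc i) = Suc (ends i)"
  using End_nodes[of i] by (auto simp: nodes_Suc ends_Suc)

lemma inv_step:
  assumes inv: "inv q i j ys" and \<delta>: "delta q a b q'"
    and a: "a = None \<and> i' = i \<or> a = Some (p i, e i) \<and> i' = Suc i"
    and b: "b = None \<and> j' = j \<or> b = Some (e j) \<and> j' = Suc j"
  shows "inv q' i' j' (ys @ chosen q q')"
  using \<delta>
proof cases
  case (init_err aa p)
  then show ?thesis using inv a correct by (auto simp: correct_def well_formed_def)
next
  case (in_err aa c d p')
  then show ?thesis using a correct by (auto simp: correct_def well_formed_def)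
next
  case (line_start p' K)
  then show ?thesis using line_succ[of i K] inv a by auto
next
  case (line_tick K z p' k)
  then have "e i = Tick k" using a by auto
  then show ?thesis using line_tick inv a next_pc_Tick[of e i k] ticks_Tick[OF inf_Pc, of i k] by (auto split: if_splits)
next
  case (line_err K z K' p')
  then have "e i = Pc K'" using a by auto
  then show ?thesis using line_err inv a by (auto simp: next_pc_Pc ticks_Pc)
next
  case (skip_start k p' K)
  then show ?thesis using line_succ[of i K] inv a b by auto
next
  case (skip_tick K k p' l)
  then show ?thesis using inv a b next_pc_Tick[of e i l] by auto
next
  case (skip_end K k p' K')
  then have "e i = Pc K'" using a by auto
  then show ?thesis using skip_end inv a b by (auto simp: next_pc_Pc apply_mode_of)
next
  case (cmp_skip1 l k m p')
  then show ?thesis using inv a b ticks_Tick[OF inf_Pc, of i l k] by auto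
next
  case (cmp_skip2 l k m)
  then show ?thesis using inv a b ticks_Tick[OF inf_Pc, of j l k] by auto
next
  case (cmp_same k p')
  then show ?thesis using inv a b ticks_Tick[OF inf_Pc, of i k k] ticks_Tick[OF inf_Pc, of j k k] by auto
next
  case (cmp_end1 k p' K)
  then show ?thesis using inv a b ticks_Pc[of e i K k] by auto
next
  case (cmp_end2 k K)
  then show ?thesis using inv a b ticks_Pc[of e j K k] by auto
next
  case (cmp_up k p')
  then show ?thesis using inv a b ticks_Tick[OF inf_Pc, of i k k] by auto
next
  case (cmp_up_err k p' K)
  then show ?thesis using inv a b ticks_Pc[of e i K k] by auto
next
  case (cmp_down k)
  then show ?thesis using inv a b ticks_Tick[OF inf_Pc, of j k k] by auto
next
  case (cmp_down_end k K)
  then show ?thesis using inv a b ticks_Pc[of e j K k] by auto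
next
  case (rest1_skip l k p')
  then show ?thesis using inv a b ticks_Tick[OF inf_Pc, of i l k] by auto
next
  case (rest1_err k p')
  then show ?thesis using inv a b ticks_Tick[OF inf_Pc, of i k k] by auto
next
  case (rest2_skip l k)
  then show ?thesis using inv a b ticks_Tick[OF inf_Pc, of j l k] by auto
next
  case (rest2_err k)
  then show ?thesis using inv a b ticks_Tick[OF inf_Pc, of j k k] by auto
next
  case (seek bb)
  then show ?thesis using inv a b by (auto simp: ends_Suc)
next
  case (seek_end bb)
  then show ?thesis using inv a b End_Suc[of j] by auto
next
  case (path aa f p')
  then show ?thesis using inv b a silent_Suc[of i] Mark_nodes[of i] by auto
next
  case (path_node aa t f p')
  then show ?thesis using inv b a Node_Suc[of i] by auto
next
  case (pair_skip1 aa t p')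
  then show ?thesis using inv b a silent_Suc[of i] by auto
next
  case (pair_skip2 bb t)
  then show ?thesis using inv a b silent_Suc[of j] by auto
next
  case (pair_node2 bb t)
  then show ?thesis using inv a b Node_Suc[of j] by auto
next
  case (pair_node1 aa p')
  then show ?thesis using inv b a Node_Suc[of i] by auto
next
  case (pair_end aa p')
  then show ?thesis using inv b a End_Suc[of i] by auto
next
  case (sync_skip1 aa t p')
  then show ?thesis using inv b a silent_Suc[of i] by auto
next
  case (sync_skip2 bb t)
  then show ?thesis using inv a b silent_Suc[of j] by auto
next
  case (sync_node2 bb)
  then show ?thesis using inv a b Node_Suc[of j] by auto
next
  case (sync_node1 aa p')
  then show ?thesis using inv b a Node_Suc[of i] by auto
next
  case (sync_end bb)
  then show ?thesis using inv a b End_Suc[of j] by auto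
qed (use inv a b in auto)

text \<open>\<open>Err\<close> contradicts the invariant and \<open>Stuck\<close> cannot pass the
  next \<open>Pc\<close>, so \<open>Path True\<close> recurs. Each time the bits chosen so far name
  a marked node, while head 1 gets to ever deeper levels.\<close>

lemma sound:
  assumes "heads_accept delta Init final_states (\<lambda>i. (p i, e i)) e"
  shows "\<exists>y\<in>omega_words {0, 1}. \<exists>\<^sub>\<infinity>n. G (rounds_code x (Suc n)) (binval y n) \<noteq> 0"
proof -
  obtain r where r0: "r 0 = (Init, 0, 0)" and st: "\<And>n. head_step delta (\<lambda>i. (p i, e i)) e (r n) (r (Suc n))"
    and inf: "\<exists>\<^sub>\<infinity>n. fst (r n) \<in> final_states" and unb: "\<And>m. \<exists>n. m \<le> fst (snd (r n))"
    using assms unfolding heads_accept_def by blast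
  define q i j where "q n = fst (r n)" and "i n = fst (snd (r n))" and "j n = snd (snd (r n))" for n
  define hist where "hist n = concat (map (\<lambda>k. chosen (q k) (q (Suc k))) [0..<n])" for n
  obtain a b where ab: "\<And>n. delta (q n) (a n) (b n) (q (Suc n))"
    "\<And>n. a n = None \<and> i (Suc n) = i n \<or> a n = Some (p (i n), e (i n)) \<and> i (Suc n) = Suc (i n)"
    "\<And>n. b n = None \<and> j (Suc n) = j n \<or> b n = Some (e (j n)) \<and> j (Suc n) = Suc (j n)"
  proof -
    define moves where "moves n a b \<longleftrightarrow> delta (q n) a b (q (Suc n)) \<and>
      (a = None \<and> i (Suc n) = i n \<or> a = Some (p (i n), e (i n)) \<and> i (Suc n) = Suc (i n)) \<and>
      (b = None \<and> j (Suc n) = j n \<or> b = Some (e (j n)) \<and> j (Suc n) = Suc (j n))" for n a b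
    have "\<exists>a b. moves n a b" for n
      using st[of n] unfolding head_step_def q_def i_def j_def moves_def .
    then obtain a b where "\<And>n. moves n (a n) (b n)" by metis
    then show thesis using that[of a b] unfolding moves_def by blast
  qed
  have inv: "inv (q n) (i n) (j n) (hist n)" for n
  proof (induction n)
    case 0
    then show ?case by (simp add: q_def i_def j_def r0 hist_def)
  next
    case (Suc n)
    then show ?case using inv_step[OF _ ab(1)[of n] ab(2)[of n] ab(3)[of n]] by (simp add: hist_def)
  qed
  have mono: "i n \<le> i m" if "n \<le> m" for n m
    by (rule lift_Suc_mono_le[OF _ that]) (use ab(2) in \<open>metis le_refl lessI less_imp_le\<close>)
  have not_stuck: "q n \<noteq> Stuck" for n
  proof
    assume n: "q n = Stuck"
    have S: "q m = Stuck" if "m \<ge> n" for m using that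
    proof (induction rule: dec_induct)
      case (step m)
      show ?case using ab(1)[of m] unfolding step.IH by cases auto
    qed (rule n)
    obtain k where k: "k \<ge> i n" "is_Pc (e k)" using inf_Pc unfolding INFM_nat_le by blast
    \<comment> \<open>The first time at which head 1 has passed the \<open>Pc\<close> at
      \<open>k\<close>; the move before it reads this letter in state \<open>Stuck\<close>.\<close>
    define m where "m = (LEAST m. k < i m)"
    obtain m0 where "Suc k \<le> i m0" using unb unfolding i_def by blast
    then have m: "k < i m" unfolding m_def by (intro LeastI[of "\<lambda>m. k < i m" m0]) simp
    have "m \<noteq> 0" using m by (cases "m = 0") (auto simp: i_def r0)
    then obtain m' where m': "m = Suc m'" by (cases m) auto
    have "\<not> k < i m'" using not_less_Least[of m' "\<lambda>m. k < i m"] m' unfolding m_def by simp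
    then have im: "i m' = k" using m m' ab(2)[of m'] by auto
    then have im': "a m' = Some (p k, e k)" using m m' ab(2)[of m'] by auto
    have "n \<le> m'" using k(1) m mono[of m n] m' by (cases "m \<le> n") auto
    then have "delta Stuck (Some (p k, e k)) (b m') Stuck" using ab(1)[of m'] S[of m'] S[of "Suc m'"] im' by simp
    then show False by cases (use k(2) in auto)
  qed
  have hist_mono: "\<exists>vs. hist m = hist n @ vs" if "n \<le> m" for n m
    using that by (induction rule: dec_induct) (auto simp: hist_def)
  \<comment> \<open>The limit of the growing lists of chosen bits, with \<open>0\<close> at indices
    that no list reaches.\<close>
  define y where "y k = (if \<exists>n. k < length (hist n) then hist (LEAST n. k < length (hist n)) ! k else 0)" for k
  have y: "y k = hist n ! k" if "k < length (hist n)" for k n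
  proof -
    let ?m = "LEAST n. k < length (hist n)"
    have m: "k < length (hist ?m)" "?m \<le> n" using that by (auto intro: LeastI Least_le)
    then obtain vs where "hist n = hist ?m @ vs" using hist_mono by blast
    then show ?thesis using m(1) that unfolding y_def by (auto simp: nth_append)
  qed
  have yk: "y k \<in> {0, 1}" for k
  proof -
    have "set (chosen s s') \<subseteq> {0, 1}" if "delta s a' b' s'" for s s' a' b' using that by cases auto
    then have "set (hist n) \<subseteq> {0, 1}" for n using ab(1) by (fastforce simp: hist_def)
    then have "k < length (hist n) \<Longrightarrow> hist n ! k \<in> {0, 1}" for n using nth_mem by blast
    then have "y k \<in> {0, 1}" if "k < length (hist n)" for n using y[OF that] that by metis
    then show ?thesis by (cases "\<exists>n. k < length (hist n)") (auto simp: y_def)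
  qed
  have "range y \<subseteq> {0, 1}" by (rule image_subsetI) (rule yk)
  then have yw: "y \<in> omega_words {0, 1}" by (simp add: omega_words_def)
  have "\<exists>n\<ge>m. G (rounds_code x (Suc n)) (binval y n) \<noteq> 0" for m
  proof -
    \<comment> \<open>Once head 1 has reached level \<open>m\<close>, the next accepting visit shows
      a mark on a level not before \<open>m\<close>.\<close>
    obtain k where k: "letter_labels (e k) = [End]" "ends k = m" using ex_End[of m] by blast
    obtain n0 where n0: "k \<le> i n0" using unb unfolding i_def by blast
    obtain n where n: "n \<ge> n0" "q n \<in> final_states" using inf unfolding INFM_nat_le q_def by blast
    have "q n \<noteq> Err" using inv[of n] by auto
    then have qn: "q n = Path True" using n(2) not_stuck[of n] by (auto simp: final_states_def)
    have "m \<le> ends (i n)" using k(2) ends_mono[of k "i n"] n0 mono[OF n(1)] by auto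
    moreover have l: "length (hist n) = ends (i n)" "G (rounds_code x (Suc (length (hist n)))) (branch_value (hist n)) \<noteq> 0"
      using inv[of n] unfolding qn by auto
    moreover have "branch_value (hist n) = binval y (length (hist n))"
      unfolding branch_value_def by (rule binval_cong) (use y in auto)
    ultimately show ?thesis by (intro exI[of _ "length (hist n)"]) auto
  qed
  then show ?thesis using yw unfolding INFM_nat_le by blast
qed

section \<open>Completeness for branches: the heads follow a given branch\<close>

abbreviation moves :: "state \<times> nat \<times> nat \<Rightarrow> state \<times> nat \<times> nat \<Rightarrow> bool" where
  "moves \<equiv> head_step delta (\<lambda>i. (p i, e i)) e"

lemma move1: "delta q (Some (p i, e i)) None q' \<Longrightarrow> moves (q, i, j) (q', Suc i, j)"
  by (auto simp: head_step_def)

lemma move2: "delta q None (Some (e j)) q' \<Longrightarrow> moves (q, i, j) (q', i, Suc j)"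
  by (auto simp: head_step_def)

lemma silent_between:
  assumes "h \<le> m" "m < i" "nodes h = nodes i" "ends h = ends i"
  shows "silent (e m)"
proof -
  have "nodes h \<le> nodes m" "nodes (Suc m) \<le> nodes i" "ends h \<le> ends m" "ends (Suc m) \<le> ends i"
    using assms(1,2) nodes_mono[of h m] nodes_mono[of "Suc m" i] ends_mono[of h m] ends_mono[of "Suc m" i] by auto
  then show ?thesis using assms by (auto simp: silent_def nodes_Suc ends_Suc)
qed

lemma skip1:
  assumes "h \<le> i" "nodes h = nodes i" "ends h = ends i" "\<And>a c. silent a \<Longrightarrow> delta q (Some (c, a)) None q"
  shows "moves\<^sup>*\<^sup>* (q, h, j) (q, i, j)"
proof -
  have "moves\<^sup>*\<^sup>* (q, h, j) (q, m, j)" if "h \<le> m" "m \<le> i" for m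
    using that
  proof (induction rule: dec_induct)
    case (step m)
    then have "moves (q, m, j) (q, Suc m, j)" by (intro move1 assms(4) silent_between[OF _ _ assms(2,3)]) auto
    then show ?case using step by (meson Suc_leD rtranclp.rtrancl_into_rtrancl)
  qed simp
  then show ?thesis using assms(1) by blast
qed

lemma skip2:
  assumes "h \<le> j" "nodes h = nodes j" "ends h = ends j" "\<And>a. silent a \<Longrightarrow> delta q None (Some a) q"
  shows "moves\<^sup>*\<^sup>* (q, i, h) (q, i, j)"
proof -
  have "moves\<^sup>*\<^sup>* (q, i, h) (q, i, m)" if "h \<le> m" "m \<le> j" for m
    using that
  proof (induction rule: dec_induct)
    case (step m)
    then have "moves (q, i, m) (q, i, Suc m)" by (intro move2 assms(4) silent_between[OF _ _ assms(2,3)]) auto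
    then show ?case using step by (meson Suc_leD rtranclp.rtrancl_into_rtrancl)
  qed simp
  then show ?thesis using assms(1) by blast
qed

lemma skip_path:
  assumes "h \<le> i" "nodes h = nodes i" "ends h = ends i"
  shows "\<exists>f'. moves\<^sup>*\<^sup>* (Path f, h, j) (Path f', i, j)"
proof -
  have "\<exists>f'. moves\<^sup>*\<^sup>* (Path f, h, j) (Path f', m, j)" if "h \<le> m" "m \<le> i" for m
    using that
  proof (induction rule: dec_induct)
    case (step m)
    then obtain f' where f': "moves\<^sup>*\<^sup>* (Path f, h, j) (Path f', m, j)" by auto
    have "moves (Path f', m, j) (Path (letter_labels (e m) = [Mark]), Suc m, j)"
      using step by (intro move1 delta.path silent_between[OF _ _ assms(2,3)]) auto
    then show ?case using f' by (meson rtranclp.rtrancl_into_rtrancl)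
  qed auto
  then show ?thesis using assms(1) by blast
qed

text \<open>At such a position all marks of the current node still lie ahead, since the preceding
  letter, if any, is a \<open>Node\<close> or an \<open>End\<close>.\<close>

definition fresh :: "nat \<Rightarrow> bool" where
  "fresh h \<longleftrightarrow> h = 0 \<or> \<not> silent (e (h - 1))"

lemma next_node:
  assumes "2 ^ ends h \<le> nodes h" "nodes h < 2 ^ Suc (ends h)"
  obtains i where "h \<le> i" "letter_labels (e i) = [Node]" "nodes h = nodes i" "ends h = ends i"
    "nodes (Suc i) = Suc (nodes h)" "ends (Suc i) = ends h" "fresh (Suc i)"
proof -
  obtain i where i: "letter_labels (e i) = [Node]" "ends i = ends h" "nodes i = nodes h"
    using ex_Node[OF assms] by blast
  have "h \<le> i"
  proof (rule ccontr)
    assume "\<not> h \<le> i"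
    then have "nodes (Suc i) \<le> nodes h" by (intro nodes_mono) simp
    then show False using i Node_Suc by simp
  qed
  then show thesis using i Node_Suc[of i] by (intro that[of i]) (auto simp: fresh_def silent_def)
qed

lemma next_end:
  assumes "nodes h = 2 ^ Suc (ends h)"
  obtains i where "h \<le> i" "letter_labels (e i) = [End]" "nodes h = nodes i" "ends h = ends i"
    "nodes (Suc i) = nodes h" "ends (Suc i) = Suc (ends h)" "fresh (Suc i)"
proof -
  obtain i where i: "letter_labels (e i) = [End]" "ends i = ends h" "nodes i = nodes h"
    using ex_End[of "ends h"] assms by metis
  have "h \<le> i"
  proof (rule ccontr)
    assume "\<not> h \<le> i"
    then have "ends (Suc i) \<le> ends h" by (intro ends_mono) simp
    then show False using i End_Suc by simp
  qed
  then show thesis using i End_Suc[of i] by (intro that[of i]) (auto simp: fresh_def silent_def)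
qed

lemma pass_node2:
  assumes "2 ^ ends j \<le> nodes j" "nodes j < 2 ^ Suc (ends j)"
    "\<And>a. silent a \<Longrightarrow> delta q None (Some a) q" "\<And>a. letter_labels a = [Node] \<Longrightarrow> delta q None (Some a) q'"
  obtains j' where "moves\<^sup>*\<^sup>* (q, i, j) (q', i, j')" "nodes j' = Suc (nodes j)" "ends j' = ends j"
proof -
  obtain k where k: "j \<le> k" "letter_labels (e k) = [Node]" "nodes j = nodes k" "ends j = ends k"
    "nodes (Suc k) = Suc (nodes j)" "ends (Suc k) = ends j" by (rule next_node[OF assms(1,2)])
  have "moves\<^sup>*\<^sup>* (q, i, j) (q, i, k)" by (rule skip2) (use k assms in auto)
  moreover have "moves (q, i, k) (q', i, Suc k)" by (rule move2) (use k assms in auto)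
  ultimately show thesis using k by (intro that[of "Suc k"]) auto
qed

lemma pass_node1:
  assumes "2 ^ ends i \<le> nodes i" "nodes i < 2 ^ Suc (ends i)"
    "\<And>a c. silent a \<Longrightarrow> delta q (Some (c, a)) None q" "\<And>a c. letter_labels a = [Node] \<Longrightarrow> delta q (Some (c, a)) None q'"
  obtains i' where "moves\<^sup>*\<^sup>* (q, i, j) (q', i', j)" "nodes i' = Suc (nodes i)" "ends i' = ends i" "fresh i'"
proof -
  obtain k where k: "i \<le> k" "letter_labels (e k) = [Node]" "nodes i = nodes k" "ends i = ends k"
    "nodes (Suc k) = Suc (nodes i)" "ends (Suc k) = ends i" "fresh (Suc k)" by (rule next_node[OF assms(1,2)])
  have "moves\<^sup>*\<^sup>* (q, i, j) (q, k, j)" by (rule skip1) (use k assms in auto)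
  moreover have "moves (q, k, j) (q', Suc k, j)" by (rule move1) (use k assms in auto)
  ultimately show thesis using k by (intro that[of "Suc k"]) auto
qed

text \<open>\<open>k\<close> nodes of its level are left to head 1, and \<open>v\<close> is the
  number of nodes that head 2 will leave unread after spending two nodes per node of head 1.\<close>

lemma pair_phase:
  assumes "ends i = n" "ends j = Suc n" "nodes i + k = 2 ^ Suc n" "nodes j + 2 * k + v = 2 ^ Suc (Suc n)"
    "2 ^ n \<le> nodes i" "2 ^ Suc n \<le> nodes j"
  shows "\<exists>i' j'. moves\<^sup>*\<^sup>* (Pair 0, i, j) (Sync 0, i', j') \<and> ends i' = Suc n \<and> nodes i' = 2 ^ Suc n \<and> fresh i' \<and>
    ends j' = Suc n \<and> nodes j' + v = 2 ^ Suc (Suc n) \<and> 2 ^ Suc n \<le> nodes j'"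
  using assms
proof (induction k arbitrary: i j)
  case 0
  obtain l where l: "i \<le> l" "letter_labels (e l) = [End]" "nodes i = nodes l" "ends i = ends l"
    "nodes (Suc l) = nodes i" "ends (Suc l) = Suc (ends i)" "fresh (Suc l)"
    by (rule next_end[of i]) (use 0 in auto)
  have "moves\<^sup>*\<^sup>* (Pair 0, i, j) (Pair 0, l, j)" by (rule skip1) (use l in \<open>auto intro: delta.pair_skip1\<close>)
  moreover have "moves (Pair 0, l, j) (Sync 0, Suc l, j)" by (rule move1) (use l in \<open>auto intro: delta.pair_end\<close>)
  ultimately have "moves\<^sup>*\<^sup>* (Pair 0, i, j) (Sync 0, Suc l, j)" by simp
  then show ?case using 0 l by (intro exI[of _ "Suc l"] exI[of _ j]) auto
next
  case (Suc k)
  obtain i1 where i1: "moves\<^sup>*\<^sup>* (Pair 0, i, j) (Pair 2, i1, j)" "nodes i1 = Suc (nodes i)" "ends i1 = ends i"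
    by (rule pass_node1[of i "Pair 0" "Pair 2" j]) (use Suc.prems in \<open>auto intro: delta.pair_skip1 delta.pair_node1\<close>)
  obtain j1 where j1: "moves\<^sup>*\<^sup>* (Pair 2, i1, j) (Pair 1, i1, j1)" "nodes j1 = Suc (nodes j)" "ends j1 = ends j"
    by (rule pass_node2[of j "Pair 2" "Pair 1" i1])
      (use Suc.prems delta.pair_node2[of _ 1] in \<open>auto intro: delta.pair_skip2 simp: numeral_2_eq_2\<close>)
  obtain j2 where j2: "moves\<^sup>*\<^sup>* (Pair 1, i1, j1) (Pair 0, i1, j2)" "nodes j2 = Suc (nodes j1)" "ends j2 = ends j1"
    by (rule pass_node2[of j1 "Pair 1" "Pair 0" i1])
      (use Suc.prems j1 delta.pair_node2[of _ 0] in \<open>auto intro: delta.pair_skip2\<close>)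
  have "\<exists>i' j'. moves\<^sup>*\<^sup>* (Pair 0, i1, j2) (Sync 0, i', j') \<and> ends i' = Suc n \<and> nodes i' = 2 ^ Suc n \<and> fresh i' \<and>
    ends j' = Suc n \<and> nodes j' + v = 2 ^ Suc (Suc n) \<and> 2 ^ Suc n \<le> nodes j'"
    by (rule Suc.IH) (use Suc.prems i1 j1 j2 in auto)
  then show ?case using i1(1) j1(1) j2(1) by (meson rtranclp_trans)
qed

text \<open>The \<open>k\<close> nodes left to head 2 turn into the offset that head 1 gains, so a
  distance to the end of a level becomes a distance from the start of one.\<close>

lemma sync_phase:
  assumes "ends i = m" "ends j = m" "nodes j + k = 2 ^ Suc m" "nodes i + k < 2 ^ Suc m"
    "2 ^ m \<le> nodes i" "2 ^ m \<le> nodes j" "fresh i"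
  shows "\<exists>i' j'. moves\<^sup>*\<^sup>* (Sync 0, i, j) (Path False, i', j') \<and> ends i' = m \<and> nodes i' = nodes i + k \<and> fresh i' \<and>
    ends j' = Suc m \<and> nodes j' = 2 ^ Suc m"
  using assms
proof (induction k arbitrary: i j)
  case 0
  obtain l where l: "j \<le> l" "letter_labels (e l) = [End]" "nodes j = nodes l" "ends j = ends l"
    "nodes (Suc l) = nodes j" "ends (Suc l) = Suc (ends j)"
    by (rule next_end[of j]) (use 0 in auto)
  have "moves\<^sup>*\<^sup>* (Sync 0, i, j) (Sync 0, i, l)" by (rule skip2) (use l in \<open>auto intro: delta.sync_skip2\<close>)
  moreover have "moves (Sync 0, i, l) (Path False, i, Suc l)" by (rule move2) (use l in \<open>auto intro: delta.sync_end\<close>)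
  ultimately have "moves\<^sup>*\<^sup>* (Sync 0, i, j) (Path False, i, Suc l)" by simp
  then show ?case using 0 l by (intro exI[of _ i] exI[of _ "Suc l"]) auto
next
  case (Suc k)
  obtain j1 where j1: "moves\<^sup>*\<^sup>* (Sync 0, i, j) (Sync 1, i, j1)" "nodes j1 = Suc (nodes j)" "ends j1 = ends j"
    by (rule pass_node2[of j "Sync 0" "Sync 1" i]) (use Suc.prems in \<open>auto intro: delta.sync_skip2 delta.sync_node2[unfolded One_nat_def]\<close>)
  obtain i1 where i1: "moves\<^sup>*\<^sup>* (Sync 1, i, j1) (Sync 0, i1, j1)" "nodes i1 = Suc (nodes i)" "ends i1 = ends i" "fresh i1"
    by (rule pass_node1[of i "Sync 1" "Sync 0" j1]) (use Suc.prems in \<open>auto intro: delta.sync_skip1 delta.sync_node1[unfolded One_nat_def]\<close>)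
  have "\<exists>i' j'. moves\<^sup>*\<^sup>* (Sync 0, i1, j1) (Path False, i', j') \<and> ends i' = m \<and> nodes i' = nodes i1 + k \<and> fresh i' \<and>
    ends j' = Suc m \<and> nodes j' = 2 ^ Suc m"
    by (rule Suc.IH) (use Suc.prems i1 j1 in auto)
  moreover have "nodes i1 + k = nodes i + Suc k" using i1 by simp
  ultimately show ?case using i1(1) j1(1) by (metis (no_types, lifting) rtranclp_trans)
qed

definition at_node :: "nat \<Rightarrow> nat \<Rightarrow> nat \<Rightarrow> nat \<Rightarrow> bool" where
  "at_node n v i j \<longleftrightarrow> ends i = n \<and> nodes i = 2 ^ n + v \<and> ends j = Suc n \<and> nodes j = 2 ^ Suc n"

text \<open>Head 1 passes node \<open>v\<close> while head 2 passes \<open>2 - b\<close> nodes. The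
  other \<open>2 ^ n - Suc v\<close> nodes of head 1 cost head 2 twice as many, which leaves
  \<open>2 * v + b\<close> of its \<open>2 ^ Suc n\<close> nodes; \<open>sync_phase\<close> hands
  this number over to head 1.\<close>

lemma child:
  assumes at: "at_node n v i j" and v: "v < 2 ^ n" and b: "b \<in> {0, 1}"
  shows "\<exists>i' j'. moves\<^sup>+\<^sup>+ (Path f, i, j) (Path False, i', j') \<and> at_node (Suc n) (2 * v + b) i' j' \<and> fresh i'"
proof -
  obtain k where k: "i \<le> k" "letter_labels (e k) = [Node]" "nodes i = nodes k" "ends i = ends k"
    "nodes (Suc k) = Suc (nodes i)" "ends (Suc k) = ends i" by (rule next_node[of i]) (use at v in \<open>auto simp: at_node_def\<close>)
  obtain f' where f': "moves\<^sup>*\<^sup>* (Path f, i, j) (Path f', k, j)" using skip_path k(1,3,4) by blast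
  have m: "moves (Path f', k, j) (Pair (2 - b), Suc k, j)"
    by (rule move1, rule delta.path_node) (use k b in auto)
  have p2: "\<And>l. 2 ^ Suc n \<le> nodes l \<Longrightarrow> nodes l < 2 ^ Suc (Suc n) \<Longrightarrow> ends l = Suc n \<Longrightarrow>
    \<exists>l'. moves\<^sup>*\<^sup>* (Pair (Suc t), Suc k, l) (Pair t, Suc k, l') \<and> nodes l' = Suc (nodes l) \<and> ends l' = Suc n" for t
  proof -
    fix l assume l: "2 ^ Suc n \<le> nodes l" "nodes l < 2 ^ Suc (Suc n)" "ends l = Suc n"
    obtain l' where "moves\<^sup>*\<^sup>* (Pair (Suc t), Suc k, l) (Pair t, Suc k, l')" "nodes l' = Suc (nodes l)" "ends l' = ends l"
      by (rule pass_node2[of l "Pair (Suc t)" "Pair t" "Suc k"]) (use l in \<open>auto intro: delta.pair_skip2 delta.pair_node2\<close>)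
    then show "\<exists>l'. moves\<^sup>*\<^sup>* (Pair (Suc t), Suc k, l) (Pair t, Suc k, l') \<and> nodes l' = Suc (nodes l) \<and> ends l' = Suc n"
      using l by auto
  qed
  have n2: "Suc 0 < 2 * 2 ^ n" using one_le_power[of "2::nat" n] by linarith
  have "\<exists>j1. moves\<^sup>*\<^sup>* (Pair (2 - b), Suc k, j) (Pair 0, Suc k, j1) \<and> nodes j1 = 2 ^ Suc n + (2 - b) \<and> ends j1 = Suc n"
  proof -
    have j: "nodes j = 2 ^ Suc n" "ends j = Suc n" using at by (auto simp: at_node_def)
    show ?thesis
    proof (cases "b = 0")
      case True
      obtain l where l: "moves\<^sup>*\<^sup>* (Pair (Suc (Suc 0)), Suc k, j) (Pair (Suc 0), Suc k, l)" "nodes l = Suc (nodes j)" "ends l = Suc n"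
        using p2[of j "Suc 0"] j by auto
      obtain l' where l': "moves\<^sup>*\<^sup>* (Pair (Suc 0), Suc k, l) (Pair 0, Suc k, l')" "nodes l' = Suc (nodes l)" "ends l' = Suc n"
        using p2[of l 0] j l n2 by auto
      have "moves\<^sup>*\<^sup>* (Pair (2 - b), Suc k, j) (Pair 0, Suc k, l')"
        using l(1) l'(1) True by (simp add: numeral_2_eq_2)
      then show ?thesis using l l' j True by (intro exI[of _ l']) auto
    next
      case False
      then have "b = 1" using b by simp
      then show ?thesis using p2[of j 0] j n2 by auto
    qed
  qed
  then obtain j1 where j1: "moves\<^sup>*\<^sup>* (Pair (2 - b), Suc k, j) (Pair 0, Suc k, j1)" "nodes j1 = 2 ^ Suc n + (2 - b)" "ends j1 = Suc n"
    by blast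
  define r where "r = 2 ^ n - Suc v"
  have r: "r + Suc v = 2 ^ n" using v by (simp add: r_def)
  have "\<exists>i' j'. moves\<^sup>*\<^sup>* (Pair 0, Suc k, j1) (Sync 0, i', j') \<and> ends i' = Suc n \<and> nodes i' = 2 ^ Suc n \<and> fresh i' \<and>
    ends j' = Suc n \<and> nodes j' + (2 * v + b) = 2 ^ Suc (Suc n) \<and> 2 ^ Suc n \<le> nodes j'"
    by (rule pair_phase[where k = r]) (use at k j1 r b in \<open>auto simp: at_node_def\<close>)
  then obtain i2 j2 where s2: "moves\<^sup>*\<^sup>* (Pair 0, Suc k, j1) (Sync 0, i2, j2)" "ends i2 = Suc n" "nodes i2 = 2 ^ Suc n" "fresh i2"
    "ends j2 = Suc n" "nodes j2 + (2 * v + b) = 2 ^ Suc (Suc n)" "2 ^ Suc n \<le> nodes j2" by blast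
  have "\<exists>i' j'. moves\<^sup>*\<^sup>* (Sync 0, i2, j2) (Path False, i', j') \<and> ends i' = Suc n \<and> nodes i' = nodes i2 + (2 * v + b) \<and> fresh i' \<and>
    ends j' = Suc (Suc n) \<and> nodes j' = 2 ^ Suc (Suc n)"
    by (rule sync_phase) (use s2 v b in auto)
  then obtain i3 j3 where s3: "moves\<^sup>*\<^sup>* (Sync 0, i2, j2) (Path False, i3, j3)" "ends i3 = Suc n" "nodes i3 = nodes i2 + (2 * v + b)" "fresh i3"
    "ends j3 = Suc (Suc n)" "nodes j3 = 2 ^ Suc (Suc n)" by blast
  have "moves\<^sup>+\<^sup>+ (Path f, i, j) (Pair (2 - b), Suc k, j)" using f' m by (rule rtranclp_into_tranclp1)
  then have "moves\<^sup>+\<^sup>+ (Path f, i, j) (Path False, i3, j3)" using j1(1) s2(1) s3(1) by (meson tranclp_rtranclp_tranclp)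
  then show ?thesis using s3 s2 by (intro exI[of _ i3] exI[of _ j3]) (simp add: at_node_def)
qed

text \<open>By \<open>fresh i\<close> the marks of node \<open>v\<close> lie at or after
  \<open>i\<close>, so head 1 can stop right after one of them.\<close>

lemma mark:
  assumes at: "at_node n v i j" and v: "v < 2 ^ n" and "fresh i" and G: "G (rounds_code x (Suc n)) v \<noteq> 0"
  shows "\<exists>i'. moves\<^sup>*\<^sup>* (Path f, i, j) (Path True, i', j) \<and> at_node n v i' j"
proof -
  obtain k where k: "letter_labels (e k) = [Mark]" "ends k = n" "nodes k = 2 ^ n + v" using ex_Mark[OF v G] by blast
  have "i \<le> k"
  proof (rule ccontr)
    assume "\<not> i \<le> k"
    then have i: "0 < i" "k \<le> i - 1" by auto
    then have "\<not> silent (e (i - 1))" using \<open>fresh i\<close> by (simp add: fresh_def)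
    moreover have "nodes k \<le> nodes (i - 1)" "ends k \<le> ends (i - 1)" using i by (auto intro: nodes_mono ends_mono)
    ultimately show False using nodes_Suc[of "i - 1"] ends_Suc[of "i - 1"] at k i by (auto simp: silent_def at_node_def)
  qed
  then obtain f' where f': "moves\<^sup>*\<^sup>* (Path f, i, j) (Path f', k, j)" using skip_path[of i k f j] at k by (auto simp: at_node_def)
  have "moves (Path f', k, j) (Path (letter_labels (e k) = [Mark]), Suc k, j)"
    by (rule move1, rule delta.path) (simp add: k silent_def)
  then have "moves\<^sup>*\<^sup>* (Path f, i, j) (Path True, Suc k, j)" using f' k by simp
  moreover have "at_node n v (Suc k) j" using at k by (simp add: at_node_def nodes_Suc ends_Suc)
  ultimately show ?thesis by blast
qed

lemma ends_le: "ends i \<le> i"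
  by (induction i) (auto simp: ends_Suc)

lemma complete_branch:
  assumes y: "y \<in> omega_words {0, 1}" and inf: "\<exists>\<^sub>\<infinity>n. G (rounds_code x (Suc n)) (binval y n) \<noteq> 0"
  shows "heads_accept delta Init final_states (\<lambda>i. (p i, e i)) e"
proof -
  \<comment> \<open>The configuration at the end of phase \<open>n\<close>: the node of the branch
    is reached, and if it is marked, a mark has just been read.\<close>
  define good where "good n c \<longleftrightarrow> (\<exists>f i j. c = (Path f, i, j) \<and> at_node n (binval y n) i j \<and>
    (G (rounds_code x (Suc n)) (binval y n) \<noteq> 0 \<longrightarrow> f))" for n c
  have arrive: "\<exists>c. moves\<^sup>*\<^sup>* (Path False, i, j) c \<and> good n c" if "at_node n (binval y n) i j" "fresh i" for n i j
    using mark[OF that(1) binval_less[OF y] that(2), of False] that(1) unfolding good_def by blast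
  have start: "\<exists>c. moves\<^sup>+\<^sup>+ (Init, 0, 0) c \<and> good 0 c"
  proof -
    obtain k where k: "letter_labels (e k) = [End]" "ends k = 0" "nodes k = 2" using ex_End[of 0] by auto
    have s: "moves\<^sup>*\<^sup>* (Seek, 0, 0) (Seek, 0, m)" if "m \<le> k" for m using that
    proof (induction m)
      case (Suc m)
      have "letter_labels (e m) \<noteq> [End]"
        using ends_mono[of "Suc m" k] Suc.prems k(2) by (auto simp: ends_Suc)
      then have "moves (Seek, 0, m) (Seek, 0, Suc m)" by (intro move2 delta.seek)
      then show ?case using Suc by (meson Suc_leD rtranclp.rtrancl_into_rtrancl)
    qed simp
    have "moves (Init, 0, 0) (Seek, 0, 0)" using delta.init_seek by (auto simp: head_step_def)
    moreover have "moves (Seek, 0, k) (Path False, 0, Suc k)" using k(1) by (intro move2 delta.seek_end)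
    ultimately have "moves\<^sup>+\<^sup>+ (Init, 0, 0) (Path False, 0, Suc k)" using s[of k] by (meson le_refl rtranclp.rtrancl_into_rtrancl rtranclp_into_tranclp2)
    moreover have "at_node 0 (binval y 0) 0 (Suc k)" "fresh 0" using k by (auto simp: at_node_def fresh_def nodes_Suc ends_Suc)
    ultimately show ?thesis using arrive[of 0 0 "Suc k"] by (meson tranclp_rtranclp_tranclp)
  qed
  have next_level: "\<exists>c'. moves\<^sup>+\<^sup>+ c c' \<and> good (Suc n) c'" if g: "good n c" for n c
  proof -
    obtain f i j where c: "c = (Path f, i, j)" "at_node n (binval y n) i j" using g unfolding good_def by blast
    obtain i' j' where ij: "moves\<^sup>+\<^sup>+ c (Path False, i', j')" "at_node (Suc n) (binval y (Suc n)) i' j'" "fresh i'"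
      using child[OF c(2) binval_less[OF y] omega_wordsD[OF y], of f n] unfolding c(1) by auto
    then show ?thesis using arrive[OF ij(2,3)] by (meson tranclp_rtranclp_tranclp)
  qed
  obtain c0 where c0: "moves\<^sup>+\<^sup>+ (Init, 0, 0) c0" "good 0 c0" using start by blast
  obtain d where d: "d 0 = c0" "\<And>n. good n (d n)" "\<And>n. moves\<^sup>+\<^sup>+ (d n) (d (Suc n))"
  proof -
    have "\<exists>d. \<forall>n. (good n (d n) \<and> (n = 0 \<longrightarrow> d n = c0)) \<and> moves\<^sup>+\<^sup>+ (d n) (d (Suc n))"
    proof (rule dependent_nat_choice)
      show "\<exists>c. good 0 c \<and> (0 = 0 \<longrightarrow> c = c0)" using c0 by blast
      show "\<exists>c'. (good (Suc n) c' \<and> (Suc n = 0 \<longrightarrow> c' = c0)) \<and> moves\<^sup>+\<^sup>+ c c'" if "good n c \<and> (n = 0 \<longrightarrow> c = c0)" for c n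
        using next_level that by blast
    qed
    then show thesis using that by blast
  qed
  define c where "c n = (case n of 0 \<Rightarrow> (Init, 0, 0) | Suc m \<Rightarrow> d m)" for n
  \<comment> \<open>Each phase takes both heads to the next level, which makes their positions
    unbounded.\<close>
  have big: "n \<le> fst (snd (d n)) \<and> n \<le> snd (snd (d n))" for n
  proof -
    obtain f i j where "d n = (Path f, i, j)" "at_node n (binval y n) i j" using d(2) unfolding good_def by blast
    then show ?thesis using ends_le[of i] ends_le[of j] by (simp add: at_node_def)
  qed
  show ?thesis
  proof (rule heads_accept_chain)
    show "moves\<^sup>+\<^sup>+ (c n) (c (Suc n))" for n using c0 d by (cases n) (auto simp: c_def)
    show "c 0 = (Init, 0, 0)" by (simp add: c_def)
    show "\<exists>\<^sub>\<infinity>n. fst (c n) \<in> final_states" unfolding INFM_nat_le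
    proof
      fix m
      obtain n where n: "n \<ge> m" "G (rounds_code x (Suc n)) (binval y n) \<noteq> 0" using inf unfolding INFM_nat_le by blast
      then have "fst (c (Suc n)) = Path True" using d(2)[of n] by (auto simp: c_def good_def)
      then show "\<exists>n\<ge>m. fst (c n) \<in> final_states" using n by (intro exI[of _ "Suc n"]) (auto simp: final_states_def)
    qed
    show "\<exists>n. m \<le> fst (snd (c n))" "\<exists>n. m \<le> snd (snd (c n))" for m
      using big[of m] by (auto simp: c_def intro!: exI[of _ "Suc m"])
  qed
qed

end

section \<open>Completeness for errors: every incorrect run is accepted\<close>

context machine
begin

lemma step1: "delta q (Some (p i, e i)) None q' \<Longrightarrow> head_step delta (\<lambda>i. (p i, e i)) e' (q, i, j) (q', Suc i, j)"
  by (auto simp: head_step_def)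

lemma step2: "delta q None (Some (e' j)) q' \<Longrightarrow> head_step delta U e' (q, i, j) (q', i, Suc j)"
  by (auto simp: head_step_def)

lemma step12: "delta q (Some (p i, e i)) (Some (e' j)) q' \<Longrightarrow>
    head_step delta (\<lambda>i. (p i, e i)) e' (q, i, j) (q', Suc i, Suc j)"
  by (auto simp: head_step_def)

definition errs :: "(nat \<Rightarrow> nat) \<Rightarrow> (nat \<Rightarrow> letter) \<Rightarrow> (nat \<Rightarrow> letter) \<Rightarrow> state \<times> nat \<times> nat \<Rightarrow> bool" where
  "errs p e e' c \<longleftrightarrow> (\<exists>i j. (head_step delta (\<lambda>i. (p i, e i)) e')\<^sup>*\<^sup>* c (Err, i, j))"

lemma errs_Err: "errs p e e' (Err, i, j)"
  unfolding errs_def by blast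

lemma errs_step: "head_step delta (\<lambda>i. (p i, e i)) e' c c' \<Longrightarrow> errs p e e' c' \<Longrightarrow> errs p e e' c"
  unfolding errs_def by (meson converse_rtranclp_into_rtranclp)

lemma reach_Start: "(head_step delta (\<lambda>i. (p i, e i)) e')\<^sup>*\<^sup>* (Init, 0, 0) (Start, n, n)"
proof (induction n)
  case 0
  show ?case using delta.init by (intro r_into_rtranclp) (auto simp: head_step_def)
next
  case (Suc n)
  then show ?case using step12[where i = n and j = n, OF delta.start] by (meson rtranclp.rtrancl_into_rtrancl)
qed

lemma accept_Start:
  assumes "errs p e e' (Start, n, n) \<or> errs p e e' (Init, 0, 0)"
  shows "heads_accept delta Init final_states (\<lambda>i. (p i, e i)) e'"
proof -
  let ?R = "head_step delta (\<lambda>i. (p i, e i)) e'"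
  obtain i j where ij: "?R\<^sup>*\<^sup>* (Init, 0, 0) (Err, i, j)"
    using assms reach_Start[of p e e' n] unfolding errs_def by (meson rtranclp_trans)
  then have ij: "?R\<^sup>+\<^sup>+ (Init, 0, 0) (Err, i, j)" by (metis rtranclpD prod.inject state.distinct(13))
  define c where "c n = (case n of 0 \<Rightarrow> (Init, 0, 0) | Suc m \<Rightarrow> (Err, i + m, j + m))" for n
  show ?thesis
  proof (rule heads_accept_chain)
    show "?R\<^sup>+\<^sup>+ (c n) (c (Suc n))" for n
    proof (cases n)
      case 0
      then show ?thesis using ij by (simp add: c_def)
    next
      case (Suc m)
      then show ?thesis using step12[where i = "i + m" and j = "j + m", OF delta.err] by (auto simp: c_def)
    qed
    show "c 0 = (Init, 0, 0)" by (simp add: c_def)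
    show "\<exists>\<^sub>\<infinity>n. fst (c n) \<in> final_states" unfolding INFM_nat_le
    proof
      fix m
      have "fst (c (Suc m)) \<in> final_states" by (simp add: c_def final_states_def)
      then show "\<exists>n\<ge>m. fst (c n) \<in> final_states" by (intro exI[of _ "Suc m"]) simp
    qed
    show "\<exists>n. m \<le> fst (snd (c n))" "\<exists>n. m \<le> snd (snd (c n))" for m
      by (auto simp: c_def intro!: exI[of _ "Suc m"])
  qed
qed

context
  fixes p :: "nat \<Rightarrow> nat" and e :: "nat \<Rightarrow> letter"
  assumes inf: "\<exists>\<^sub>\<infinity>i. is_Pc (e i)"
begin

lemma Tick_distance: "e h = Tick i \<Longrightarrow> next_pc e (Suc h) - Suc h < next_pc e h - h"
  using next_pc_Tick[of e h i] next_pc(1)[OF inf, of "Suc h"] by simp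

lemma errs_Rest1: "ticks e k h > 0 \<Longrightarrow> errs p e e (Rest1 k, h, j)"
proof (induction "next_pc e h - h" arbitrary: h rule: less_induct)
  case less
  show ?case
  proof (cases "e h")
    case (Pc K)
    then show ?thesis using less.prems by (simp add: ticks_Pc)
  next
    case (Tick i)
    show ?thesis
    proof (cases "i = k")
      case True
      show ?thesis by (rule errs_step[OF step1[where q' = Err] errs_Err]) (use Tick True in \<open>auto intro: delta.rest1_err\<close>)
    next
      case False
      show ?thesis
        by (rule errs_step[OF step1[where q' = "Rest1 k"] less.hyps])
          (use Tick False less.prems ticks_Tick[OF inf Tick, of k] Tick_distance[OF Tick] in \<open>auto intro: delta.rest1_skip\<close>)
    qed
  qed
qed

lemma errs_Rest2: "ticks e k j > 0 \<Longrightarrow> errs p e e (Rest2 k, h, j)"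
proof (induction "next_pc e j - j" arbitrary: j rule: less_induct)
  case less
  show ?case
  proof (cases "e j")
    case (Pc K)
    then show ?thesis using less.prems by (simp add: ticks_Pc)
  next
    case (Tick i)
    show ?thesis
    proof (cases "i = k")
      case True
      show ?thesis by (rule errs_step[OF step2[where q' = Err] errs_Err]) (use Tick True in \<open>auto intro: delta.rest2_err\<close>)
    next
      case False
      show ?thesis
        by (rule errs_step[OF step2[where q' = "Rest2 k"] less.hyps])
          (use Tick False less.prems ticks_Tick[OF inf Tick, of k] Tick_distance[OF Tick] in \<open>auto intro: delta.rest2_skip\<close>)
    qed
  qed
qed

text \<open>Every move shortens the unread rest of one of the two lines. The discrepancy survives
  until a head meets the end of its line, where it shows as a missing tick or as a surplus tick
  under the other head.\<close>

lemma errs_Cmp: "ticks e k h \<noteq> apply_mode m (ticks e k j) \<Longrightarrow> errs p e e (Cmp m k, h, j)"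
proof (induction "(next_pc e h - h) + (next_pc e j - j)" arbitrary: m h j rule: less_induct)
  case less
  consider (skip1) i where "e h = Tick i" "i \<noteq> k" | (skip2) i where "e j = Tick i" "i \<noteq> k"
    | (TT) "e h = Tick k" "e j = Tick k" | (TP) K where "e h = Tick k" "e j = Pc K"
    | (PT) K where "e h = Pc K" "e j = Tick k" | (PP) K K' where "e h = Pc K" "e j = Pc K'"
    by (metis letter.exhaust)
  then show ?case
  proof cases
    case skip1
    show ?thesis
      by (rule errs_step[OF step1[where q' = "Cmp m k"] less.hyps])
        (use skip1 less.prems ticks_Tick[OF inf skip1(1), of k] Tick_distance[OF skip1(1)] in \<open>auto intro: delta.cmp_skip1\<close>)
  next
    case skip2
    show ?thesis
      by (rule errs_step[OF step2[where q' = "Cmp m k"] less.hyps])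
        (use skip2 less.prems ticks_Tick[OF inf skip2(1), of k] Tick_distance[OF skip2(1)] in \<open>auto intro: delta.cmp_skip2\<close>)
  next
    case TT
    note t = ticks_Tick[OF inf TT(1), of k] ticks_Tick[OF inf TT(2), of k] Tick_distance[OF TT(1)] Tick_distance[OF TT(2)]
    show ?thesis
    proof (cases m)
      case Same
      show ?thesis unfolding Same
        by (rule errs_step[OF step12[where q' = "Cmp Same k"] less.hyps])
          (use Same TT less.prems t in \<open>auto intro: delta.cmp_same\<close>)
    next
      case Up
      show ?thesis unfolding Up
        by (rule errs_step[OF step1[where q' = "Cmp Same k"] less.hyps])
          (use Up TT less.prems t in \<open>auto intro: delta.cmp_up\<close>)
    next
      case Down
      show ?thesis unfolding Down
        by (rule errs_step[OF step2[where q' = "Cmp Same k"] less.hyps])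
          (use Down TT less.prems t in \<open>auto intro: delta.cmp_down\<close>)
    qed
  next
    case (TP K)
    note t = ticks_Tick[OF inf TP(1), of k] ticks_Pc[of e j, OF TP(2), of k] Tick_distance[OF TP(1)]
    show ?thesis
    proof (cases m)
      case Same
      show ?thesis unfolding Same
        by (rule errs_step[OF step2[where q' = "Rest1 k"] errs_Rest1])
          (use Same TP less.prems t in \<open>auto intro: delta.cmp_end2\<close>)
    next
      case Up
      show ?thesis unfolding Up
        by (rule errs_step[OF step1[where q' = "Cmp Same k"] less.hyps])
          (use Up TP less.prems t in \<open>auto intro: delta.cmp_up\<close>)
    next
      case Down
      show ?thesis unfolding Down
        by (rule errs_step[OF step2[where q' = "Rest1 k"] errs_Rest1])
          (use Down TP less.prems t in \<open>auto intro: delta.cmp_down_end\<close>)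
    qed
  next
    case (PT K)
    note t = ticks_Tick[OF inf PT(2), of k] ticks_Pc[of e h, OF PT(1), of k] Tick_distance[OF PT(2)]
    show ?thesis
    proof (cases m)
      case Same
      show ?thesis unfolding Same
        by (rule errs_step[OF step1[where q' = "Rest2 k"] errs_Rest2])
          (use Same PT less.prems t in \<open>auto intro: delta.cmp_end1\<close>)
    next
      case Up
      show ?thesis unfolding Up
        by (rule errs_step[OF step1[where q' = Err] errs_Err]) (use PT in \<open>auto intro: delta.cmp_up_err\<close>)
    next
      case Down
      show ?thesis unfolding Down
        by (rule errs_step[OF step2[where q' = "Cmp Same k"] less.hyps])
          (use Down PT less.prems t in \<open>auto intro: delta.cmp_down\<close>)
    qed
  next
    case (PP K K')
    have m: "m = Up" using less.prems ticks_Pc[of e h, OF PP(1), of k] ticks_Pc[of e j, OF PP(2), of k] by (cases m) auto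
    show ?thesis unfolding m
      by (rule errs_step[OF step1[where q' = Err] errs_Err]) (use PP in \<open>auto intro: delta.cmp_up_err\<close>)
  qed
qed

lemma errs_Skip:
  "errs p e e (Cmp (mode_of K k) k, Suc (next_pc e h), j) \<Longrightarrow> errs p e e (Skip K k, h, j)"
proof (induction "next_pc e h - h" arbitrary: h rule: less_induct)
  case less
  show ?case
  proof (cases "e h")
    case (Pc K')
    show ?thesis
      by (rule errs_step[OF step1 less.prems[unfolded next_pc_Pc[of e h, OF Pc]]]) (use Pc in \<open>auto intro: delta.skip_end\<close>)
  next
    case (Tick i)
    show ?thesis
      by (rule errs_step[OF step1[where q' = "Skip K k"] less.hyps])
        (use Tick less.prems next_pc_Tick[of e h i] Tick_distance[OF Tick] in \<open>auto intro: delta.skip_tick\<close>)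
  qed
qed

lemma errs_Line:
  "e (next_pc e h) = Pc K' \<Longrightarrow> \<not> succ_cont K (\<not> (z \<or> ticks e (test_reg K) h > 0)) K' \<Longrightarrow> errs p e e (Line K z, h, j)"
proof (induction "next_pc e h - h" arbitrary: h z rule: less_induct)
  case less
  show ?case
  proof (cases "e h")
    case (Pc K'')
    show ?thesis
      by (rule errs_step[OF step1[where q' = Err] errs_Err])
        (use Pc less.prems next_pc_Pc[of e h, OF Pc] ticks_Pc[of e h, OF Pc] in \<open>auto intro: delta.line_err\<close>)
  next
    case (Tick i)
    have "errs p e e (Line K (z \<or> i = test_reg K), Suc h, j)"
      by (rule less.hyps)
        (use Tick less.prems next_pc_Tick[of e h i] Tick_distance[OF Tick] ticks_Tick[OF inf Tick, of "test_reg K"] in \<open>auto split: if_splits\<close>)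
    then show ?thesis
      by (rule errs_step[OF step1[where q' = "Line K (z \<or> i = test_reg K)"], rotated])
        (use Tick in \<open>auto intro: delta.line_tick[unfolded]\<close>)
  qed
qed

end

text \<open>Either the tapes differ at some position, or no line begins from some point on, or a
  local clause of \<open>correct\<close> fails. The second case has no finite witness; it is
  accepted in \<open>Stuck\<close> by never reading a \<open>Pc\<close> again.\<close>

lemma complete_error:
  assumes alph: "\<And>i. e i \<in> alphabet" and wrong: "\<not> (e = e' \<and> correct p e)"
  shows "heads_accept delta Init final_states (\<lambda>i. (p i, e i)) e'"
proof (cases "e = e'")
  case False
  then obtain n where "e n \<noteq> e' n" by auto
  then have "errs p e e' (Start, n, n)"
    by (intro errs_step[OF step12[where q' = Err] errs_Err] delta.copy_err)
  then show ?thesis using accept_Start by blast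
next
  case eq: True
  show ?thesis
  proof (cases "\<exists>\<^sub>\<infinity>i. is_Pc (e i)")
    case False
    then obtain n where n: "\<And>i. i \<ge> n \<Longrightarrow> \<not> is_Pc (e i)" unfolding INFM_nat_le by blast
    let ?R = "head_step delta (\<lambda>i. (p i, e i)) e'"
    have "?R (Start, n, n) (Stuck, n, n)" using delta.stuck_guess by (auto simp: head_step_def)
    then have first: "?R\<^sup>+\<^sup>+ (Init, 0, 0) (Stuck, n, n)" using reach_Start by (meson rtranclp_into_tranclp1)
    define c where "c k = (case k of 0 \<Rightarrow> (Init, 0, 0) | Suc m \<Rightarrow> (Stuck, n + m, n + m))" for k
    show ?thesis
    proof (rule heads_accept_chain)
      show "?R\<^sup>+\<^sup>+ (c k) (c (Suc k))" for k
      proof (cases k)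
        case 0
        then show ?thesis using first by (simp add: c_def)
      next
        case (Suc m)
        have "?R (Stuck, n + m, n + m) (Stuck, Suc (n + m), Suc (n + m))"
          by (rule step12[OF delta.stuck]) (simp add: n)
        then show ?thesis by (auto simp: c_def Suc)
      qed
      show "c 0 = (Init, 0, 0)" by (simp add: c_def)
      show "\<exists>\<^sub>\<infinity>n. fst (c n) \<in> final_states" unfolding INFM_nat_le
      proof
        fix m
        have "fst (c (Suc m)) \<in> final_states" by (simp add: c_def final_states_def)
        then show "\<exists>n\<ge>m. fst (c n) \<in> final_states" by (intro exI[of _ "Suc m"]) simp
      qed
      show "\<exists>n. m \<le> fst (snd (c n))" "\<exists>n. m \<le> snd (snd (c n))" for m
        by (auto simp: c_def intro!: exI[of _ "Suc m"])
    qed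
  next
    case inf: True
    have "errs p e e (Init, 0, 0) \<or> (\<exists>n. errs p e e (Start, n, n))"
    proof (rule ccontr)
      assume no: "\<not> ?thesis"
      have "e 0 = Pc start"
      proof (rule ccontr)
        assume "e 0 \<noteq> Pc start"
        then have "errs p e e (Init, 0, 0)"
          by (intro errs_step[OF step1[where q' = Err] errs_Err] delta.init_err)
        then show False using no by blast
      qed
      moreover have "p i = c" if "letter_labels (e i) = [In c d]" for i c d
      proof (rule ccontr)
        assume "p i \<noteq> c"
        then have "errs p e e (Start, i, i)"
          by (intro errs_step[OF step1[where q' = Err] errs_Err] delta.in_err[OF that])
        then show False using no by blast
      qed
      moreover have "\<exists>K'. e (next_pc e (Suc i)) = Pc K' \<and> succ_cont K (ticks e (test_reg K) (Suc i) = 0) K'" if K: "e i = Pc K" for i K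
      proof -
        obtain K' where K': "e (next_pc e (Suc i)) = Pc K'" using next_pc(2)[OF inf, of "Suc i"] by (cases "e (next_pc e (Suc i))") auto
        have "succ_cont K (ticks e (test_reg K) (Suc i) = 0) K'"
        proof (rule ccontr)
          assume "\<not> ?thesis"
          then have "errs p e e (Line K False, Suc i, i)" by (intro errs_Line[OF inf K']) simp
          then have "errs p e e (Start, i, i)"
            by (rule errs_step[OF step1, rotated]) (simp add: K delta.line_start)
          then show False using no by blast
        qed
        then show ?thesis using K' by blast
      qed
      moreover have "ticks e j (Suc (next_pc e (Suc i))) = upd_reg K j (ticks e j (Suc i))" if K: "e i = Pc K" for i K j
      proof (rule ccontr)
        assume neq: "\<not> ?thesis"
        \<comment> \<open>The acceptor compares only registers below \<open>reg_bound\<close>; a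
          larger one has no tick in the alphabet and is changed by no continuation in
          \<open>pcs\<close>, so it cannot cause the failure.\<close>
        have "j < reg_bound"
        proof (rule ccontr)
          assume j: "\<not> j < reg_bound"
          then have "e m \<noteq> Tick j" for m using alph[of m] by (auto simp: alphabet_def)
          then have "ticks e j h = 0" for h by (simp add: ticks_def)
          moreover have "K \<in> pcs" using alph[of i] K by (auto simp: alphabet_def)
          then have "touched K < j" using reg_bound(1) j by (meson less_le_trans not_le)
          ultimately show False using neq upd_reg_untouched by simp
        qed
        have "errs p e e (Cmp (mode_of K j) j, Suc (next_pc e (Suc i)), Suc i)"
          using neq by (intro errs_Cmp[OF inf]) (simp add: apply_mode_of)
        then have "errs p e e (Skip K j, Suc i, Suc i)" by (rule errs_Skip[OF inf])
        then have "errs p e e (Start, i, i)"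
          by (rule errs_step[OF step12, rotated]) (simp add: K delta.skip_start \<open>j < reg_bound\<close>)
        then show False using no by blast
      qed
      ultimately have "correct p e" unfolding correct_def well_formed_def using inf by blast
      then show False using wrong eq by blast
    qed
    then show ?thesis using accept_Start eq by blast
  qed
qed

end

section \<open>Plays against a fixed behaviour\<close>

primrec history :: "(('a \<times> 'a) list \<Rightarrow> 'a) \<Rightarrow> (('a \<times> 'a) list \<Rightarrow> 'a \<Rightarrow> 'a) \<Rightarrow> nat \<Rightarrow> ('a \<times> 'a) list" where
  "history \<sigma> \<tau> 0 = []"
| "history \<sigma> \<tau> (Suc n) = history \<sigma> \<tau> n @ [(\<sigma> (history \<sigma> \<tau> n), \<tau> (history \<sigma> \<tau> n) (\<sigma> (history \<sigma> \<tau> n)))]"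

definition play :: "(('a \<times> 'a) list \<Rightarrow> 'a) \<Rightarrow> (('a \<times> 'a) list \<Rightarrow> 'a \<Rightarrow> 'a) \<Rightarrow> 'a word" where
  "play \<sigma> \<tau> i = (let h = history \<sigma> \<tau> (i div 2) in if even i then \<sigma> h else \<tau> h (\<sigma> h))"

lemma play_even: "play \<sigma> \<tau> (2 * n) = \<sigma> (history \<sigma> \<tau> n)"
  and play_odd: "play \<sigma> \<tau> (Suc (2 * n)) = \<tau> (history \<sigma> \<tau> n) (\<sigma> (history \<sigma> \<tau> n))"
  by (simp_all add: play_def Let_def)

lemma rounds_Suc: "rounds z (Suc n) = rounds z n @ [(z (2 * n), z (Suc (2 * n)))]"
  by (simp add: rounds_def)

lemma rounds_play: "rounds (play \<sigma> \<tau>) n = history \<sigma> \<tau> n"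
proof (induction n)
  case (Suc n)
  then show ?case by (simp add: rounds_Suc play_even play_odd)
qed (simp add: rounds_def)

lemma follows1_play: "follows1 \<sigma> (play \<sigma> \<tau>)"
  by (simp add: follows1_def rounds_play play_even)

lemma follows2_play: "follows2 \<tau> (play \<sigma> \<tau>)"
  by (simp add: follows2_def rounds_play play_even play_odd)

lemma play_in_omega_words:
  assumes "\<And>n. history \<sigma> \<tau> n \<in> lists (Y \<times> Y) \<Longrightarrow>
    \<sigma> (history \<sigma> \<tau> n) \<in> Y \<and> \<tau> (history \<sigma> \<tau> n) (\<sigma> (history \<sigma> \<tau> n)) \<in> Y"
  shows "play \<sigma> \<tau> \<in> omega_words Y"
proof -
  have h: "history \<sigma> \<tau> n \<in> lists (Y \<times> Y)" for n
    by (induction n) (use assms in auto)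
  have "play \<sigma> \<tau> i \<in> Y" for i using assms[OF h, of "i div 2"] by (simp add: play_def Let_def)
  then show ?thesis by (auto simp: omega_words_def)
qed

text \<open>The number of rounds of the embedded play that are read before position
  \<open>i\<close>; it links positions of the new play with rounds of the original one.\<close>

definition reads :: "(nat \<Rightarrow> letter) \<Rightarrow> nat \<Rightarrow> nat" where
  "reads e i = length (filter is_In (concat (map (\<lambda>i. letter_labels (e i)) [0..<i])))"

definition is_read :: "letter \<Rightarrow> bool" where
  "is_read a \<longleftrightarrow> (\<exists>c d. letter_labels a = [In c d])"

lemma reads_0 [simp]: "reads e 0 = 0"
  by (simp add: reads_def)

lemma reads_Suc: "reads e (Suc i) = reads e i + (if is_read (e i) then 1 else 0)"
proof -
  have "length (filter is_In (letter_labels a)) = (if is_read a then 1 else 0)" for a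
  proof (cases "letter_labels a")
    case (Cons l ls)
    have "length (letter_labels a) \<le> 1" using length_labels by (cases a) auto
    then have "letter_labels a = [l]" using Cons by simp
    then show ?thesis by (cases l) (auto simp: is_read_def)
  qed (simp add: is_read_def)
  then show ?thesis by (simp add: reads_def)
qed

lemma reads_mono: "i \<le> j \<Longrightarrow> reads e i \<le> reads e j"
  by (rule lift_Suc_mono_le[of "reads e"]) (auto simp: reads_Suc)

lemma reads_cong: "(\<And>k. k < i \<Longrightarrow> e k = e' k) \<Longrightarrow> reads e i = reads e' i"
  by (induction i) (auto simp: reads_Suc)

lemma label_stream_read:
  assumes "label_stream G x (\<lambda>i. letter_labels (e i))" "letter_labels (e i) = [In c d]"
  shows "x (2 * reads e i) = c \<and> x (Suc (2 * reads e i)) = d"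
proof -
  interpret stream G x "\<lambda>i. letter_labels (e i)" by unfold_locales (rule assms(1))
  show ?thesis using In_letters[OF assms(2)] by (simp add: ins_def labs_def reads_def)
qed

lemma label_stream_ex_read:
  assumes "label_stream G x (\<lambda>i. letter_labels (e i))"
  obtains i c d where "letter_labels (e i) = [In c d]" "reads e i = n"
proof -
  interpret stream G x "\<lambda>i. letter_labels (e i)" by unfold_locales (rule assms(1))
  show thesis using ex_In[of n] that by (auto simp: ins_def labs_def reads_def)
qed

section \<open>The honest second player\<close>

type_synonym writer = "letter list \<times> com list \<times> store \<times> nat"

context machine
begin

definition tick_word :: "store \<Rightarrow> letter list" where
  "tick_word s = concat (map (\<lambda>j. replicate (s j) (Tick j)) [0..<reg_bound])"

lemma count_tick_word: "count_list (tick_word s) (Tick j) = (if j < reg_bound then s j else 0)"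
proof -
  have "count_list (concat (map (\<lambda>j. replicate (s j) (Tick j)) [0..<n])) (Tick j) = (if j < n then s j else 0)" for n
  proof (induction n)
    case (Suc n)
    have "count_list (replicate m (Tick n)) (Tick j) = (if n = j then m else 0)" for m
      by (induction m) auto
    then show ?case using Suc by auto
  qed simp
  then show ?thesis by (simp add: tick_word_def)
qed

text \<open>
  The components are the rest of the current line, the current configuration, and the number of
  rounds of the original game played so far; \<open>d\<close> supplies the moves of Player 2 in that game.
\<close>

fun emit :: "(nat \<Rightarrow> nat) \<Rightarrow> nat \<Rightarrow> writer \<Rightarrow> letter \<times> writer" where
  "emit d c (a # l, K, s, m) = (a, l, K, s, m)"
| "emit d c ([], K, s, m) =
    (let K' = if K = [] then entry c (d m) else next_cont K (s (test_reg K) = 0);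
         s' = \<lambda>j. upd_reg K j (s j)
     in (Pc K', tick_word s', K', s', if K = [] then Suc m else m))"

definition writer_start :: writer where
  "writer_start = ([Pc start], start, \<lambda>_. 0, 0)"

text \<open>After the first letter, the pending letters are the unwritten ticks of the current line.
  So the counts on the tape agree with the store of the writer, from which it computes the next
  line.\<close>

lemma honest_correct:
  assumes st0: "st 0 = writer_start" and stS: "\<And>i. st (Suc i) = snd (emit d (c i) (st i))"
    and e: "\<And>i. e i = fst (emit d (c i) (st i))" and c: "\<And>i. c i \<in> X" and d: "\<And>i. d i \<in> X"
  shows "correct c e" "e i \<in> alphabet" "letter_labels (e i) = [In c' d'] \<Longrightarrow> d' = d (reads e i)"
    "snd (snd (snd (st i))) = reads e i"
proof -
  define pend cont store cnt where "pend i = fst (st i)" and "cont i = fst (snd (st i))"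
    and "store i = fst (snd (snd (st i)))" and "cnt i = snd (snd (snd (st i)))" for i
  have st: "st i = (pend i, cont i, store i, cnt i)" for i by (simp add: pend_def cont_def store_def cnt_def)
  have invariant: "set (pend i) \<subseteq> alphabet \<and> cont i \<in> pcs \<and> (\<forall>j\<ge>reg_bound. store i j = 0)" for i
  proof (induction i)
    case 0
    have "pend 0 = [Pc start]" "cont 0 = start" "store 0 = (\<lambda>_. 0)"
      by (simp_all add: pend_def cont_def store_def st0 writer_start_def)
    then show ?case using start_pcs by (simp add: alphabet_def)
  next
    case (Suc i)
    show ?case
    proof (cases "pend i")
      case Nil
      define K' where "K' = (if cont i = [] then entry (c i) (d (cnt i)) else next_cont (cont i) (store i (test_reg (cont i)) = 0))"
      have S: "pend (Suc i) = tick_word (\<lambda>j. upd_reg (cont i) j (store i j))" "cont (Suc i) = K'"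
        "store (Suc i) = (\<lambda>j. upd_reg (cont i) j (store i j))"
        using stS[of i] st[of i] st[of "Suc i"] Nil by (auto simp: Let_def K'_def)
      have "K' \<in> pcs" using Suc entry_pcs[OF c d] next_pcs by (auto simp: K'_def)
      moreover have "touched (cont i) < reg_bound" using reg_bound(1) Suc by blast
      ultimately show ?thesis unfolding S using Suc
        by (auto simp: tick_word_def alphabet_def upd_reg_untouched split: if_splits)
    next
      case (Cons a l)
      then show ?thesis using stS[of i] st[of i] st[of "Suc i"] Suc by auto
    qed
  qed
  have e_Cons: "e i = a \<and> pend (Suc i) = l \<and> cont (Suc i) = cont i \<and> store (Suc i) = store i \<and> cnt (Suc i) = cnt i"
    if "pend i = a # l" for i a l
    using that e[of i] stS[of i] st[of i] st[of "Suc i"] by simp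
  have e_Nil: "e i = Pc (cont (Suc i)) \<and>
      cont (Suc i) = (if cont i = [] then entry (c i) (d (cnt i)) else next_cont (cont i) (store i (test_reg (cont i)) = 0)) \<and>
      store (Suc i) = (\<lambda>j. upd_reg (cont i) j (store i j)) \<and> pend (Suc i) = tick_word (store (Suc i)) \<and>
      cnt (Suc i) = (if cont i = [] then Suc (cnt i) else cnt i)"
    if "pend i = []" for i
    using that e[of i] stS[of i] st[of i] st[of "Suc i"] by (simp add: Let_def)
  show al: "e i \<in> alphabet" for i
  proof (cases "pend i")
    case Nil
    then show ?thesis using e_Nil[of i] invariant[of "Suc i"] by (auto simp: alphabet_def)
  next
    case (Cons a l)
    then show ?thesis using e_Cons[of i a l] invariant[of i] by auto
  qed
  have zero: "e 0 = Pc start" "pend (Suc 0) = []" "cont (Suc 0) = start" "store (Suc 0) = (\<lambda>_. 0)"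
    using e[of 0] stS[of 0] st[of "Suc 0"] by (auto simp: st0 writer_start_def)
  have only_ticks: "set (pend (Suc i)) \<subseteq> range Tick" for i
  proof (induction i)
    case (Suc i)
    then show ?case using e_Nil[of "Suc i"] e_Cons[of "Suc i"]
      by (cases "pend (Suc i)") (auto simp: tick_word_def split: if_splits)
  qed (simp add: zero)
  have ex_Nil: "\<exists>k\<ge>i. pend k = []" for i
  proof (induction "pend i" arbitrary: i)
    case (Cons a l)
    then have "pend (Suc i) = l" using e_Cons[of i a l] by simp
    then show ?case using Cons.hyps(1)[of "Suc i"] Suc_leD by blast
  qed auto
  have inf: "\<exists>\<^sub>\<infinity>i. is_Pc (e i)" unfolding INFM_nat_le
  proof
    fix i
    obtain k where "k \<ge> i" "pend k = []" using ex_Nil by blast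
    then show "\<exists>k\<ge>i. is_Pc (e k)" using e_Nil[of k] by (intro exI[of _ k]) simp
  qed
  have line: "(\<forall>j. ticks e j (Suc i) = count_list (pend (Suc i)) (Tick j)) \<and>
    st (next_pc e (Suc i)) = ([], cont (Suc i), store (Suc i), cnt (Suc i))" for i
  proof (induction "pend (Suc i)" arbitrary: i)
    case Nil
    then have "e (Suc i) = Pc (cont (Suc (Suc i)))" using e_Nil[of "Suc i"] by simp
    then have "next_pc e (Suc i) = Suc i" "ticks e j (Suc i) = 0" for j
      using next_pc_Pc[of e "Suc i"] ticks_Pc[of e "Suc i"] by auto
    then show ?case using Nil st[of "Suc i"] by simp
  next
    case (Cons a l)
    then obtain r where r: "a = Tick r" using only_ticks[of i] by (metis imageE insert_subset list.set(2))
    have n: "e (Suc i) = Tick r" "pend (Suc (Suc i)) = l" "cont (Suc (Suc i)) = cont (Suc i)"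
      "store (Suc (Suc i)) = store (Suc i)" "cnt (Suc (Suc i)) = cnt (Suc i)"
      using e_Cons[of "Suc i" a l] Cons.hyps(2) r by auto
    show ?case using Cons.hyps(1)[of "Suc i"] n Cons.hyps(2)[symmetric] r
      ticks_Tick[OF inf n(1)] next_pc_Tick[of e "Suc i" r] by auto
  qed
  have after: "cont (Suc i) = K \<and> (\<forall>j. count_list (pend (Suc i)) (Tick j) = store (Suc i) j)" if "e i = Pc K" for i K
  proof (cases i)
    case 0
    then show ?thesis using that zero by auto
  next
    case (Suc k)
    have "pend i = []"
    proof (cases "pend i")
      case (Cons a l)
      then show ?thesis using e_Cons[of i a l] that only_ticks[of k] Suc by auto
    qed
    then show ?thesis using e_Nil[of i] that invariant[of "Suc i"] by (auto simp: count_tick_word)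
  qed
  have next_line: "e (next_pc e (Suc i)) = Pc (cont (Suc (next_pc e (Suc i)))) \<and>
      cont (Suc (next_pc e (Suc i))) = (if K = [] then entry (c (next_pc e (Suc i))) (d (cnt (next_pc e (Suc i))))
        else next_cont K (ticks e (test_reg K) (Suc i) = 0)) \<and>
      (\<forall>j. ticks e j (Suc (next_pc e (Suc i))) = upd_reg K j (ticks e j (Suc i))) \<and>
      pend (next_pc e (Suc i)) = [] \<and> cont (next_pc e (Suc i)) = K"
    if K: "e i = Pc K" for i K
  proof -
    let ?k = "next_pc e (Suc i)"
    have k: "pend ?k = []" "cont ?k = K" "store ?k = store (Suc i)" "\<And>j. store (Suc i) j = ticks e j (Suc i)"
      using line[of i] after[OF K] st[of ?k] by auto
    have "\<And>j. ticks e j (Suc ?k) = store (Suc ?k) j"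
      using line[of ?k] after[of ?k] e_Nil[OF k(1)] by auto
    then show ?thesis using e_Nil[OF k(1)] k by simp
  qed
  have wf: "well_formed e" unfolding well_formed_def
  proof (intro conjI allI impI)
    fix i K assume K: "e i = Pc K"
    show "\<exists>K'. e (next_pc e (Suc i)) = Pc K' \<and> succ_cont K (ticks e (test_reg K) (Suc i) = 0) K'"
      using next_line[OF K] c d unfolding succ_cont_def by auto
    show "ticks e j (Suc (next_pc e (Suc i))) = upd_reg K j (ticks e j (Suc i))" for j
      using next_line[OF K] by blast
  qed (use zero inf in auto)
  \<comment> \<open>An \<open>In\<close> label begins a line that follows a waiting line; there the
    writer has just used the input \<open>c i\<close> and its own next move.\<close>
  have In: "c' = c i \<and> d' = d (cnt i) \<and> pend i = [] \<and> cont i = []" if lab: "letter_labels (e i) = [In c' d']" for i c' d'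
  proof -
    obtain k where k: "e k = Pc []" "i = next_pc e (Suc k)" using label_stream_well_formed(2)[OF wf lab] by blast
    then show ?thesis using next_line[OF k(1)] lab by (auto simp: entry_def)
  qed
  then show "correct c e" unfolding correct_def using wf by blast
  show cnt: "snd (snd (snd (st i))) = reads e i" for i
  proof (induction i)
    case 0
    then show ?case by (simp add: st0 writer_start_def)
  next
    case (Suc i)
    have "is_read (e i) \<longleftrightarrow> pend i = [] \<and> cont i = []"
      using In[of i] e_Nil[of i] by (auto simp: is_read_def entry_def)
    moreover have "cnt (Suc i) = (if pend i = [] \<and> cont i = [] then Suc (cnt i) else cnt i)"
      using e_Nil[of i] e_Cons[of i] by (cases "pend i") auto
    ultimately show ?case using Suc by (simp add: reads_Suc cnt_def)
  qed
  show "letter_labels (e i) = [In c' d'] \<Longrightarrow> d' = d (reads e i)"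
    using In[of i c' d'] cnt[of i] by (simp add: cnt_def)
qed

end

section \<open>Transfer of winning strategies\<close>

locale coded_game = machine +
  fixes L :: "nat word set" and f :: "letter \<Rightarrow> nat"
  assumes inj: "inj_on f alphabet"
    and L: "x \<in> omega_words X \<Longrightarrow>
      x \<in> L \<longleftrightarrow> (\<exists>y\<in>omega_words {0, 1}. \<exists>\<^sub>\<infinity>n. G (rounds_code x (Suc n)) (binval y n) \<noteq> 0)"
begin

definition default :: nat where "default = (SOME c. c \<in> X)"
definition dec :: "nat \<Rightarrow> letter" where "dec = inv_into alphabet f"
text \<open>Every letter of Player 1 denotes a legal move, with \<open>default\<close> for letters
  that code none; thus only Player 2 can break the rules.\<close>

definition input :: "nat \<Rightarrow> nat" where
  "input v = (case dec v of Tick c \<Rightarrow> if c \<in> X then c else default | Pc K \<Rightarrow> default)"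

lemma default: "default \<in> X"
  unfolding default_def using neX by (simp add: some_in_eq)

lemma input: "input v \<in> X"
  unfolding input_def using default by (auto split: letter.split)

lemma dec: "a \<in> alphabet \<Longrightarrow> dec (f a) = a"
  unfolding dec_def using inj by simp

lemma dec_alphabet: "v \<in> f ` alphabet \<Longrightarrow> dec v \<in> alphabet"
  unfolding dec_def by (rule inv_into_into)

lemma input_Tick: "c \<in> X \<Longrightarrow> input (f (Tick c)) = c"
  unfolding input_def using dec[of "Tick c"] reg_bound(2) by (simp add: alphabet_def)

abbreviation Y :: "(nat \<times> nat) set" where "Y \<equiv> f ` alphabet \<times> f ` alphabet"

text \<open>The run is written on both tapes at once, one copy for each head.\<close>

definition both :: "letter \<Rightarrow> nat \<times> nat" where "both a = (f a, f a)"

lemma both: "a \<in> alphabet \<Longrightarrow> both a \<in> Y"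
  by (simp add: both_def)

definition inputs :: "(nat \<times> nat) word \<Rightarrow> nat \<Rightarrow> nat" where "inputs z i = input (fst (z (2 * i)))"
definition tape1 :: "(nat \<times> nat) word \<Rightarrow> nat \<Rightarrow> letter" where "tape1 z i = dec (fst (z (2 * i + 1)))"
definition tape2 :: "(nat \<times> nat) word \<Rightarrow> nat \<Rightarrow> letter" where "tape2 z i = dec (snd (z (2 * i + 1)))"

end

locale rational_game = coded_game +
  fixes A :: "(nat \<times> nat) word set"
  assumes A: "z \<in> omega_words Y \<Longrightarrow>
    z \<in> A \<longleftrightarrow> heads_accept delta Init final_states (\<lambda>i. (inputs z i, tape1 z i)) (tape2 z)"
begin

lemma incorrect_in_A:
  assumes z: "z \<in> omega_words Y" and "\<not> (tape1 z = tape2 z \<and> correct (inputs z) (tape1 z))"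
  shows "z \<in> A"
proof -
  have "tape1 z i \<in> alphabet" for i
    unfolding tape1_def by (rule dec_alphabet) (use omega_wordsD[OF z, of "2 * i + 1"] in auto)
  then show ?thesis using complete_error assms A by blast
qed

text \<open>On a correct run the acceptor can succeed only by following a branch, and such branches
  exist exactly for \<open>x \<in> L\<close>.\<close>

lemma correct_in_A_iff:
  assumes z: "z \<in> omega_words Y" and eq: "tape1 z = tape2 z" and cor: "correct (inputs z) (tape1 z)"
    and x: "x \<in> omega_words X" "label_stream G x (\<lambda>i. letter_labels (tape1 z i))"
  shows "z \<in> A \<longleftrightarrow> x \<in> L"
proof -
  interpret correct_run X G prog x "tape1 z" "inputs z" by unfold_locales (use x cor in auto)
  have "z \<in> A \<longleftrightarrow> heads_accept delta Init final_states (\<lambda>i. (inputs z i, tape1 z i)) (tape1 z)"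
    using A[OF z] eq by simp
  also have "\<dots> \<longleftrightarrow> (\<exists>y\<in>omega_words {0, 1}. \<exists>\<^sub>\<infinity>n. G (rounds_code x (Suc n)) (binval y n) \<noteq> 0)"
    using sound complete_branch by blast
  finally show ?thesis using L[OF x(1)] by simp
qed

lemma stream_of_correct:
  "correct p e \<Longrightarrow> \<exists>x. x \<in> omega_words X \<and> label_stream G x (\<lambda>i. letter_labels (e i))"
  using label_stream_well_formed(1) correct_def by blast

definition encoded_play :: "(nat \<times> nat) word \<Rightarrow> nat word" where
  "encoded_play z = (SOME x. x \<in> omega_words X \<and> label_stream G x (\<lambda>i. letter_labels (tape1 z i)))"

lemma encoded_play:
  assumes "correct (inputs z) (tape1 z)"
  shows "encoded_play z \<in> omega_words X" "label_stream G (encoded_play z) (\<lambda>i. letter_labels (tape1 z i))"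
  using someI_ex[OF stream_of_correct[OF assms]] unfolding encoded_play_def by auto

definition writer_after :: "(nat \<Rightarrow> nat) \<Rightarrow> ((nat \<times> nat) \<times> (nat \<times> nat)) list \<Rightarrow> writer" where
  "writer_after d h = foldl (\<lambda>st r. snd (emit d (input (fst (fst r))) st)) writer_start h"

definition honest :: "(nat \<Rightarrow> nat) \<Rightarrow> ((nat \<times> nat) \<times> (nat \<times> nat)) list \<Rightarrow> nat \<times> nat \<Rightarrow> nat \<times> nat" where
  "honest d h a = both (fst (emit d (input (fst a)) (writer_after d h)))"

lemma honest_play:
  assumes d: "\<And>i. d i \<in> X" and \<sigma>: "strategy1 Y \<sigma>"
  defines "z \<equiv> play \<sigma> (honest d)"
  shows "z \<in> omega_words Y" "tape1 z = tape2 z" "correct (inputs z) (tape1 z)"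
    "letter_labels (tape1 z i) = [In c' d'] \<Longrightarrow> d' = d (reads (tape1 z) i)"
    "tape1 z i = fst (emit d (inputs z i) (writer_after d (history \<sigma> (honest d) i)))"
    "writer_after d (history \<sigma> (honest d) (Suc i)) = snd (emit d (inputs z i) (writer_after d (history \<sigma> (honest d) i)))"
    "snd (snd (snd (writer_after d (history \<sigma> (honest d) i)))) = reads (tape1 z) i"
proof -
  let ?h = "history \<sigma> (honest d)"
  define st where "st i = writer_after d (?h i)" for i
  define e where "e i = fst (emit d (inputs z i) (st i))" for i
  have inputs: "inputs z i = input (fst (\<sigma> (?h i)))" for i by (simp add: inputs_def z_def play_even)
  have st0: "st 0 = writer_start" by (simp add: st_def writer_after_def)
  have stS: "st (Suc i) = snd (emit d (inputs z i) (st i))" for i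
    by (simp add: st_def writer_after_def inputs)
  have inX: "inputs z i \<in> X" for i by (simp add: inputs input)
  note hc = honest_correct[where st = st and d = d and c = "inputs z" and e = e, OF st0 stS e_def inX d]
  have odd: "z (Suc (2 * i)) = both (e i)" for i
    by (simp add: z_def play_odd honest_def e_def st_def inputs[unfolded z_def, symmetric])
  have tapes: "tape1 z i = e i" "tape2 z i = e i" for i
    using odd[of i] dec[OF hc(2)] by (simp_all add: tape1_def tape2_def both_def)
  then have t: "tape1 z = e" "tape2 z = e" by auto
  show "z \<in> omega_words Y" unfolding z_def
  proof (rule play_in_omega_words)
    fix n assume "?h n \<in> lists (Y \<times> Y)"
    then have "\<sigma> (?h n) \<in> Y" using \<sigma> unfolding strategy1_def by (rule funcset_mem[rotated])
    moreover have "honest d (?h n) (\<sigma> (?h n)) = both (e n)"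
      using odd[of n] by (simp add: z_def play_odd)
    ultimately show "\<sigma> (?h n) \<in> Y \<and> honest d (?h n) (\<sigma> (?h n)) \<in> Y" using both[OF hc(2)] by simp
  qed
  show "tape1 z = tape2 z" using t by simp
  show "correct (inputs z) (tape1 z)" unfolding t by (rule hc(1))
  show "letter_labels (tape1 z i) = [In c' d'] \<Longrightarrow> d' = d (reads (tape1 z) i)" unfolding t by (rule hc(3))
  show "tape1 z i = fst (emit d (inputs z i) (writer_after d (?h i)))" unfolding t e_def st_def ..
  show "writer_after d (?h (Suc i)) = snd (emit d (inputs z i) (writer_after d (?h i)))" using stS unfolding st_def .
  show "snd (snd (snd (writer_after d (?h i)))) = reads (tape1 z) i" unfolding t using hc(4) unfolding st_def .
qed

text \<open>An emission uses \<open>d\<close> only at the number of rounds read so far, and doing so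
  raises that number.\<close>

lemma emit_cong:
  assumes "snd (snd (snd (snd (emit d c st)))) \<le> N" "\<And>k. k < N \<Longrightarrow> d k = d' k"
  shows "emit d c st = emit d' c st"
proof -
  obtain l K s m where st: "st = (l, K, s, m)" by (cases st)
  show ?thesis
  proof (cases l)
    case Nil
    then show ?thesis using assms unfolding st by (auto simp: Let_def split: if_splits)
  qed (simp add: st)
qed

text \<open>The move \<open>d N\<close> is first used at the position where round \<open>N\<close>
  is read. Before it both plays coincide, and the letter of Player 1 at this position is fixed by
  the common history before Player 2 answers.\<close>

lemma honest_play_causal:
  assumes d: "\<And>i. d i \<in> X" "\<And>i. d' i \<in> X" and \<sigma>: "strategy1 Y \<sigma>" and eq: "\<And>k. k < N \<Longrightarrow> d k = d' k"
  shows "encoded_play (play \<sigma> (honest d)) (2 * N) = encoded_play (play \<sigma> (honest d')) (2 * N)"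
proof -
  let ?z = "play \<sigma> (honest d)" and ?z' = "play \<sigma> (honest d')"
  let ?h = "history \<sigma> (honest d)" and ?h' = "history \<sigma> (honest d')"
  note H = honest_play[of d, OF d(1) \<sigma>] and H' = honest_play[of d', OF d(2) \<sigma>]
  have same: "?h i = ?h' i \<and> writer_after d (?h i) = writer_after d' (?h' i)"
    if "reads (tape1 ?z) i \<le> N" for i using that
  proof (induction i)
    case 0
    then show ?case by (simp add: writer_after_def)
  next
    case (Suc i)
    have IH: "?h i = ?h' i" "writer_after d (?h i) = writer_after d' (?h' i)"
      using Suc reads_mono[of i "Suc i" "tape1 ?z"] by auto
    have in_eq: "inputs ?z' i = inputs ?z i" using IH(1) by (simp add: inputs_def play_even)
    have w: "emit d (inputs ?z i) (writer_after d (?h i)) = emit d' (inputs ?z' i) (writer_after d' (?h' i))"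
      unfolding in_eq IH(2)[symmetric]
      by (rule emit_cong[OF _ eq]) (use H(7)[of "Suc i"] H(6)[of i] Suc.prems in simp)
    then have "writer_after d (?h (Suc i)) = writer_after d' (?h' (Suc i))" unfolding H(6) H'(6) by simp
    moreover have "?h (Suc i) = ?h' (Suc i)"
      using IH w by (simp add: honest_def inputs_def play_even)
    ultimately show ?case by blast
  qed
  note ex = encoded_play[OF H(3)] encoded_play[OF H'(3)]
  obtain i c a where i: "letter_labels (tape1 ?z i) = [In c a]" "reads (tape1 ?z) i = N"
    using label_stream_ex_read[OF ex(2)] by metis
  have tape_eq: "tape1 ?z k = tape1 ?z' k" if "k < i" for k
  proof -
    have r: "reads (tape1 ?z) (Suc k) \<le> N" using reads_mono[of "Suc k" i "tape1 ?z"] that i by simp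
    then have "?h (Suc k) = ?h' (Suc k)" using same by blast
    then have "snd (last (?h (Suc k))) = snd (last (?h' (Suc k)))" by (simp only:)
    then have "?z (Suc (2 * k)) = ?z' (Suc (2 * k))" by (simp add: play_odd)
    then show ?thesis by (simp add: tape1_def)
  qed
  have s: "?h i = ?h' i" "writer_after d (?h i) = writer_after d' (?h' i)" using same[of i] i(2) by blast+
  have in_eq: "inputs ?z' i = inputs ?z i" using s(1) by (simp add: inputs_def play_even)
  have c: "c = inputs ?z i" using H(3) i(1) unfolding correct_def by metis
  have reads': "reads (tape1 ?z') i = N" using reads_cong[of i "tape1 ?z" "tape1 ?z'"] tape_eq i(2) by simp
  \<comment> \<open>Here the two writers may use different moves, but the round counter in
    \<open>emit\<close> does not depend on them.\<close>
  have "is_read (tape1 ?z' i)"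
  proof -
    have "reads (tape1 ?z) (Suc i) = Suc N" using i by (auto simp: reads_Suc is_read_def)
    then have "snd (snd (snd (snd (emit d (inputs ?z i) (writer_after d (?h i)))))) = Suc N"
      using H(6)[of i] H(7)[of "Suc i"] by simp
    moreover have "snd (snd (snd (snd (emit d (inputs ?z i) (writer_after d (?h i)))))) =
      snd (snd (snd (snd (emit d' (inputs ?z' i) (writer_after d' (?h' i))))))"
      unfolding in_eq s(2)
    proof -
      obtain l K t m where "writer_after d' (?h' i) = (l, K, t, m)" by (cases "writer_after d' (?h' i)")
      then show "snd (snd (snd (snd (emit d (inputs ?z i) (writer_after d' (?h' i)))))) =
        snd (snd (snd (snd (emit d' (inputs ?z i) (writer_after d' (?h' i))))))" by (cases l) (simp_all add: Let_def)
    qed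
    ultimately have "reads (tape1 ?z') (Suc i) = Suc N" using H'(6)[of i] H'(7)[of "Suc i"] by simp
    then show ?thesis using reads' by (auto simp: reads_Suc split: if_splits)
  qed
  then obtain c' a' where i': "letter_labels (tape1 ?z' i) = [In c' a']" unfolding is_read_def by blast
  have c': "c' = inputs ?z' i" using H'(3) i' unfolding correct_def by metis
  show ?thesis
    using label_stream_read[OF ex(2) i(1)] label_stream_read[OF ex(4) i'] i(2) reads' c c' in_eq by simp
qed

text \<open>Extends a finite history to the infinite sequence that a simulation asks for; by
  causality every extension gives the same answer to the history.\<close>

definition padded :: "nat list \<Rightarrow> nat \<Rightarrow> nat" where
  "padded xs n = (if n < length xs then xs ! n else default)"

lemma padded: "xs \<in> lists X \<Longrightarrow> padded xs n \<in> X"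
  unfolding padded_def using default by (auto simp: in_lists_conv_set)

text \<open>\<open>\<sigma>'\<close> simulates \<open>\<sigma>\<close> against the honest writer
  that plays the moves of the history. A play \<open>y\<close> following \<open>\<sigma>'\<close> is
  the encoded play for the full sequence \<open>d\<close> of the answers in \<open>y\<close>, and it
  is in \<open>L\<close> because the simulated play is in \<open>A\<close>.\<close>

lemma transfer1:
  assumes win: "winning1 Y A \<sigma>"
  shows "\<exists>\<sigma>'. winning1 X L \<sigma>'"
proof -
  have \<sigma>: "strategy1 Y \<sigma>" using win by (simp add: winning1_def)
  have inL: "encoded_play (play \<sigma> (honest d)) \<in> L" if "\<And>i. d i \<in> X" for d
  proof -
    note H = honest_play[of d, OF that \<sigma>]
    have "play \<sigma> (honest d) \<in> A" using win H(1) follows1_play unfolding winning1_def by blast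
    then show ?thesis using correct_in_A_iff[OF H(1-3) encoded_play[OF H(3)]] by blast
  qed
  have odd: "encoded_play (play \<sigma> (honest d)) (Suc (2 * n)) = d n" if "\<And>i. d i \<in> X" for d n
  proof -
    note H = honest_play[of d, OF that \<sigma>]
    obtain i c a where i: "letter_labels (tape1 (play \<sigma> (honest d)) i) = [In c a]" "reads (tape1 (play \<sigma> (honest d))) i = n"
      using label_stream_ex_read[OF encoded_play(2)[OF H(3)]] by metis
    then show ?thesis using label_stream_read[OF encoded_play(2)[OF H(3)] i(1)] H(4)[OF i(1)] by simp
  qed
  define \<sigma>' :: "(nat \<times> nat) list \<Rightarrow> nat" where "\<sigma>' r = encoded_play (play \<sigma> (honest (padded (map snd r)))) (2 * length r)" for r
  have pad: "padded (map snd r) i \<in> X" if "r \<in> lists (X \<times> X)" for r :: "(nat \<times> nat) list" and i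
    by (rule padded) (use that in \<open>auto simp: in_lists_conv_set\<close>)
  have "winning1 X L \<sigma>'" unfolding winning1_def
  proof (intro conjI ballI impI)
    show "strategy1 X \<sigma>'" unfolding strategy1_def
    proof
      fix r :: "(nat \<times> nat) list" assume r: "r \<in> lists (X \<times> X)"
      have "encoded_play (play \<sigma> (honest (padded (map snd r)))) \<in> omega_words X"
        by (rule encoded_play(1)[OF honest_play(3)[OF pad[OF r] \<sigma>]])
      then show "\<sigma>' r \<in> X" unfolding \<sigma>'_def by (rule omega_wordsD)
    qed
    fix y assume y: "y \<in> omega_words X" "follows1 \<sigma>' y"
    define d where "d n = y (Suc (2 * n))" for n
    have d: "d i \<in> X" for i using omega_wordsD[OF y(1)] by (simp add: d_def)
    have "encoded_play (play \<sigma> (honest d)) (2 * n) = y (2 * n)" for n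
    proof -
      have "encoded_play (play \<sigma> (honest d)) (2 * n) = encoded_play (play \<sigma> (honest (padded (map snd (rounds y n))))) (2 * n)"
        by (rule honest_play_causal[OF d pad \<sigma>])
          (use rounds_in_lists[OF y(1)] in \<open>auto simp: padded_def d_def rounds_nth\<close>)
      then show ?thesis using y(2) by (simp add: follows1_def \<sigma>'_def)
    qed
    moreover have "encoded_play (play \<sigma> (honest d)) (Suc (2 * n)) = y (Suc (2 * n))" for n
      using odd[of d, OF d] by (simp add: d_def)
    ultimately have "encoded_play (play \<sigma> (honest d)) i = y i" for i
      by (cases "even i") (auto elim!: evenE oddE)
    then have "encoded_play (play \<sigma> (honest d)) = y" by auto
    then show "y \<in> L" using inL[of d, OF d] by simp
  qed
  then show ?thesis by blast
qed

text \<open>Player 1 repeats its next move until the run reads it; the number of read letters in the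
  history tells which move is the next one.\<close>

definition feed :: "(nat \<Rightarrow> nat) \<Rightarrow> ((nat \<times> nat) \<times> (nat \<times> nat)) list \<Rightarrow> nat \<times> nat" where
  "feed c h = both (Tick (c (length (filter (\<lambda>r. is_read (dec (fst (snd r)))) h))))"

text \<open>A winning \<open>\<tau>\<close> keeps the play outside \<open>A\<close>, and every
  incorrect play is in \<open>A\<close>; so \<open>\<tau>\<close> itself writes a correct run on
  both tapes.\<close>

lemma feed_play:
  assumes c: "\<And>i. c i \<in> X" and win: "winning2 Y A \<tau>"
  defines "z \<equiv> play (feed c) \<tau>"
  shows "z \<in> omega_words Y" "z \<notin> A" "tape1 z = tape2 z" "correct (inputs z) (tape1 z)"
    "inputs z i = c (reads (tape1 z) i)"
    "length (filter (\<lambda>r. is_read (dec (fst (snd r)))) (history (feed c) \<tau> i)) = reads (tape1 z) i"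
proof -
  let ?h = "history (feed c) \<tau>"
  have cnt: "length (filter (\<lambda>r. is_read (dec (fst (snd r)))) (?h i)) = reads (tape1 z) i" for i
    by (induction i) (auto simp: reads_Suc tape1_def z_def play_odd)
  then show "length (filter (\<lambda>r. is_read (dec (fst (snd r)))) (?h i)) = reads (tape1 z) i" .
  have al: "Tick (c i) \<in> alphabet" for i using reg_bound(2)[OF c] by (simp add: alphabet_def)
  show "inputs z i = c (reads (tape1 z) i)"
    using cnt[of i] input_Tick[OF c] by (simp add: inputs_def z_def play_even feed_def both_def)
  show z: "z \<in> omega_words Y" unfolding z_def
  proof (rule play_in_omega_words)
    fix n assume h: "?h n \<in> lists (Y \<times> Y)"
    have "feed c (?h n) \<in> Y" unfolding feed_def by (rule both[OF al])
    moreover have "\<tau> (?h n) \<in> Y \<rightarrow> Y" using win h unfolding winning2_def strategy2_def by (blast intro: funcset_mem)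
    ultimately show "feed c (?h n) \<in> Y \<and> \<tau> (?h n) (feed c (?h n)) \<in> Y" by (blast intro: funcset_mem)
  qed
  show "z \<notin> A" using win z follows2_play unfolding winning2_def z_def by blast
  then show "tape1 z = tape2 z" "correct (inputs z) (tape1 z)" using incorrect_in_A[OF z] by blast+
qed

text \<open>Here \<open>k = N\<close> is included, since Player 2 answers in round \<open>N\<close>
  after seeing the move \<open>c N\<close>.\<close>

lemma feed_play_causal:
  assumes c: "\<And>i. c i \<in> X" "\<And>i. c' i \<in> X" and win: "winning2 Y A \<tau>" and eq: "\<And>k. k \<le> N \<Longrightarrow> c k = c' k"
  shows "encoded_play (play (feed c) \<tau>) (Suc (2 * N)) = encoded_play (play (feed c') \<tau>) (Suc (2 * N))"
proof -
  let ?z = "play (feed c) \<tau>" and ?z' = "play (feed c') \<tau>"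
  let ?h = "history (feed c) \<tau>" and ?h' = "history (feed c') \<tau>"
  note H = feed_play[of c, OF c(1) win] and H' = feed_play[of c', OF c(2) win]
  have feed_eq: "feed c (?h i) = feed c' (?h i)" if "reads (tape1 ?z) i \<le> N" for i
    unfolding feed_def[of c "?h i"] feed_def[of c' "?h i"] H(6) using eq[OF that] by simp
  have same: "?h i = ?h' i" if "reads (tape1 ?z) i \<le> N" for i
    using that
  proof (induction i)
    case (Suc i)
    have r: "reads (tape1 ?z) i \<le> N" using Suc.prems reads_mono[of i "Suc i" "tape1 ?z"] by simp
    then have "?h i = ?h' i" by (rule Suc.IH)
    then show ?case using feed_eq[OF r] by simp
  qed simp
  note ex = encoded_play(2)[OF H(4)] encoded_play(2)[OF H'(4)]
  obtain i a b where i: "letter_labels (tape1 ?z i) = [In a b]" "reads (tape1 ?z) i = N"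
    using label_stream_ex_read[OF ex(1)] by metis
  have tape_eq: "tape1 ?z k = tape1 ?z' k" if "k \<le> i" for k
  proof -
    have r: "reads (tape1 ?z) k \<le> N" using reads_mono[of k i "tape1 ?z"] that i by simp
    show ?thesis using same[OF r] feed_eq[OF r] by (simp add: tape1_def play_odd)
  qed
  have "reads (tape1 ?z') i = N" using reads_cong[of i "tape1 ?z" "tape1 ?z'"] tape_eq i(2) by simp
  then show ?thesis using label_stream_read[OF ex(1) i(1)] label_stream_read[OF ex(2), of i a b] i tape_eq[of i] by simp
qed

text \<open>The honest writer of \<open>transfer1\<close> is replaced by \<open>\<tau>\<close>: its
  answers in the original game are read off the run that it writes when the moves of the history are
  fed to it.\<close>

lemma transfer2:
  assumes win: "winning2 Y A \<tau>"
  shows "\<exists>\<tau>'. winning2 X L \<tau>'"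
proof -
  have notL: "encoded_play (play (feed c) \<tau>) \<notin> L" if "\<And>i. c i \<in> X" for c
  proof -
    note H = feed_play[of c, OF that win]
    show ?thesis using correct_in_A_iff[OF H(1,3,4) encoded_play[OF H(4)]] H(2) by blast
  qed
  have even: "encoded_play (play (feed c) \<tau>) (2 * n) = c n" if "\<And>i. c i \<in> X" for c n
  proof -
    note H = feed_play[of c, OF that win]
    obtain i a b where i: "letter_labels (tape1 (play (feed c) \<tau>) i) = [In a b]" "reads (tape1 (play (feed c) \<tau>)) i = n"
      using label_stream_ex_read[OF encoded_play(2)[OF H(4)]] by metis
    have "a = inputs (play (feed c) \<tau>) i" using H(4) i(1) unfolding correct_def by metis
    then show ?thesis using label_stream_read[OF encoded_play(2)[OF H(4)] i(1)] H(5)[of i] i(2) by simp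
  qed
  define \<tau>' :: "(nat \<times> nat) list \<Rightarrow> nat \<Rightarrow> nat" where "\<tau>' r a = encoded_play (play (feed (padded (map fst r @ [a]))) \<tau>) (Suc (2 * length r))" for r a
  have pad: "padded (map fst r @ [a]) i \<in> X" if "r \<in> lists (X \<times> X)" "a \<in> X" for r :: "(nat \<times> nat) list" and a i
    by (rule padded) (use that in \<open>auto simp: in_lists_conv_set\<close>)
  have "winning2 X L \<tau>'" unfolding winning2_def
  proof (intro conjI ballI impI)
    show "strategy2 X \<tau>'" unfolding strategy2_def
    proof (intro funcsetI)
      fix r :: "(nat \<times> nat) list" and a assume r: "r \<in> lists (X \<times> X)" "a \<in> X"
      have "encoded_play (play (feed (padded (map fst r @ [a]))) \<tau>) \<in> omega_words X"
        by (rule encoded_play(1)[OF feed_play(4)[OF pad[OF r] win]])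
      then show "\<tau>' r a \<in> X" unfolding \<tau>'_def by (rule omega_wordsD)
    qed
    fix y assume y: "y \<in> omega_words X" "follows2 \<tau>' y"
    define c where "c n = y (2 * n)" for n
    have c: "c i \<in> X" for i using omega_wordsD[OF y(1)] by (simp add: c_def)
    have "encoded_play (play (feed c) \<tau>) (Suc (2 * n)) = y (Suc (2 * n))" for n
    proof -
      have "encoded_play (play (feed c) \<tau>) (Suc (2 * n)) =
        encoded_play (play (feed (padded (map fst (rounds y n) @ [y (2 * n)]))) \<tau>) (Suc (2 * n))"
        by (rule feed_play_causal[OF c pad win])
          (use rounds_in_lists[OF y(1)] omega_wordsD[OF y(1)] in
            \<open>auto simp: padded_def c_def rounds_nth nth_append less_Suc_eq_le le_less\<close>)
      then show ?thesis using y(2) by (simp add: follows2_def \<tau>'_def)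
    qed
    moreover have "encoded_play (play (feed c) \<tau>) (2 * n) = y (2 * n)" for n
      using even[of c, OF c] by (simp add: c_def)
    ultimately have "encoded_play (play (feed c) \<tau>) i = y i" for i
      by (cases "even i") (auto elim!: evenE oddE)
    then have "encoded_play (play (feed c) \<tau>) = y" by auto
    then show "y \<notin> L" using notL[of c, OF c] by simp
  qed
  then show ?thesis by blast
qed

end

lemma determined_no_letters: "determined {} L"
proof -
  have "winning2 {} L (\<lambda>r c. c)" by (auto simp: winning2_def strategy2_def omega_words_def)
  then show ?thesis unfolding determined_def by blast
qed

lemma Det_Sigma11_if_Det_RAT:
  assumes "Det_RAT"
  shows "Det_Sigma11"
  unfolding Det_Sigma11_def
proof (intro allI impI)
  fix X :: "nat set" and L
  assume "finite X \<and> Sigma11 X L"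
  then have fin: "finite X" and S: "Sigma11 X L" by auto
  show "determined X L"
  proof (cases "X = {}")
    \<comment> \<open>\<open>machine\<close> requires a letter; without letters there are no plays,
      and any strategy of Player 2 wins.\<close>
    case True
    then show ?thesis by (simp add: determined_no_letters)
  next
    case False
    obtain P where P: "Pi02 (prod_encode ` (X \<times> {0, 1})) P"
      "L = {x \<in> omega_words X. \<exists>y \<in> omega_words {0, 1}. (\<lambda>i. prod_encode (x i, y i)) \<in> P}"
      using S unfolding Sigma11_def by blast
    obtain G where G: "computable (\<lambda>z. G (pfst z) (psnd z))"
      "\<And>x y. x \<in> omega_words X \<Longrightarrow> y \<in> omega_words {0, 1} \<Longrightarrow>
        (\<lambda>i. prod_encode (x i, y i)) \<in> P \<longleftrightarrow> (\<exists>\<^sub>\<infinity>n. G (rounds_code x (Suc n)) (binval y n) \<noteq> 0)"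
      using Pi02_normal_form[OF P(1)] by blast
    obtain prog where prog: "\<And>c d s. let C = push_round c d (s 0) in
      \<exists>s'. exec (prog c d) s (node_labels (G C) (level_size C) @ [End]) s' \<and> s' 0 = C"
      using round_program[OF G(1)] by metis
    interpret machine X G prog by unfold_locales (use fin False prog in auto)
    have "finite alphabet" unfolding alphabet_def using finite_pcs by simp
    then obtain f :: "letter \<Rightarrow> nat" where f: "inj_on f alphabet" using finite_imp_inj_to_nat_seg by blast
    interpret coded_game X G prog L f
      by unfold_locales (use f P(2) G(2) in auto)
    let ?S = "f ` alphabet"
    \<comment> \<open>The acceptor on coded rounds: head 1 decodes the move of Player 1 and a letter
      of the run, head 2 only the letter of its own copy.\<close>
    define \<delta> where "\<delta> q a b q' = delta q (map_option (\<lambda>(a, b). (input a, dec b)) a) (map_option (\<lambda>(a, b). dec b) b) q'"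
      for q and a b :: "(nat \<times> nat) option" and q'
    obtain M :: "(nat, nat, nat) buchi2" where M: "buchi2_automaton ?S ?S M"
      "\<And>u v. u \<in> omega_words ?S \<Longrightarrow> v \<in> omega_words ?S \<Longrightarrow> accepts M u v \<longleftrightarrow>
        heads_accept \<delta> Init final_states (\<lambda>i. (u (2 * i), u (2 * i + 1))) (\<lambda>i. (v (2 * i), v (2 * i + 1)))"
    proof (rule two_head_rational[of state_set Init final_states ?S \<delta>])
      show "Init \<in> state_set" "final_states \<subseteq> state_set" by (auto simp: state_set_def final_states_def)
      fix q a b q' assume "q \<in> state_set" "\<delta> q a b q'" "set_option a \<subseteq> ?S \<times> ?S" "set_option b \<subseteq> ?S \<times> ?S"
      then show "q' \<in> state_set" unfolding \<delta>_def
        by (elim delta_state_set) (auto simp: option.set_map dec)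
    qed (use finite_state_set \<open>finite alphabet\<close> in auto)
    define A where "A = zip_words (rel_lang ?S ?S M)"
    have A: "z \<in> A \<longleftrightarrow> heads_accept delta Init final_states (\<lambda>i. (inputs z i, tape1 z i)) (tape2 z)"
      if z: "z \<in> omega_words (?S \<times> ?S)" for z
    proof -
      have uv: "(\<lambda>i. fst (z i)) \<in> omega_words ?S" "(\<lambda>i. snd (z i)) \<in> omega_words ?S"
        using omega_wordsD[OF z] by (auto simp: omega_words_def mem_Times_iff)
      have "z \<in> A \<longleftrightarrow> accepts M (\<lambda>i. fst (z i)) (\<lambda>i. snd (z i))"
      proof
        assume "z \<in> A"
        then show "accepts M (\<lambda>i. fst (z i)) (\<lambda>i. snd (z i))" by (auto simp: A_def zip_words_def rel_lang_def)
      next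
        assume "accepts M (\<lambda>i. fst (z i)) (\<lambda>i. snd (z i))"
        then have "(\<lambda>(u, v) i. (u i, v i)) (\<lambda>i. fst (z i), \<lambda>i. snd (z i)) \<in> A"
          unfolding A_def zip_words_def by (intro imageI) (simp add: rel_lang_def uv)
        then show "z \<in> A" by simp
      qed
      also have "\<dots> \<longleftrightarrow> heads_accept \<delta> Init final_states (\<lambda>i. (fst (z (2 * i)), fst (z (2 * i + 1))))
        (\<lambda>i. (snd (z (2 * i)), snd (z (2 * i + 1))))" using M(2)[OF uv] by simp
      also have "\<dots> \<longleftrightarrow> heads_accept delta Init final_states (\<lambda>i. (inputs z i, tape1 z i)) (tape2 z)"
        unfolding heads_accept_def \<delta>_def head_step_map by (simp add: inputs_def tape1_def tape2_def[abs_def])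
      finally show ?thesis .
    qed
    interpret rational_game X G prog L f A
      by unfold_locales (use A in auto)
    have "finite ?S" using \<open>finite alphabet\<close> by simp
    then have "determined (?S \<times> ?S) A"
      using assms M(1) unfolding Det_RAT_def inf_rational_def A_def by blast
    then show "determined X L" unfolding determined_def using transfer1 transfer2 by blast
  qed
qed

theorem theorem3p5:
  shows "Det_Sigma11 \<longleftrightarrow> Det_RAT"
  using Det_RAT_if_Det_Sigma11 Det_Sigma11_if_Det_RAT by blast

end
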